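(* For a positive integer $t$ let $p^{(t)}(n)$ denote the $t$-core partition function, i.e. $\sum_{n\ge 0}p^{(t)}(n)q^n=\prod_{n\ge1}\frac{(1-q^{tn})^t}{1-q^n}$. Then: (i) $$C^{(7)}(z,\tau) = \prod_{n=1}^\infty\frac{(1-q^n)(1-q^{7n})^3(1-\zeta^{\pm2}q^{7n})(1-\zeta^{\pm 4}q^{7n})}{(1-\zeta^{\pm1}q^n)}$$ explains $p^{(7)}(21n+\beta)\equiv 0\pmod 3$, where $\beta\in\{8,11,17\}$; (ii) $$C^{(11)}(z,\tau) = \prod_{n=1}^\infty\frac{(1-q^n)(1-q^{11n})^3(1-\zeta^{\pm2}q^{11n})(1-\zeta^{\pm 4}q^{11n})(1-\zeta^{\pm 8}q^{11n})(1-\zeta^{\pm 10}q^{11n})}{(1-\zeta^{\pm1}q^n)}$$ explains $p^{(11)}(33n+\beta)\equiv 0\pmod 3$, where $\beta\in\{11,20,26,29,32\}$; (iii) $$C^{(17)}(z,\tau) = \prod_{n=1}^\infty\frac{(1-q^n)(1-q^{17n})^5(1-\zeta^{\pm2}q^{17n})(1-\zeta^{\pm 4}q^{17n})(1-\zeta^{\pm 8}q^{17n})(1-\zeta^{\pm 10}q^{17n})(1-\zeta^{\pm 14}q^{17n})(1-\zeta^{\pm 16}q^{17n})}{(1-\zeta^{\pm1}q^n)}$$ explains $p^{(17)}(51n+\beta)\equiv 0\pmod 3$, where $\beta\in\{14,20,23,26,35,38,41,47\}$; (iv) $$C^{(19)}(z,\tau) = \prod_{n=1}^\infty\frac{(1-q^n)(1-q^{19n})^7(1-\zeta^{\pm2}q^{19n})(1-\zeta^{\pm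 4}q^{19n})(1-\zeta^{\pm 8}q^{19n})(1-\zeta^{\pm 10}q^{19n})(1-\zeta^{\pm 14}q^{19n})(1-\zeta^{\pm 16}q^{19n})}{(1-\zeta^{\pm1}q^n)}$$ explains $p^{(19)}(57n+\beta)\equiv 0\pmod 3$, where $\beta\in\{14,17,26,35,38,41,44,50,56\}$. That is, for each $t\in\{7,11,17,19\}$: setting $\zeta=1$ in $C^{(t)}(z,\tau)$ gives $\sum_{n\ge0}p^{(t)}(n)q^n$, and for every $\beta$ in the corresponding listed set and every integer $n\ge0$, the polynomial $\Phi_3(\zeta)=1+\zeta+\zeta^2$ divides $[q^{3tn+\beta}]\,C^{(t)}(z,\tau)$ in $\mathbb{Z}[\zeta,\zeta^{-1}]$.
   Context: Here $q=e^{2\pi i\tau}$ and $\zeta=e^{2\pi i z}$; $q$ and $\zeta$ may be treated as formal variables, and products are expanded as power series in $q$ with coefficients in $\mathbb{Z}[\zeta,\zeta^{-1}]$. Setting $z=0$ means setting $\zeta=1$. The shorthand $(1-\zeta^{\pm k}q^n)$ means $(1-\zeta^{k}q^n)(1-\zeta^{-k}q^n)$. The notation $[q^m]C(z,\tau)$ denotes the coefficient of $q^m$ in $C(z,\tau)$, a Laurent polynomial in $\zeta$. $\Phi_\ell$ denotes the $\ell$-th cyclotomic polynomial. Definition: given a generating function $\sum_{n\ge0}a(n)q^n$ satisfying $a(\alpha n+\beta)\equiv 0\pmod \ell$ for all $n\ge 0$, with $\alpha,\beta$ positive integers and $\ell$ a prime, a series $C(z,\tau)$ in $q$ with coefficients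 in $\mathbb{Z}[\zeta,\zeta^{-1}]$ is said to explain the congruence if and only if $C(0,\tau)=\sum_{n\ge0}a(n)q^n$ and $\Phi_\ell(\zeta)\mid[q^{\alpha n+\beta}]C(z,\tau)$ for all $n\ge0$. *)

theory Defs
  imports
    "HOL-Analysis.Analysis"
    "HOL-Computational_Algebra.Computational_Algebra"
    "HOL-Number_Theory.Cong"
    "HOL-Library.Poly_Mapping"
begin

section \<open>Laurent polynomials with integer coefficients\<close>

text \<open>The convolution product of \<^typ>\<open>int \<Rightarrow>\<^sub>0 int\<close> adds exponents, so this type is the ring
  of Laurent polynomials in one variable \<open>\<zeta>\<close> over the integers.\<close>

type_synonym laurent = "int \<Rightarrow>\<^sub>0 int"

definition zeta_pow :: "int \<Rightarrow> laurent" where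
  "zeta_pow k = Poly_Mapping.single k 1"

text \<open>The value at \<open>\<zeta> = 1\<close>, that is, the sum of all coefficients.\<close>

definition at_zeta_one :: "laurent \<Rightarrow> int" where
  "at_zeta_one L = (\<Sum>k\<in>Poly_Mapping.keys L. Poly_Mapping.lookup L k)"

definition fps_at_zeta_one :: "laurent fps \<Rightarrow> int fps" where
  "fps_at_zeta_one C = Abs_fps (\<lambda>n. at_zeta_one (fps_nth C n))"

definition poly_at_zeta :: "int poly \<Rightarrow> laurent" where
  "poly_at_zeta p = poly (map_poly of_int p) (zeta_pow 1)"


section \<open>Cyclotomic polynomials\<close>

definition cyclotomic_poly :: "nat \<Rightarrow> int poly" where
  "cyclotomic_poly n = (THE p. map_poly (of_int :: int \<Rightarrow> complex) p =
     (\<Prod>k\<in>{k\<in>{1..n}. coprime k n}. [:- cis (2 * pi * real k / real n), 1:]))"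

lemma cyclotomic_polyI:
  assumes "map_poly (of_int :: int \<Rightarrow> complex) p =
     (\<Prod>k\<in>{k\<in>{1..n}. coprime k n}. [:- cis (2 * pi * real k / real n), 1:])"
  shows "cyclotomic_poly n = p"
  unfolding cyclotomic_poly_def
proof (rule the_equality)
  fix p' :: "int poly"
  assume "map_poly (of_int :: int \<Rightarrow> complex) p' =
     (\<Prod>k\<in>{k\<in>{1..n}. coprime k n}. [:- cis (2 * pi * real k / real n), 1:])"
  with assms have "map_poly (of_int :: int \<Rightarrow> complex) p' = map_poly of_int p" by simp
  then have "(of_int (coeff p' i) :: complex) = of_int (coeff p i)" for i
    by (metis coeff_map_poly of_int_0)
  then show "p' = p" by (simp add: poly_eq_iff)
qed (rule assms)

lemma cyclotomic_poly_3: "cyclotomic_poly 3 = [:1, 1, 1:]"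
proof (rule cyclotomic_polyI)
  have S: "{k\<in>{1..3::nat}. coprime k 3} = {1, 2}"
  proof -
    have "coprime (2::nat) 3" by (simp add: coprime_iff_gcd_eq_1 gcd_non_0_nat)
    moreover have "k = 1 \<or> k = 2 \<or> k = 3" if "k \<in> {1..3::nat}" for k using that by auto
    ultimately show ?thesis by fastforce
  qed
  have a: "cis (2 * pi / 3) = Complex (-1/2) (sqrt 3 / 2)"
    using cos_120 sin_120 by (simp add: complex_eq_iff)
  have b: "cis (4 * pi / 3) = Complex (-1/2) (- (sqrt 3 / 2))"
  proof -
    have "cis (4 * pi / 3) = cis (2 * pi / 3) * cis (2 * pi / 3)"
      by (simp add: cis_mult)
    then show ?thesis unfolding a by (simp add: complex_eq_iff)
  qed
  have a': "cis (2 * pi * real 1 / real 3) = Complex (-1/2) (sqrt 3 / 2)"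
    and b': "cis (2 * pi * real 2 / real 3) = Complex (-1/2) (- (sqrt 3 / 2))"
    using a b by simp_all
  have "(\<Prod>k\<in>{1, 2::nat}. [:- cis (2 * pi * real k / real 3), 1:]) =
      [:- Complex (-1/2) (sqrt 3 / 2), 1:] * [:- Complex (-1/2) (- (sqrt 3 / 2)), 1:]"
    unfolding a'[symmetric] b'[symmetric] by simp
  also have "\<dots> = [:1, 1, 1:]"
    by (simp add: complex_eq_iff)
  finally show "map_poly (of_int :: int \<Rightarrow> complex) [:1, 1, 1:] =
     (\<Prod>k\<in>{k\<in>{1..3}. coprime k 3}. [:- cis (2 * pi * real k / real 3), 1:])"
    unfolding S by (simp add: map_poly_pCons)
qed


section \<open>Infinite products of power series in \<open>q\<close>\<close>

text \<open>The variable \<open>q\<close> is \<^const>\<open>fps_X\<close>.  The product runs over all \<open>n \<ge> 1\<close>; the limit is taken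
  in the \<open>q\<close>-adic topology.\<close>

definition q_product :: "(nat \<Rightarrow> 'a::comm_ring_1 fps) \<Rightarrow> 'a fps" where
  "q_product f = prodinf (\<lambda>n. f (Suc n))"

text \<open>Power series inversion through \<^const>\<open>inverse\<close> needs an inverse operation on the coefficient
  ring. Here only series with constant coefficient \<open>1\<close> are inverted, and this makes sense over
  every commutative ring.\<close>

abbreviation fps_recip :: "'a::comm_ring_1 fps \<Rightarrow> 'a fps" where
  "fps_recip f \<equiv> fps_right_inverse f 1"

text \<open>The next facts show that \<^const>\<open>q_product\<close> is an actual limit for all products below.\<close>

definition one_mod_q :: "nat \<Rightarrow> 'a::comm_ring_1 fps \<Rightarrow> bool" where
  "one_mod_q n f \<longleftrightarrow> fps_X ^ n dvd f - 1"

lemma one_mod_q_1: "one_mod_q n 1"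
  by (simp add: one_mod_q_def)

lemma one_mod_q_mult:
  assumes "one_mod_q n f" "one_mod_q n g" shows "one_mod_q n (f * g)"
proof -
  have "f * g - 1 = f * (g - 1) + (f - 1)" by (simp add: algebra_simps)
  then show ?thesis using assms unfolding one_mod_q_def by (metis dvd_add dvd_mult)
qed

lemma one_mod_q_power: "one_mod_q n f \<Longrightarrow> one_mod_q n (f ^ k)"
  by (induction k) (auto intro: one_mod_q_1 one_mod_q_mult)

lemma one_mod_q_linear: "n \<le> m \<Longrightarrow> one_mod_q n (1 - c * fps_X ^ m)"
  unfolding one_mod_q_def by (simp add: le_imp_power_dvd)

lemma one_mod_q_linear': "n \<le> m \<Longrightarrow> one_mod_q n (1 - fps_X ^ m)"
  using one_mod_q_linear[of n m 1] by simp

lemma one_mod_q_nth: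
  assumes "one_mod_q n f" "m < n" shows "fps_nth f m = (if m = 0 then 1 else 0)"
proof -
  obtain g where "f - 1 = fps_X ^ n * g" using assms(1) unfolding one_mod_q_def by blast
  then have "f = 1 + fps_X ^ n * g" by (simp add: algebra_simps)
  then show ?thesis using assms(2) by (simp add: fps_X_power_mult_nth)
qed

lemma one_mod_q_recip:
  assumes "one_mod_q n f" "n > 0" shows "one_mod_q n (fps_recip f)"
proof -
  have "f * fps_recip f = 1"
    using one_mod_q_nth[OF assms] by (intro fps_right_inverse) simp
  then have "fps_recip f - 1 = - fps_recip f * (f - 1)" by (simp add: algebra_simps)
  then show ?thesis using assms(1) unfolding one_mod_q_def by (metis dvd_mult)
qed

theorem q_product_limit:
  fixes f :: "nat \<Rightarrow> 'a::idom fps"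
  assumes f: "\<And>n. n \<ge> 1 \<Longrightarrow> one_mod_q n (f n)"
  shows "(\<lambda>n. f (Suc n)) has_prod q_product f"
    and "fps_nth (q_product f) m = fps_nth (\<Prod>n=1..m. f n) m"
proof -
  define P where "P = Abs_fps (\<lambda>m. fps_nth (\<Prod>n=1..m. f n) m)"
  have step: "fps_nth (\<Prod>n=1..m+k. f n) m = fps_nth (\<Prod>n=1..m. f n) m" for m k
  proof (induction k)
    case (Suc k)
    obtain g where "f (Suc (m + k)) - 1 = fps_X ^ Suc (m + k) * g"
      using f[of "Suc (m + k)"] unfolding one_mod_q_def by auto
    then have "f (Suc (m + k)) = 1 + fps_X ^ Suc (m + k) * g" by (simp add: algebra_simps)
    then have "(\<Prod>n=1..m+Suc k. f n) =
        (\<Prod>n=1..m+k. f n) + fps_X ^ Suc (m + k) * (g * (\<Prod>n=1..m+k. f n))"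
      by (simp add: algebra_simps)
    then show ?case using Suc by (simp add: fps_X_power_mult_nth del: power_Suc)
  qed simp
  have "(\<lambda>n. \<Prod>i\<le>n. f (Suc i)) \<longlonglongrightarrow> P"
  proof (rule tendsto_fpsI)
    fix m
    show "\<forall>\<^sub>F n in sequentially. fps_nth (\<Prod>i\<le>n. f (Suc i)) m = fps_nth P m"
      using eventually_ge_at_top[of m]
    proof eventually_elim
      case (elim n)
      have "(\<Prod>i\<le>n. f (Suc i)) = (\<Prod>i=1..Suc n. f i)"
        by (rule prod.reindex_bij_witness[of _ "\<lambda>i. i - 1" Suc]) auto
      also have "fps_nth \<dots> m = fps_nth P m"
        using step[of m "Suc n - m"] elim by (simp add: P_def Suc_diff_le)
      finally show ?case .
    qed
  qed
  moreover have "P \<noteq> 0"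
  proof
    assume "P = 0"
    then have "fps_nth P 0 = 0" by simp
    then show False by (simp add: P_def)
  qed
  ultimately have "(\<lambda>n. f (Suc n)) has_prod P"
    by (simp add: has_prod_def raw_has_prod_def)
  moreover from this have "q_product f = P"
    unfolding q_product_def using has_prod_unique by metis
  ultimately show "(\<lambda>n. f (Suc n)) has_prod q_product f"
    "fps_nth (q_product f) m = fps_nth (\<Prod>n=1..m. f n) m"
    by (simp_all add: P_def)
qed


section \<open>The partition function of \<open>t\<close>-cores\<close>

definition core_factor :: "nat \<Rightarrow> nat \<Rightarrow> int fps" where
  "core_factor t n = (1 - fps_X ^ (t * n)) ^ t * fps_recip (1 - fps_X ^ n)"

definition core_partitions :: "nat \<Rightarrow> nat \<Rightarrow> int" where
  "core_partitions t n = fps_nth (q_product (core_factor t)) n"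


section \<open>Crank-type functions\<close>

text \<open>\<open>pm k m\<close> is \<open>(1 - \<zeta>\<^sup>\<plusminus>\<^sup>k q\<^sup>m) = (1 - \<zeta>\<^sup>k q\<^sup>m) (1 - \<zeta>\<^sup>-\<^sup>k q\<^sup>m)\<close>.\<close>

definition pm :: "int \<Rightarrow> nat \<Rightarrow> laurent fps" where
  "pm k m = (1 - fps_const (zeta_pow k) * fps_X ^ m) * (1 - fps_const (zeta_pow (- k)) * fps_X ^ m)"

definition factor7 :: "nat \<Rightarrow> laurent fps" where
  "factor7 n =
     (1 - fps_X ^ n) * (1 - fps_X ^ (7 * n)) ^ 3
       * pm 2 (7 * n) * pm 4 (7 * n)
       * fps_recip (pm 1 n)"

definition factor11 :: "nat \<Rightarrow> laurent fps" where
  "factor11 n =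
     (1 - fps_X ^ n) * (1 - fps_X ^ (11 * n)) ^ 3
       * pm 2 (11 * n) * pm 4 (11 * n) * pm 8 (11 * n) * pm 10 (11 * n)
       * fps_recip (pm 1 n)"

definition factor17 :: "nat \<Rightarrow> laurent fps" where
  "factor17 n =
     (1 - fps_X ^ n) * (1 - fps_X ^ (17 * n)) ^ 5
       * pm 2 (17 * n) * pm 4 (17 * n) * pm 8 (17 * n) * pm 10 (17 * n)
       * pm 14 (17 * n) * pm 16 (17 * n)
       * fps_recip (pm 1 n)"

definition factor19 :: "nat \<Rightarrow> laurent fps" where
  "factor19 n =
     (1 - fps_X ^ n) * (1 - fps_X ^ (19 * n)) ^ 7
       * pm 2 (19 * n) * pm 4 (19 * n) * pm 8 (19 * n) * pm 10 (19 * n)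
       * pm 14 (19 * n) * pm 16 (19 * n)
       * fps_recip (pm 1 n)"

definition C7 :: "laurent fps" where "C7 = q_product factor7"
definition C11 :: "laurent fps" where "C11 = q_product factor11"
definition C17 :: "laurent fps" where "C17 = q_product factor17"
definition C19 :: "laurent fps" where "C19 = q_product factor19"

lemma one_mod_q_pm: "n \<le> m \<Longrightarrow> one_mod_q n (pm k m)"
  unfolding pm_def by (intro one_mod_q_mult one_mod_q_linear)

lemma one_mod_q_factors:
  assumes "n \<ge> 1"
  shows "t \<ge> 1 \<Longrightarrow> one_mod_q n (core_factor t n)"
    and "one_mod_q n (factor7 n)" and "one_mod_q n (factor11 n)"
    and "one_mod_q n (factor17 n)" and "one_mod_q n (factor19 n)"
  using assms
  unfolding core_factor_def factor7_def factor11_def factor17_def factor19_def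
  by (intro one_mod_q_mult one_mod_q_power one_mod_q_linear' one_mod_q_recip one_mod_q_pm; simp)+


section \<open>Explaining a congruence\<close>

text \<open>The divisibility is in the ring of Laurent polynomials.\<close>

definition explains ::
  "laurent fps \<Rightarrow> (nat \<Rightarrow> int) \<Rightarrow> nat \<Rightarrow> nat \<Rightarrow> nat \<Rightarrow> bool" where
  "explains C a \<alpha> \<beta> l \<longleftrightarrow>
     \<alpha> > 0 \<and> \<beta> > 0 \<and> prime l \<and>
     (\<forall>n. [a (\<alpha> * n + \<beta>) = 0] (mod int l)) \<and>
     fps_at_zeta_one C = Abs_fps a \<and>
     (\<forall>n. poly_at_zeta (cyclotomic_poly l) dvd fps_nth C (\<alpha> * n + \<beta>))"

end

theory Submission
  imports Defs "HOL-Complex_Analysis.Complex_Analysis" "HOL-Number_Theory.Totient"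
begin

text \<open>
  Write \<open>E(d)\<close> for the product of all \<open>1 - q ^ (d * n)\<close>. At a primitive cube root of unity \<open>\<omega>\<close>,
  \<open>C\<close> becomes \<open>D * E(3t) ^ b\<close> with \<open>D = E(1) ^ 2 * E(t) ^ v / (E(3) * E(t))\<close>, and \<open>\<Phi>\<^sub>3\<close> divides a Laurent
  polynomial if and only if the latter vanishes at \<open>\<omega>\<close>. Series in \<open>q ^ (3t)\<close> do not affect the vanishing of
  all coefficients in a residue class modulo \<open>3t\<close>, so \<open>D\<close> may be replaced by \<open>D / E(3t) ^ v\<close>, a product
  \<open>Psi\<close> of Siegel functions of level \<open>3t\<close>. The modular group permutes the functions \<open>Psi a b\<close> up to constants
  of modulus one, hence also the parts of their expansions supported on a set of residue classes that is
  stable under squares of units. If sufficiently many coefficients in such classes vanish, the product of all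
  these parts decays at the cusp, and so it is zero by the maximum principle. The required
  coefficients of \<open>D\<close> are computed with the pentagonal number theorem.
\<close>

section \<open>Infinite products\<close>

text \<open>Division by \<open>E(3t) ^ v\<close> brings \<open>D\<close>, of weight v / 2, to weight
  zero, the weight of Siegel functions. Liouville's theorem in z, applied for each \<tau>
  separately, gives the inversion formula with a constant that may depend on \<tau>; the three
  half-periods determine only its modulus. So no multiplier system is computed, and modular
  behaviour is expressed through absolute values, which is all that the maximum principle asks for.
  A residue class of exponents is cut out by averaging over translations along a primitive vector
  modulo 3t, and the modular group moves this vector; hence the product over all such vectors. The
  expansion is under control only at the vectors (0, d) with d a unit, where the average keeps the
  exponents m for which (\<open>shift\<close> + m) * d ^ 2 lies in a fixed class: this is where the
  squares of units come from. At the other vectors there is only a bound for the poles, so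
  \<open>B\<close> must be so large that the zeros at the 2 (t - 1) vectors (0, d) outweigh the
  poles at all the rest.\<close>

definition qpoch :: "complex \<Rightarrow> complex \<Rightarrow> complex" where
  "qpoch x q = prodinf (\<lambda>m. 1 - x * q ^ m)"

lemma summable_norm_geometric_mult:
  fixes x q :: complex
  assumes "norm q < 1"
  shows "summable (\<lambda>m. norm (x * q ^ m))"
  using assms by (simp add: norm_mult norm_power summable_mult summable_geometric)

lemma qpoch_abs_convergent:
  fixes x q :: complex
  assumes "norm q < 1"
  shows "abs_convergent_prod (\<lambda>m. 1 - x * q ^ m)"
  using summable_norm_geometric_mult[OF assms, of x]
  by (intro summable_imp_abs_convergent_prod) simp

lemma qpoch_has_prod:
  assumes "norm q < 1"
  shows "(\<lambda>m. 1 - x * q ^ m) has_prod qpoch x q"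
  unfolding qpoch_def
  by (intro convergent_prod_has_prod abs_convergent_prod_imp_convergent_prod
        qpoch_abs_convergent assms)

lemma qpoch_LIMSEQ:
  assumes "norm q < 1"
  shows "(\<lambda>N. \<Prod>m<N. 1 - x * q ^ m) \<longlonglongrightarrow> qpoch x q"
  using has_prod_imp_tendsto'[OF qpoch_has_prod[OF assms]] .

lemma qpoch_eq_0_iff:
  assumes "norm q < 1"
  shows "qpoch x q = 0 \<longleftrightarrow> (\<exists>m. x * q ^ m = 1)"
  using has_prod_eq_0_iff[OF qpoch_has_prod[OF assms, of x]]
  by (metis (no_types, lifting) eq_iff_diff_eq_0 image_iff rangeI)

lemma qpoch_rec:
  assumes "norm q < 1"
  shows "qpoch x q = (1 - x) * qpoch (x * q) q"
proof (rule LIMSEQ_unique)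
  show "(\<lambda>N. \<Prod>m<Suc N. 1 - x * q ^ m) \<longlonglongrightarrow> qpoch x q"
    using qpoch_LIMSEQ[OF assms] by (subst filterlim_sequentially_Suc)
  have "(\<lambda>N. (1 - x) * (\<Prod>m<N. 1 - (x * q) * q ^ m)) \<longlonglongrightarrow> (1 - x) * qpoch (x * q) q"
    by (intro tendsto_mult_left qpoch_LIMSEQ assms)
  also have "(\<lambda>N. (1 - x) * (\<Prod>m<N. 1 - (x * q) * q ^ m)) = (\<lambda>N. \<Prod>m<Suc N. 1 - x * q ^ m)"
    by (subst prod.lessThan_Suc_shift) (simp add: mult_ac)
  finally show "(\<lambda>N. \<Prod>m<Suc N. 1 - x * q ^ m) \<longlonglongrightarrow> (1 - x) * qpoch (x * q) q" .
qed

lemma norm_power_less_one: "norm (q :: complex) < 1 \<Longrightarrow> n > 0 \<Longrightarrow> norm (q ^ n) < 1"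
  by (simp add: norm_power power_less_one_iff)

lemma qpoch_mult_minus:
  assumes "norm q < 1"
  shows "qpoch x q * qpoch (- x) q = qpoch (x\<^sup>2) (q\<^sup>2)"
proof (rule LIMSEQ_unique)
  show "(\<lambda>N. (\<Prod>m<N. 1 - x * q ^ m) * (\<Prod>m<N. 1 - (- x) * q ^ m)) \<longlonglongrightarrow> qpoch x q * qpoch (- x) q"
    by (intro tendsto_mult qpoch_LIMSEQ assms)
  have eq: "(1 - x * q ^ m) * (1 - (- x) * q ^ m) = 1 - x\<^sup>2 * (q\<^sup>2) ^ m" for m
    by (simp add: algebra_simps power2_eq_square power_mult_distrib)
  have "norm (q\<^sup>2) < 1" using assms by (simp add: norm_power power_less_one_iff)
  from qpoch_LIMSEQ[OF this, of "x\<^sup>2"]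
  show "(\<lambda>N. (\<Prod>m<N. 1 - x * q ^ m) * (\<Prod>m<N. 1 - (- x) * q ^ m)) \<longlonglongrightarrow> qpoch (x\<^sup>2) (q\<^sup>2)"
    unfolding prod.distrib[symmetric] eq .
qed

lemma prod_less_mult_eq:
  fixes f :: "nat \<Rightarrow> 'a :: comm_monoid_mult"
  shows "(\<Prod>i<N * n. f i) = (\<Prod>m<N. \<Prod>k<n. f (k + m * n))"
proof (induction N)
  case (Suc N)
  have "(\<Prod>i<Suc N * n. f i) = (\<Prod>i<N * n. f i) * (\<Prod>i=N * n..<N * n + n. f i)"
    by (metis (no_types) add.commute lessThan_atLeast0 le_add1 mult_Suc prod.atLeastLessThan_concat zero_le)
  also have "(\<Prod>i=N * n..<N * n + n. f i) = (\<Prod>k<n. f (k + N * n))"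
    by (rule prod.reindex_bij_witness[of _ "\<lambda>k. k + N * n" "\<lambda>i. i - N * n"]) auto
  finally show ?case using Suc by simp
qed simp

text \<open>The factors are sorted by the residue of their exponent modulo n; for the partial
  products of length N * n this is a finite rearrangement.\<close>

lemma qpoch_dissect:
  assumes "norm q < 1" "n > 0"
  shows "qpoch x q = (\<Prod>k<n. qpoch (x * q ^ k) (q ^ n))"
proof (rule LIMSEQ_unique)
  show "(\<lambda>N. \<Prod>k<n. \<Prod>m<N. 1 - (x * q ^ k) * (q ^ n) ^ m) \<longlonglongrightarrow> (\<Prod>k<n. qpoch (x * q ^ k) (q ^ n))"
    by (intro tendsto_prod qpoch_LIMSEQ norm_power_less_one assms)
  have "filterlim (\<lambda>N. N * n) sequentially sequentially"
    by (rule filterlim_subseq) (use assms(2) in \<open>auto simp: strict_mono_def\<close>)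
  from filterlim_compose[OF qpoch_LIMSEQ[OF assms(1)] this, of x]
  show "(\<lambda>N. \<Prod>k<n. \<Prod>m<N. 1 - (x * q ^ k) * (q ^ n) ^ m) \<longlonglongrightarrow> qpoch x q"
    unfolding prod_less_mult_eq
    by (subst prod.swap) (simp add: mult_ac power_add flip: power_mult)
qed

text \<open>Euler's identity behind the modulus of the theta multiplier.\<close>

lemma qpoch_euler_half:
  assumes "norm p < 1"
  shows "qpoch (- (p\<^sup>2)) (p\<^sup>2) * (qpoch p (p\<^sup>2) * qpoch (- p) (p\<^sup>2)) = 1"
proof -
  define q where "q = p\<^sup>2"
  have q: "norm q < 1" and q2: "norm (q\<^sup>2) < 1"
    using assms by (simp_all add: q_def norm_power power_less_one_iff)
  have pp: "qpoch p q * qpoch (- p) q = qpoch q (q\<^sup>2)"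
    using qpoch_mult_minus[OF q, of p] by (simp add: q_def)
  have d: "qpoch q q = qpoch q (q\<^sup>2) * qpoch (q\<^sup>2) (q\<^sup>2)"
    using qpoch_dissect[OF q, of 2 q] by (simp add: numeral_2_eq_2)
  have m: "qpoch q q * qpoch (- q) q = qpoch (q\<^sup>2) (q\<^sup>2)"
    by (rule qpoch_mult_minus[OF q])
  have nz: "qpoch (q\<^sup>2) (q\<^sup>2) \<noteq> 0"
  proof
    assume "qpoch (q\<^sup>2) (q\<^sup>2) = 0"
    then obtain k where "(q\<^sup>2) ^ Suc k = 1"
      using qpoch_eq_0_iff[OF q2] by (metis power_Suc)
    then have "norm (q\<^sup>2) ^ Suc k = 1" by (metis norm_one norm_power)
    then show False using power_less_one_iff[of "norm (q\<^sup>2)" "Suc k"] q2 by simp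
  qed
  have "qpoch (q\<^sup>2) (q\<^sup>2) * (qpoch (- q) q * qpoch q (q\<^sup>2)) = qpoch (q\<^sup>2) (q\<^sup>2)"
    using m d by (simp add: mult_ac)
  then have "qpoch (- q) q * qpoch q (q\<^sup>2) = 1" using nz by simp
  then show ?thesis using pp by (simp add: q_def)
qed

text \<open>Weierstrass test: on a compact set |g| attains a maximum below 1, and a geometric series
  with this ratio dominates.\<close>

lemma qpoch_uniform_limit:
  assumes f: "continuous_on K f" and g: "continuous_on K g" and K: "compact K"
    and g1: "\<And>z. z \<in> K \<Longrightarrow> norm (g z) < 1"
  shows "uniform_limit K (\<lambda>N z. \<Prod>m<N. 1 - f z * g z ^ m) (\<lambda>z. qpoch (f z) (g z)) sequentially"
proof (cases "K = {}")
  case False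
  obtain F where F: "\<And>z. z \<in> K \<Longrightarrow> norm (f z) \<le> F"
    using compact_imp_bounded[OF compact_continuous_image[OF f K]] unfolding bounded_iff by auto
  have "compact ((\<lambda>z. norm (g z)) ` K)"
    by (intro compact_continuous_image continuous_intros g K)
  then obtain z0 where z0: "z0 \<in> K" "\<And>z. z \<in> K \<Longrightarrow> norm (g z) \<le> norm (g z0)"
    using compact_attains_sup[of "(\<lambda>z. norm (g z)) ` K"] False by auto
  have F0: "F \<ge> 0" using F[OF z0(1)] norm_ge_zero order_trans by blast
  have "uniformly_convergent_on K (\<lambda>N z. \<Prod>m<N. 1 - f z * g z ^ m)"
  proof (rule uniformly_convergent_on_prod')
    show "uniformly_convergent_on K (\<lambda>N z. \<Sum>m<N. norm (1 - f z * g z ^ m - 1))"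
    proof (rule Weierstrass_m_test')
      show "norm (norm (1 - f z * g z ^ m - 1)) \<le> F * norm (g z0) ^ m" if "z \<in> K" for m z
        using F[OF that] z0(2)[OF that] F0
        by (simp add: norm_mult norm_power mult_mono power_mono)
      show "summable (\<lambda>m. F * norm (g z0) ^ m)"
        using g1[OF z0(1)] by (intro summable_mult summable_geometric) simp
    qed
  qed (auto intro!: continuous_intros f g K)
  then obtain l where l: "uniform_limit K (\<lambda>N z. \<Prod>m<N. 1 - f z * g z ^ m) l sequentially"
    by (auto simp: uniformly_convergent_on_def)
  have "l z = qpoch (f z) (g z)" if "z \<in> K" for z
    using tendsto_uniform_limitI[OF l that] qpoch_LIMSEQ[OF g1[OF that], of "f z"]
    by (rule LIMSEQ_unique)
  with l show ?thesis by (simp cong: uniform_limit_cong')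
qed (simp add: uniform_limit_iff)

lemma qpoch_holomorphic [holomorphic_intros]:
  assumes "f holomorphic_on A" "g holomorphic_on A" "open A" "\<And>z. z \<in> A \<Longrightarrow> norm (g z) < 1"
  shows "(\<lambda>z. qpoch (f z) (g z)) holomorphic_on A"
proof (rule holomorphic_uniform_sequence[OF assms(3)])
  show "(\<lambda>z. \<Prod>m<N. 1 - f z * g z ^ m) holomorphic_on A" for N
    by (intro holomorphic_intros assms)
  fix z assume "z \<in> A"
  then obtain d where d: "d > 0" "cball z d \<subseteq> A" using assms(3) open_contains_cball by blast
  then show "\<exists>d>0. cball z d \<subseteq> A \<and>
      uniform_limit (cball z d) (\<lambda>N z. \<Prod>m<N. 1 - f z * g z ^ m) (\<lambda>z. qpoch (f z) (g z)) sequentially"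
    using assms by (intro exI[of _ d] conjI qpoch_uniform_limit)
       (auto intro: holomorphic_on_imp_continuous_on holomorphic_on_subset)
qed

text \<open>Each factor is at most 1 + r ^ m, and 1 + y \<le> exp y turns the product into a
  geometric sum. The bound is independent of x, which later makes the constants uniform in the real
  part of \<tau> and in the index b.\<close>

lemma norm_qpoch_bound:
  assumes "norm x \<le> 1" "norm q \<le> r" "r < 1"
  shows "norm (qpoch x q) \<le> exp (1 / (1 - r))"
proof (rule LIMSEQ_le_const2)
  have r0: "r \<ge> 0" using assms(2) norm_ge_zero order_trans by blast
  show "(\<lambda>N. norm (\<Prod>m<N. 1 - x * q ^ m)) \<longlonglongrightarrow> norm (qpoch x q)"
    using assms by (intro tendsto_norm qpoch_LIMSEQ) simp
  have "norm (\<Prod>m<N. 1 - x * q ^ m) \<le> exp (1 / (1 - r))" for N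
  proof -
    have "norm (\<Prod>m<N. 1 - x * q ^ m) = (\<Prod>m<N. norm (1 - x * q ^ m))" by (simp add: prod_norm)
    also have "\<dots> \<le> (\<Prod>m<N. 1 + r ^ m)"
    proof (rule prod_mono)
      fix m
      have "norm (x * q ^ m) \<le> 1 * r ^ m"
        unfolding norm_mult norm_power using assms r0 by (intro mult_mono power_mono) auto
      then show "0 \<le> norm (1 - x * q ^ m) \<and> norm (1 - x * q ^ m) \<le> 1 + r ^ m"
        using norm_triangle_ineq4[of 1 "x * q ^ m"] by simp
    qed
    also have "\<dots> \<le> exp (\<Sum>m<N. r ^ m)" by (rule prod_le_exp_sum) (use r0 in auto)
    also have "(\<Sum>m<N. r ^ m) \<le> suminf (\<lambda>m. r ^ m)"
      using r0 assms(3) by (intro sum_le_suminf summable_geometric) auto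
    also have "suminf (\<lambda>m. r ^ m) = 1 / (1 - r)" using r0 assms(3) by (intro suminf_geometric) simp
    finally show ?thesis by simp
  qed
  then show "\<exists>N. \<forall>n\<ge>N. norm (\<Prod>m<n. 1 - x * q ^ m) \<le> exp (1 / (1 - r))" by blast
qed

section \<open>The theta function\<close>

definition ee :: "complex \<Rightarrow> complex" where
  "ee z = exp (2 * of_real pi * \<i> * z)"

lemma ee_0 [simp]: "ee 0 = 1" by (simp add: ee_def)

lemma ee_nz [simp]: "ee z \<noteq> 0" by (simp add: ee_def)

lemma ee_add: "ee (x + y) = ee x * ee y" by (simp add: ee_def ring_distribs exp_add)

lemma ee_diff: "ee (x - y) = ee x / ee y" by (simp add: ee_def ring_distribs exp_diff)

lemma ee_minus: "ee (- x) = inverse (ee x)" by (simp add: ee_def exp_minus)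

lemma ee_power: "ee x ^ n = ee (of_nat n * x)"
  by (simp add: ee_def exp_of_nat_mult [symmetric] mult_ac)

lemma ee_of_int [simp]: "ee (of_int k) = 1"
  using exp_integer_2pi[of "of_int k"] by (simp add: ee_def mult_ac)

lemma ee_of_nat [simp]: "ee (of_nat k) = 1"
  using ee_of_int[of "int k"] by simp

lemma ee_1 [simp]: "ee 1 = 1" using ee_of_int[of 1] by simp

lemma ee_half [simp]: "ee (1 / 2) = -1"
  by (simp add: ee_def)

lemma norm_ee: "norm (ee z) = exp (- 2 * pi * Im z)"
  by (simp add: ee_def)

lemma norm_ee_real [simp]: "norm (ee (of_real x)) = 1"
  by (simp add: norm_ee)

lemma norm_ee_less_1 [simp]: "Im z > 0 \<Longrightarrow> norm (ee z) < 1"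
  by (simp add: norm_ee)

lemma ee_eq_1_iff: "ee z = 1 \<longleftrightarrow> z \<in> \<int>"
proof
  assume "ee z = 1"
  then have "Im z = 0" "\<exists>n. 2 * pi * Re z = of_int (2 * n) * pi"
    by (simp_all add: ee_def exp_eq_1)
  then obtain n :: int where "Re z = of_int n" "Im z = 0" by auto
  then have "z = of_int n" by (simp add: complex_eq_iff)
  then show "z \<in> \<int>" by simp
qed (auto elim: Ints_cases)

lemma ee_holomorphic [holomorphic_intros]:
  "f holomorphic_on A \<Longrightarrow> (\<lambda>z. ee (f z)) holomorphic_on A"
  unfolding ee_def by (intro holomorphic_intros)

text \<open>\<open>theta z \<tau>\<close> is, up to a constant, the quotient of the odd Jacobi theta function by the
  Dedekind eta function.\<close>

definition theta :: "complex \<Rightarrow> complex \<Rightarrow> complex" where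
  "theta z \<tau> = ee (\<tau> / 12 - z / 2) * qpoch (ee z) (ee \<tau>) * qpoch (ee (\<tau> - z)) (ee \<tau>)"

text \<open>Splits off the factor that vanishes at z = 0; the two remaining products are exchanged
  by z \<mapsto> - z.\<close>

lemma theta_alt:
  assumes "Im \<tau> > 0"
  shows "theta z \<tau> = (1 - ee z) *
    (ee (\<tau> / 12 - z / 2) * qpoch (ee (\<tau> + z)) (ee \<tau>) * qpoch (ee (\<tau> - z)) (ee \<tau>))"
  unfolding theta_def using assms
  by (subst qpoch_rec) (simp_all add: ee_add mult_ac)

lemma theta_add_1: "theta (z + 1) \<tau> = - theta z \<tau>"
proof -
  have "ee (\<tau> / 12 - (z + 1) / 2) = - ee (\<tau> / 12 - z / 2)"
    by (simp add: add_divide_distrib ee_add ee_diff ee_half)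
  then show ?thesis by (simp add: theta_def ee_add ee_diff)
qed

text \<open>The first product loses the factor 1 - ee z and the second gains 1 - ee (- z); the
  quotient of the new factor by the old one is - ee (- z).\<close>

lemma theta_add_tau:
  assumes "Im \<tau> > 0"
  shows "theta (z + \<tau>) \<tau> = - ee (- \<tau> / 2 - z) * theta z \<tau>"
proof -
  have 1: "qpoch (ee z) (ee \<tau>) = (1 - ee z) * qpoch (ee (z + \<tau>)) (ee \<tau>)"
    using assms by (subst qpoch_rec) (simp_all add: ee_add)
  have 2: "qpoch (ee (- z)) (ee \<tau>) = (1 - ee (- z)) * qpoch (ee (\<tau> - z)) (ee \<tau>)"
    using assms by (subst qpoch_rec) (simp_all add: ee_diff ee_minus field_simps)
  have 3: "ee (- z) * (1 - ee z) = - (1 - ee (- z))"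
    by (simp add: ee_minus field_simps)
  have 4: "ee (\<tau> / 12 - (z + \<tau>) / 2) = ee (\<tau> / 12 - z / 2) * ee (- \<tau> / 2)"
    unfolding ee_add [symmetric] by (intro arg_cong[of _ _ ee]) (simp add: field_simps)
  have 6: "\<tau> - (z + \<tau>) = - z" by simp
  have 5: "ee (- \<tau> / 2 - z) = ee (- \<tau> / 2) * ee (- z)"
    unfolding ee_add [symmetric] by simp
  have "ee (- \<tau> / 2 - z) * theta z \<tau> =
      ee (\<tau> / 12 - z / 2) * ee (- \<tau> / 2) * (ee (- z) * (1 - ee z)) *
        qpoch (ee (z + \<tau>)) (ee \<tau>) * qpoch (ee (\<tau> - z)) (ee \<tau>)"
    unfolding theta_def 1 5 by (simp only: mult_ac)
  also have "\<dots> = - theta (z + \<tau>) \<tau>"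
    unfolding 3 theta_def 4 6 2 by (simp only: mult_ac mult_minus_left mult_minus_right)
  finally show ?thesis by simp
qed

lemma theta_minus:
  assumes "Im \<tau> > 0"
  shows "theta (- z) \<tau> = - theta z \<tau>"
proof -
  define X Y where "X = qpoch (ee (\<tau> + z)) (ee \<tau>)" and "Y = qpoch (ee (\<tau> - z)) (ee \<tau>)"
  have 1: "(1 - ee (- z)) * ee (z / 2) = - ((1 - ee z) * ee (- z / 2))"
    by (simp add: ee_add[symmetric] algebra_simps)
  have 2: "ee (\<tau> / 12 + z / 2) = ee (\<tau> / 12) * ee (z / 2)"
    "ee (\<tau> / 12 - z / 2) = ee (\<tau> / 12) * ee (- z / 2)"
    by (simp_all add: ee_add[symmetric])
  have "theta (- z) \<tau> = ((1 - ee (- z)) * ee (z / 2)) * (ee (\<tau> / 12) * X * Y)"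
    unfolding theta_alt[OF assms] X_def Y_def by (simp add: 2 mult_ac)
  also have "\<dots> = - (((1 - ee z) * ee (- z / 2)) * (ee (\<tau> / 12) * X * Y))"
    unfolding 1 by simp
  also have "((1 - ee z) * ee (- z / 2)) * (ee (\<tau> / 12) * X * Y) = theta z \<tau>"
    unfolding theta_alt[OF assms] X_def Y_def 2 by (simp only: mult_ac)
  finally show ?thesis .
qed

lemma theta_holomorphic [holomorphic_intros]:
  assumes "f holomorphic_on A" "g holomorphic_on A" "open A" "\<And>z. z \<in> A \<Longrightarrow> Im (g z) > 0"
  shows "(\<lambda>z. theta (f z) (g z)) holomorphic_on A"
  unfolding theta_def using assms by (auto intro!: holomorphic_intros)

lemma theta_eq_0_iff:
  assumes "Im \<tau> > 0"
  shows "theta z \<tau> = 0 \<longleftrightarrow> (\<exists>m k. z = of_int m + of_int k * \<tau>)"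
proof
  assume "theta z \<tau> = 0"
  then consider m where "ee z * ee \<tau> ^ m = 1" | m where "ee (\<tau> - z) * ee \<tau> ^ m = 1"
    using qpoch_eq_0_iff[OF norm_ee_less_1[OF assms]] by (auto simp: theta_def)
  then show "\<exists>m k. z = of_int m + of_int k * \<tau>"
  proof cases
    case 1
    then have "ee (z + of_nat m * \<tau>) = 1" by (simp add: ee_add ee_power)
    then obtain l where "z + of_nat m * \<tau> = of_int l" by (auto simp: ee_eq_1_iff elim: Ints_cases)
    then have "z = of_int l + of_int (- int m) * \<tau>" by (simp add: algebra_simps)
    then show ?thesis by blast
  next
    case 2
    then have "ee (\<tau> - z + of_nat m * \<tau>) = 1" by (simp add: ee_add ee_power)
    then obtain l where "\<tau> - z + of_nat m * \<tau> = of_int l" by (auto simp: ee_eq_1_iff elim: Ints_cases)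
    then have "z = of_int (- l) + of_int (int m + 1) * \<tau>" by (simp add: algebra_simps)
    then show ?thesis by blast
  qed
next
  assume "\<exists>m k. z = of_int m + of_int k * \<tau>"
  then obtain m k where z: "z = of_int m + of_int k * \<tau>" by blast
  show "theta z \<tau> = 0"
  \<comment> \<open>The first product vanishes at the lattice points with k \<le> 0, the second at
    those with k \<ge> 1.\<close>
  proof (cases "k \<le> 0")
    case True
    then have "ee z * ee \<tau> ^ nat (- k) = ee (of_int m)"
      unfolding ee_power ee_add[symmetric] by (simp add: z of_nat_nat)
    then have "ee z * ee \<tau> ^ nat (- k) = 1" by simp
    then have "qpoch (ee z) (ee \<tau>) = 0" using qpoch_eq_0_iff[OF norm_ee_less_1[OF assms]] by blast
    then show ?thesis by (simp add: theta_def)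
  next
    case False
    then have "ee (\<tau> - z) * ee \<tau> ^ nat (k - 1) = ee (of_int (- m))"
      unfolding ee_power ee_add[symmetric] by (simp add: z of_nat_nat algebra_simps)
    then have "ee (\<tau> - z) * ee \<tau> ^ nat (k - 1) = 1" by (metis ee_of_int)
    then have "qpoch (ee (\<tau> - z)) (ee \<tau>) = 0"
      using qpoch_eq_0_iff[OF norm_ee_less_1[OF assms]] by blast
    then show ?thesis by (simp add: theta_def)
  qed
qed

lemma Im_neg_inverse: "Im \<tau> > 0 \<Longrightarrow> Im (- 1 / \<tau>) > 0"
  by (cases "\<tau> = 0") (auto simp: Im_divide power2_eq_square field_simps add_pos_nonneg add_nonneg_pos)

lemma int_periodic:
  fixes f :: "complex \<Rightarrow> 'b"
  assumes "\<And>z. f (z + w) = f z"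
  shows "f (z + of_int k * w) = f z"
proof (induction k arbitrary: z rule: int_induct[where k = 0])
  case (step1 i)
  have "z + of_int (i + 1) * w = (z + of_int i * w) + w" by (simp add: algebra_simps)
  then show ?case using step1 assms by metis
next
  case (step2 i)
  have "(z + of_int (i - 1) * w) + w = z + of_int i * w" by (simp add: algebra_simps)
  then show ?case using step2 assms by metis
qed simp

text \<open>Both sides have the same quasi-periods and the same zeros, so that their quotient is
  constant by Liouville's theorem.\<close>

lemma theta_inversion:
  assumes tau: "Im \<tau> > 0"
  shows "\<exists>c. \<forall>z. theta (z / \<tau>) (- 1 / \<tau>) = c * ee (z\<^sup>2 / (2 * \<tau>)) * theta z \<tau>"
proof -
  define \<sigma> where "\<sigma> = - 1 / \<tau>"
  have sig: "Im \<sigma> > 0" using Im_neg_inverse[OF tau] by (simp add: \<sigma>_def)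
  have t0: "\<tau> \<noteq> 0" using tau by auto
  \<comment> \<open>With the Gaussian factor on this side, \<open>A\<close> has exactly the
    multipliers of \<open>B\<close> under z + 1 and z + \<tau>.\<close>
  define A where "A z = theta (z / \<tau>) \<sigma> * ee (- (z\<^sup>2) / (2 * \<tau>))" for z
  define B where "B z = theta z \<tau>" for z
  define L where "L = {z. B z = 0}"
  have A1: "A (z + 1) = - A z" for z
  proof -
    have "theta (z / \<tau>) \<sigma> = - ee (- \<sigma> / 2 - (z + 1) / \<tau>) * theta ((z + 1) / \<tau>) \<sigma>"
      using theta_add_tau[OF sig, of "(z + 1) / \<tau>"] by (simp add: \<sigma>_def add_divide_distrib)
    moreover have "ee (- ((z + 1)\<^sup>2) / (2 * \<tau>)) =
        ee (- \<sigma> / 2 - (z + 1) / \<tau>) * ee (- (z\<^sup>2) / (2 * \<tau>))"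
      unfolding ee_add[symmetric] using t0
      by (intro arg_cong[of _ _ ee]) (simp add: \<sigma>_def field_simps power2_eq_square)
    ultimately show ?thesis by (simp add: A_def)
  qed
  have A2: "A (z + \<tau>) = - ee (- \<tau> / 2 - z) * A z" for z
  proof -
    have "ee (- ((z + \<tau>)\<^sup>2) / (2 * \<tau>)) = ee (- \<tau> / 2 - z) * ee (- (z\<^sup>2) / (2 * \<tau>))"
      unfolding ee_add[symmetric] using t0
      by (intro arg_cong[of _ _ ee]) (simp add: field_simps power2_eq_square)
    moreover have "theta ((z + \<tau>) / \<tau>) \<sigma> = - theta (z / \<tau>) \<sigma>"
      using theta_add_1[of "z / \<tau>"] t0 by (simp add: add_divide_distrib)
    ultimately show ?thesis by (simp add: A_def)
  qed
  have B1: "B (z + 1) = - B z" and B2: "B (z + \<tau>) = - ee (- \<tau> / 2 - z) * B z" for z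
    unfolding B_def by (rule theta_add_1, rule theta_add_tau[OF tau])
  \<comment> \<open>\<open>U\<close> and \<open>V\<close> are \<open>B\<close> and \<open>A\<close>
    without the factors that vanish at 0, so that the limit of A / B at 0 can be computed.\<close>
  define U where "U z = ee (\<tau> / 12 - z / 2) * qpoch (ee (\<tau> + z)) (ee \<tau>) * qpoch (ee (\<tau> - z)) (ee \<tau>)" for z
  define V where "V z = ee (\<sigma> / 12 - z / \<tau> / 2) * qpoch (ee (\<sigma> + z / \<tau>)) (ee \<sigma>) *
      qpoch (ee (\<sigma> - z / \<tau>)) (ee \<sigma>) * ee (- (z\<^sup>2) / (2 * \<tau>))" for z
  have BU: "B z = (1 - ee z) * U z" for z unfolding B_def U_def by (rule theta_alt[OF tau])
  have AV: "A z = (1 - ee (z / \<tau>)) * V z" for z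
    unfolding A_def V_def theta_alt[OF sig] by (simp add: mult_ac)
  have Uhol: "U holomorphic_on UNIV" and Vhol: "V holomorphic_on UNIV"
    unfolding U_def V_def using tau sig t0 by (auto intro!: holomorphic_intros)
  have Ahol: "A holomorphic_on UNIV" and Bhol: "B holomorphic_on UNIV"
    unfolding A_def B_def using tau sig t0 by (auto intro!: holomorphic_intros)
  have pw: "w * w ^ m \<noteq> 1" if "norm w < 1" for w :: complex and m
    using power_less_one_iff[of "norm w" "Suc m"] that by (metis less_irrefl norm_ge_zero norm_one norm_power power_Suc zero_less_Suc)
  have U0: "U 0 \<noteq> 0"
    using qpoch_eq_0_iff[OF norm_ee_less_1[OF tau]] pw[OF norm_ee_less_1[OF tau]] by (auto simp: U_def)
  have "continuous (at 0) U" using Uhol holomorphic_on_imp_continuous_on continuous_on_eq_continuous_at by blast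
  then have "\<forall>\<^sub>F z in at 0. U z \<noteq> 0"
    using U0 by (metis continuous_at isCont_def tendsto_imp_eventually_ne)
  then obtain r0 where r0: "r0 > 0" "\<And>z. z \<noteq> 0 \<Longrightarrow> dist z 0 < r0 \<Longrightarrow> U z \<noteq> 0"
    unfolding eventually_at by auto
  define r where "r = min r0 1"
  have Ur: "U z \<noteq> 0" if "z \<in> ball 0 r" for z
    using r0(2)[of z] U0 that by (cases "z = 0") (auto simp: r_def)
  have r: "r > 0" using r0 by (simp add: r_def)
  have ez: "ee z \<noteq> 1" if "z \<in> ball 0 r" "z \<noteq> 0" for z
  proof
    assume "ee z = 1"
    then obtain k where k: "z = of_int k" by (auto simp: ee_eq_1_iff elim: Ints_cases)
    with that(2) have "\<bar>real_of_int k\<bar> \<ge> 1" by (cases "k = 0") auto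
    then show False using that(1) k by (auto simp: r_def)
  qed
  \<comment> \<open>The value at 0 is the limit: (1 - ee (z / \<tau>)) / (1 - ee z) tends to 1 /
    \<tau>.\<close>
  define h0 where "h0 z = (if z = 0 then V 0 / (\<tau> * U 0) else A z / B z)" for z
  have Bnz: "B z \<noteq> 0" if "z \<in> ball 0 r" "z \<noteq> 0" for z using ez Ur that by (simp add: BU)
  have h0: "h0 holomorphic_on ball 0 r"
  proof (rule no_isolated_singularity'[where K = "{0}"])
    have "(\<lambda>z. A z / B z) holomorphic_on ball 0 r - {0}"
      using Bnz by (auto intro!: holomorphic_intros holomorphic_on_subset[OF Ahol] holomorphic_on_subset[OF Bhol])
    then show "h0 holomorphic_on ball 0 r - {0}"
      by (rule holomorphic_transform) (auto simp: h0_def)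
    fix z :: complex assume "z \<in> {0}"
    then have z: "z = 0" by simp
    have d: "((\<lambda>z. 1 - ee (z / w)) has_field_derivative (- 2 * of_real pi * \<i> / w)) (at 0)"
      if "w \<noteq> 0" for w
      unfolding ee_def by (rule derivative_eq_intros refl | use that in simp)+
    have l: "((\<lambda>z. (1 - ee (z / w)) / z) \<longlongrightarrow> - 2 * of_real pi * \<i> / w) (at 0)" if "w \<noteq> 0" for w
      using d[OF that] unfolding has_field_derivative_iff by simp
    have c: "(U \<longlongrightarrow> U 0) (at 0)" "(V \<longlongrightarrow> V 0) (at 0)"
      using Uhol Vhol by (metis UNIV_I continuous_on_def holomorphic_on_imp_continuous_on)+
    have "((\<lambda>z. ((1 - ee (z / \<tau>)) / z * V z) / ((1 - ee (z / 1)) / z * U z)) \<longlongrightarrow>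
        (- 2 * of_real pi * \<i> / \<tau> * V 0) / (- 2 * of_real pi * \<i> / 1 * U 0)) (at 0)"
      by (intro tendsto_intros l c) (use t0 U0 in auto)
    also have "(- 2 * of_real pi * \<i> / \<tau> * V 0) / (- 2 * of_real pi * \<i> / 1 * U 0) = h0 0"
      by (simp add: h0_def)
    finally have "(h0 \<longlongrightarrow> h0 0) (at 0)"
    proof (rule Lim_transform_eventually)
      show "\<forall>\<^sub>F z in at 0. (1 - ee (z / \<tau>)) / z * V z / ((1 - ee (z / 1)) / z * U z) = h0 z"
        unfolding eventually_at by (intro exI[of _ 1]) (auto simp: h0_def AV BU)
    qed
    then show "(h0 \<longlongrightarrow> h0 z) (at z within ball 0 r)" unfolding z by (rule tendsto_within_subset) simp
  qed auto
  \<comment> \<open>All lattice points receive the value at 0. Thus \<open>h\<close> is periodic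
    without exception, and differentiability at 0 carries over to every lattice point.\<close>
  define h where "h z = (if B z = 0 then h0 0 else A z / B z)" for z
  have h1: "h (z + 1) = h z" for z by (simp add: h_def A1 B1)
  have h2: "h (z + \<tau>) = h z" for z by (simp add: h_def A2 B2)
  have hper: "h (z + of_int m + of_int k * \<tau>) = h z" for z m k
    using int_periodic[of h \<tau> "z + of_int m" k] int_periodic[of h 1 z m] h1 h2 by simp
  have B0: "B z = 0 \<longleftrightarrow> (\<exists>m k. z = of_int m + of_int k * \<tau>)" for z
    unfolding B_def by (rule theta_eq_0_iff[OF tau])
  have hb: "h holomorphic_on ball 0 r"
    by (rule holomorphic_transform[OF h0]) (use Bnz in \<open>auto simp: h_def h0_def BU\<close>)
  have "h field_differentiable at z" for z
  proof (cases "B z = 0")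
    case True
    then obtain m k where z: "z = of_int m + of_int k * \<tau>" using B0 by blast
    have "h = (\<lambda>w. h (w - z))"
    proof
      fix w show "h w = h (w - z)" using hper[of "w - z" m k] by (simp add: z add.assoc)
    qed
    moreover have "(\<lambda>w. h (w - z)) field_differentiable at z"
    proof -
      have "h field_differentiable at (z - z)"
        using hb r by (metis cancel_comm_monoid_add_class.diff_cancel centre_in_ball holomorphic_on_imp_differentiable_at open_ball)
      moreover have "(\<lambda>w. w - z) field_differentiable at z" by (intro derivative_intros)
      ultimately show ?thesis using field_differentiable_compose[of "\<lambda>w. w - z" z h] by (simp add: o_def)
    qed
    ultimately show ?thesis by metis
  next
    case False
    have "open {z. B z \<noteq> 0}"
      by (intro open_Collect_neq holomorphic_on_imp_continuous_on[OF Bhol] continuous_on_const)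
    moreover have "h holomorphic_on {z. B z \<noteq> 0}"
    proof (rule holomorphic_transform)
      show "(\<lambda>z. A z / B z) holomorphic_on {z. B z \<noteq> 0}"
        by (auto intro!: holomorphic_intros holomorphic_on_subset[OF Ahol] holomorphic_on_subset[OF Bhol])
    qed (auto simp: h_def)
    ultimately show ?thesis using False holomorphic_on_imp_differentiable_at by blast
  qed
  then have hhol: "h holomorphic_on UNIV" by (simp add: holomorphic_on_open field_differentiable_def)
  have "h constant_on UNIV"
  proof (rule Liouville_theorem[OF hhol])
    \<comment> \<open>The closed fundamental parallelogram, on which a doubly periodic function
      takes all its values.\<close>
    define K where "K = (\<lambda>p. of_real (fst p) + of_real (snd p) * \<tau>) ` ({0..1} \<times> {0..1::real})"
    have "compact K" unfolding K_def
      by (intro compact_continuous_image continuous_intros compact_Times) auto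
    then have "compact (h ` K)"
      using hhol by (intro compact_continuous_image holomorphic_on_imp_continuous_on)
        (auto intro: holomorphic_on_subset)
    moreover have "range h \<subseteq> h ` K"
    proof safe
      fix z
      define y where "y = Im z / Im \<tau>"
      define x where "x = Re z - y * Re \<tau>"
      have z: "z = of_real x + of_real y * \<tau>"
        using tau by (simp add: complex_eq_iff x_def y_def)
      have "z = (of_real (frac x) + of_real (frac y) * \<tau>) + of_int \<lfloor>x\<rfloor> + of_int \<lfloor>y\<rfloor> * \<tau>"
        by (subst z) (simp add: frac_def algebra_simps)
      then have "h z = h (of_real (frac x) + of_real (frac y) * \<tau>)" using hper by metis
      moreover have "of_real (frac x) + of_real (frac y) * \<tau> \<in> K"
        unfolding K_def using frac_ge_0 frac_lt_1
        by (intro image_eqI[where x = "(frac x, frac y)"]) (auto intro: less_imp_le)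
      ultimately show "h z \<in> h ` K" by blast
    qed
    ultimately show "bounded (range h)" using bounded_subset compact_imp_bounded by blast
  qed
  then obtain c where c: "\<And>z. h z = c" by (auto simp: constant_on_def)
  \<comment> \<open>At the zeros of \<open>B\<close> the function \<open>h\<close> says nothing
    about \<open>A\<close>, so these points are treated separately.\<close>
  have A0: "A z = 0" if bz: "B z = 0" for z
  proof -
    obtain m k where z: "z = of_int m + of_int k * \<tau>" using B0[of z] bz by blast
    have "z / \<tau> = of_int k + of_int (- m) * \<sigma>" using t0 by (simp add: z \<sigma>_def field_simps)
    then have "theta (z / \<tau>) \<sigma> = 0" using theta_eq_0_iff[OF sig] by blast
    then show ?thesis by (simp add: A_def)
  qed
  have "A z = c * B z" for z using c[of z] A0[of z] by (auto simp: h_def split: if_splits)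
  then have "theta (z / \<tau>) \<sigma> = c * ee (z\<^sup>2 / (2 * \<tau>)) * theta z \<tau>" for z
    unfolding A_def B_def by (simp add: ee_minus field_simps)
  then show ?thesis unfolding \<sigma>_def by blast
qed

section \<open>Siegel functions\<close>

text \<open>The exponential prefactor completes the square: it absorbs the Gaussian of the inversion
  formula, so that inversion sends (a, b) to (b, -a) with a constant independent of (a, b).\<close>

definition siegel :: "real \<Rightarrow> real \<Rightarrow> complex \<Rightarrow> complex" where
  "siegel a b \<tau> = ee (of_real a * (of_real a * \<tau> + of_real b) / 2) * theta (of_real a * \<tau> + of_real b) \<tau>"

lemma siegel_minus:
  assumes "Im \<tau> > 0"
  shows "siegel (- a) (- b) \<tau> = - siegel a b \<tau>"
  using theta_minus[OF assms, of "of_real a * \<tau> + of_real b"]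
  by (simp add: siegel_def algebra_simps)

lemma siegel_add_1_left:
  assumes "Im \<tau> > 0"
  shows "siegel (a + 1) b \<tau> = - ee (- of_real b / 2) * siegel a b \<tau>"
proof -
  define z where "z = of_real a * \<tau> + of_real b"
  have "siegel (a + 1) b \<tau> = ee (of_real (a + 1) * (z + \<tau>) / 2) * theta (z + \<tau>) \<tau>"
    by (simp add: siegel_def z_def algebra_simps)
  also have "\<dots> = - (ee (of_real (a + 1) * (z + \<tau>) / 2) * ee (- \<tau> / 2 - z)) * theta z \<tau>"
    by (simp add: theta_add_tau[OF assms])
  also have "ee (of_real (a + 1) * (z + \<tau>) / 2) * ee (- \<tau> / 2 - z) =
      ee (- of_real b / 2) * ee (of_real a * z / 2)"
    unfolding ee_add[symmetric] by (intro arg_cong[of _ _ ee]) (simp add: z_def field_simps)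
  finally show ?thesis by (simp add: siegel_def z_def)
qed

lemma siegel_add_1_right: "siegel a (b + 1) \<tau> = - ee (of_real a / 2) * siegel a b \<tau>"
proof -
  define z where "z = of_real a * \<tau> + of_real b"
  have "siegel a (b + 1) \<tau> = ee (of_real a * (z + 1) / 2) * theta (z + 1) \<tau>"
    by (simp add: siegel_def z_def algebra_simps)
  also have "ee (of_real a * (z + 1) / 2) = ee (of_real a / 2) * ee (of_real a * z / 2)"
    unfolding ee_add[symmetric] by (intro arg_cong[of _ _ ee]) (simp add: field_simps)
  finally show ?thesis by (simp add: siegel_def z_def theta_add_1)
qed

lemma siegel_add_even_left:
  assumes "Im \<tau> > 0"
  shows "siegel (a + 2 * of_int k) b \<tau> = ee (- of_int k * of_real b) * siegel a b \<tau>"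
proof -
  have step: "siegel (x + 2) b \<tau> = ee (- of_real b) * siegel x b \<tau>" for x
  proof -
    have "siegel (x + 2) b \<tau> = - ee (- of_real b / 2) * siegel (x + 1) b \<tau>"
      using siegel_add_1_left[OF assms, of "x + 1" b] by (simp add: add.assoc)
    also have "\<dots> = (ee (- of_real b / 2) * ee (- of_real b / 2)) * siegel x b \<tau>"
      by (simp add: siegel_add_1_left[OF assms, of x b])
    also have "ee (- of_real b / 2) * ee (- of_real b / 2) = ee (- of_real b)"
      unfolding ee_add[symmetric] by simp
    finally show ?thesis .
  qed
  show ?thesis
  proof (induction k rule: int_induct[where k = 0])
    case (step1 i)
    have "siegel (a + 2 * of_int (i + 1)) b \<tau> = siegel ((a + 2 * of_int i) + 2) b \<tau>"
      by (simp add: algebra_simps)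
    also have "\<dots> = (ee (- of_real b) * ee (- of_int i * of_real b)) * siegel a b \<tau>"
      unfolding step step1(2) by simp
    also have "ee (- of_real b) * ee (- of_int i * of_real b) = ee (- of_int (i + 1) * of_real b)"
      unfolding ee_add[symmetric] by (simp add: algebra_simps)
    finally show ?case .
  next
    case (step2 i)
    have "ee (- of_int i * of_real b) * siegel a b \<tau> = siegel ((a + 2 * of_int (i - 1)) + 2) b \<tau>"
      using step2(2) by (simp add: algebra_simps)
    also have "\<dots> = ee (- of_real b) * siegel (a + 2 * of_int (i - 1)) b \<tau>"
      unfolding step ..
    finally have "siegel (a + 2 * of_int (i - 1)) b \<tau> =
        (ee (- of_int i * of_real b) / ee (- of_real b)) * siegel a b \<tau>"
      by (simp add: field_simps)
    also have "ee (- of_int i * of_real b) / ee (- of_real b) = ee (- of_int (i - 1) * of_real b)"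
      unfolding ee_diff[symmetric] by (simp add: algebra_simps)
    finally show ?case .
  qed simp
qed

lemma siegel_add_even_right:
  "siegel a (b + 2 * of_int k) \<tau> = ee (of_int k * of_real a) * siegel a b \<tau>"
proof -
  have step: "siegel a (x + 2) \<tau> = ee (of_real a) * siegel a x \<tau>" for x
  proof -
    have "siegel a (x + 2) \<tau> = - ee (of_real a / 2) * siegel a (x + 1) \<tau>"
      using siegel_add_1_right[of a "x + 1"] by (simp add: add.assoc)
    also have "\<dots> = (ee (of_real a / 2) * ee (of_real a / 2)) * siegel a x \<tau>"
      by (simp add: siegel_add_1_right[of a x])
    also have "ee (of_real a / 2) * ee (of_real a / 2) = ee (of_real a)"
      unfolding ee_add[symmetric] by simp
    finally show ?thesis .
  qed
  show ?thesis
  proof (induction k rule: int_induct[where k = 0])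
    case (step1 i)
    have "siegel a (b + 2 * of_int (i + 1)) \<tau> = siegel a ((b + 2 * of_int i) + 2) \<tau>"
      by (simp add: algebra_simps)
    also have "\<dots> = (ee (of_real a) * ee (of_int i * of_real a)) * siegel a b \<tau>"
      unfolding step step1(2) by simp
    also have "ee (of_real a) * ee (of_int i * of_real a) = ee (of_int (i + 1) * of_real a)"
      unfolding ee_add[symmetric] by (simp add: algebra_simps)
    finally show ?case .
  next
    case (step2 i)
    have "ee (of_int i * of_real a) * siegel a b \<tau> = siegel a ((b + 2 * of_int (i - 1)) + 2) \<tau>"
      using step2(2) by (simp add: algebra_simps)
    also have "\<dots> = ee (of_real a) * siegel a (b + 2 * of_int (i - 1)) \<tau>"
      unfolding step ..
    finally have "siegel a (b + 2 * of_int (i - 1)) \<tau> =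
        (ee (of_int i * of_real a) / ee (of_real a)) * siegel a b \<tau>"
      by (simp add: field_simps)
    also have "ee (of_int i * of_real a) / ee (of_real a) = ee (of_int (i - 1) * of_real a)"
      unfolding ee_diff[symmetric] by (simp add: algebra_simps)
    finally show ?case .
  qed simp
qed

lemma siegel_translate: "siegel a b (\<tau> + 1) = ee (1 / 12) * siegel a (a + b) \<tau>"
proof -
  have "ee (\<tau> + 1) = ee \<tau>" by (simp add: ee_add)
  moreover have "ee (\<tau> + 1 - z) = ee (\<tau> - z)" for z by (simp add: ee_add ee_diff)
  moreover have "ee ((\<tau> + 1) / 12 - z / 2) = ee (1 / 12) * ee (\<tau> / 12 - z / 2)" for z
    unfolding ee_add[symmetric] by (intro arg_cong[of _ _ ee]) (simp add: field_simps)
  ultimately have "theta z (\<tau> + 1) = ee (1 / 12) * theta z \<tau>" for z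
    by (simp add: theta_def)
  then show ?thesis by (simp add: siegel_def algebra_simps)
qed

lemma siegel_holomorphic [holomorphic_intros]:
  assumes "f holomorphic_on A" "open A" "\<And>z. z \<in> A \<Longrightarrow> Im (f z) > 0"
  shows "(\<lambda>z. siegel a b (f z)) holomorphic_on A"
  unfolding siegel_def using assms by (auto intro!: holomorphic_intros)

lemma norm_siegel_add_int:
  assumes "Im \<tau> > 0"
  shows "norm (siegel (a + of_int k) b \<tau>) = norm (siegel a b \<tau>)"
proof (induction k rule: int_induct[where k = 0])
  case (step1 i)
  have "norm (siegel ((a + of_int i) + 1) b \<tau>) = norm (siegel (a + of_int i) b \<tau>)"
    unfolding siegel_add_1_left[OF assms] using norm_ee_real[of "- b / 2"] by (simp add: norm_mult)
  then show ?case using step1 by (simp add: add.assoc)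
next
  case (step2 i)
  have "norm (siegel ((a + of_int (i - 1)) + 1) b \<tau>) = norm (siegel (a + of_int (i - 1)) b \<tau>)"
    unfolding siegel_add_1_left[OF assms] using norm_ee_real[of "- b / 2"] by (simp add: norm_mult)
  then show ?case using step2 by (simp add: add.assoc)
qed simp

text \<open>x ^ 2 - x + 1 / 6 is the second Bernoulli polynomial, and half of its value at
  \<open>frac a\<close> is the order of the function at infinity. For Im \<tau> \<ge> 1 / 2 one has
  |ee \<tau>| \<le> exp (- pi), which bounds both infinite products by one constant.\<close>

lemma norm_siegel_bound:
  "\<exists>C>0. \<forall>a b \<tau>. Im \<tau> \<ge> 1 / 2 \<longrightarrow>
     norm (siegel a b \<tau>) \<le> C * exp (- pi * Im \<tau> * ((frac a)\<^sup>2 - frac a + 1 / 6))"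
proof -
  define C where "C = exp (1 / (1 - exp (- pi)))"
  have main: "norm (siegel a b \<tau>) \<le> C\<^sup>2 * exp (- pi * Im \<tau> * (a\<^sup>2 - a + 1 / 6))"
    if a: "0 \<le> a" "a < 1" and tau: "Im \<tau> \<ge> 1 / 2" for a b \<tau>
  proof -
    have t0: "Im \<tau> > 0" using tau by simp
    define z where "z = of_real a * \<tau> + of_real b"
    have q: "norm (ee \<tau>) \<le> exp (- pi)" using tau by (simp add: norm_ee)
    have 1: "norm (qpoch (ee z) (ee \<tau>)) \<le> C" unfolding C_def
      using a t0 by (intro norm_qpoch_bound q) (auto simp: norm_ee z_def)
    have 2: "norm (qpoch (ee (\<tau> - z)) (ee \<tau>)) \<le> C" unfolding C_def
      using a t0 by (intro norm_qpoch_bound q) (auto simp: norm_ee z_def mult_le_cancel_right1)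
    have 3: "norm (ee (of_real a * z / 2)) * norm (ee (\<tau> / 12 - z / 2)) =
        exp (- pi * Im \<tau> * (a\<^sup>2 - a + 1 / 6))"
      unfolding norm_ee exp_add[symmetric]
      by (simp add: z_def field_simps power2_eq_square)
    have "norm (siegel a b \<tau>) = (norm (ee (of_real a * z / 2)) * norm (ee (\<tau> / 12 - z / 2))) *
        (norm (qpoch (ee z) (ee \<tau>)) * norm (qpoch (ee (\<tau> - z)) (ee \<tau>)))"
      by (simp add: siegel_def theta_def z_def[symmetric] norm_mult)
    also have "\<dots> \<le> exp (- pi * Im \<tau> * (a\<^sup>2 - a + 1 / 6)) * (C * C)"
      unfolding 3 using 1 2 by (intro mult_left_mono mult_mono) (auto simp: C_def)
    finally show ?thesis by (simp add: power2_eq_square mult_ac)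
  qed
  have "norm (siegel a b \<tau>) \<le> C\<^sup>2 * exp (- pi * Im \<tau> * ((frac a)\<^sup>2 - frac a + 1 / 6))"
    if tau: "Im \<tau> \<ge> 1 / 2" for a b \<tau>
    using main[of "frac a" \<tau> b] norm_siegel_add_int[of \<tau> "frac a" "\<lfloor>a\<rfloor>" b] tau
    by (simp add: frac_lt_1) (simp add: frac_def)
  then show ?thesis by (intro exI[of _ "C\<^sup>2"]) (auto simp: C_def)
qed

text \<open>Up to constants of modulus one the factors are the squares of Weber's three functions,
  whose product is the square root of 2.\<close>

lemma siegel_half_product:
  assumes "Im \<tau> > 0"
  shows "norm (siegel 0 (1/2) \<tau> * siegel (1/2) 0 \<tau> * siegel (1/2) (1/2) \<tau>) = 2"
proof -
  define q p where "q = ee \<tau>" and "p = ee (\<tau> / 2)"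
  have p: "norm p < 1" and q: "norm q < 1" using assms by (simp_all add: p_def q_def)
  have qp: "q = p\<^sup>2" by (simp add: p_def q_def ee_power)
  have m1: "qpoch (- 1) q = 2 * qpoch (- q) q" using qpoch_rec[OF q, of "- 1"] by simp
  have h: "\<tau> - \<tau> / 2 = \<tau> / 2" "\<tau> - (\<tau> / 2 + 1 / 2) = \<tau> / 2 - 1 / 2" by (simp_all add: field_simps)
  have e: "ee (\<tau> - 1 / 2) = - q" "ee (\<tau> / 2 + 1 / 2) = - p" "ee (\<tau> - (\<tau> / 2 + 1 / 2)) = - p"
      "ee (\<tau> - \<tau> / 2) = p"
    unfolding h by (simp_all add: q_def p_def ee_diff ee_add)
  have 1: "siegel 0 (1/2) \<tau> = ee (\<tau> / 12 - 1 / 4) * (2 * qpoch (- q) q) * qpoch (- q) q"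
    by (simp add: siegel_def theta_def e m1[symmetric] flip: q_def)
  have 2: "siegel (1/2) 0 \<tau> = ee (\<tau> / 8) * ee (\<tau> / 12 - \<tau> / 4) * qpoch p q * qpoch p q"
    using e(4) by (simp add: siegel_def theta_def flip: q_def p_def)
  have 3: "siegel (1/2) (1/2) \<tau> = ee ((\<tau> + 1) / 8) * ee (\<tau> / 12 - (\<tau> + 1) / 4) * qpoch (- p) q * qpoch (- p) q"
    using e(2,3) by (simp add: siegel_def theta_def add_divide_distrib flip: q_def p_def)
  have "siegel 0 (1/2) \<tau> * siegel (1/2) 0 \<tau> * siegel (1/2) (1/2) \<tau> =
     2 * (ee (\<tau> / 12 - 1 / 4) * (ee (\<tau> / 8) * ee (\<tau> / 12 - \<tau> / 4)) *
       (ee ((\<tau> + 1) / 8) * ee (\<tau> / 12 - (\<tau> + 1) / 4))) *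
       (qpoch (- q) q * (qpoch p q * qpoch (- p) q))\<^sup>2"
    unfolding 1 2 3 by (simp add: power2_eq_square mult_ac)
  also have "qpoch (- q) q * (qpoch p q * qpoch (- p) q) = 1"
    unfolding qp by (rule qpoch_euler_half[OF p])
  also have "ee (\<tau> / 12 - 1 / 4) * (ee (\<tau> / 8) * ee (\<tau> / 12 - \<tau> / 4)) *
       (ee ((\<tau> + 1) / 8) * ee (\<tau> / 12 - (\<tau> + 1) / 4)) = ee (of_real (- 3 / 8))"
    unfolding ee_add[symmetric] by (intro arg_cong[of _ _ ee]) (simp add: field_simps)
  finally have E: "siegel 0 (1/2) \<tau> * siegel (1/2) 0 \<tau> * siegel (1/2) (1/2) \<tau> =
      2 * ee (of_real (- 3 / 8)) * 1\<^sup>2" .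
  show ?thesis unfolding E norm_mult norm_ee_real by simp
qed

text \<open>The constant from \<open>theta_inversion\<close> serves all (a, b) at once, and
  inversion permutes the three half-periods up to signs. Comparing
  \<open>siegel_half_product\<close> at - 1 / \<tau> and at \<tau> therefore gives |c| ^ 3 =
  1.\<close>

lemma siegel_inversion:
  assumes tau: "Im \<tau> > 0"
  obtains c where "norm c = 1" "\<And>a b. siegel a b (- 1 / \<tau>) = c * siegel b (- a) \<tau>"
proof -
  have t0: "\<tau> \<noteq> 0" using tau by auto
  obtain c where c: "\<And>z. theta (z / \<tau>) (- 1 / \<tau>) = c * ee (z\<^sup>2 / (2 * \<tau>)) * theta z \<tau>"
    using theta_inversion[OF tau] by blast
  have inv: "siegel a b (- 1 / \<tau>) = c * siegel b (- a) \<tau>" for a b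
  proof -
    define z where "z = of_real b * \<tau> - of_real a"
    have z: "of_real a * (- 1 / \<tau>) + of_real b = z / \<tau>" using t0 by (simp add: z_def field_simps)
    have "ee (of_real a * (z / \<tau>) / 2) * ee (z\<^sup>2 / (2 * \<tau>)) = ee (of_real b * z / 2)"
      unfolding ee_add[symmetric] using t0
      by (intro arg_cong[of _ _ ee]) (simp add: z_def field_simps power2_eq_square)
    then have "siegel a b (- 1 / \<tau>) = c * (ee (of_real b * z / 2) * theta z \<tau>)"
      unfolding siegel_def z c by (simp add: mult_ac)
    then show ?thesis by (simp add: siegel_def z_def)
  qed
  have n1: "norm (siegel (1/2) (- (1/2)) \<tau>) = norm (siegel (1/2) (1/2) \<tau>)"
    using siegel_add_1_right[of "1/2" "- (1/2)" \<tau>] norm_ee_real[of "1/4"] by (simp add: norm_mult)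
  have n2: "norm (siegel 0 (- (1/2)) \<tau>) = norm (siegel 0 (1/2) \<tau>)"
    using siegel_minus[OF tau, of 0 "1/2"] by simp
  have "2 = norm (siegel 0 (1/2) (-1/\<tau>) * siegel (1/2) 0 (-1/\<tau>) * siegel (1/2) (1/2) (-1/\<tau>))"
    by (rule siegel_half_product[symmetric]) (use Im_neg_inverse[OF tau] in simp)
  also have "\<dots> = norm c ^ 3 * norm (siegel 0 (1/2) \<tau> * siegel (1/2) 0 \<tau> * siegel (1/2) (1/2) \<tau>)"
    unfolding inv using n1 n2 by (simp add: norm_mult power3_eq_cube)
  also have "\<dots> = norm c ^ 3 * 2" unfolding siegel_half_product[OF tau] ..
  finally have "norm c ^ 3 = 1" by simp
  then have "norm c = 1" using power_eq_imp_eq_base[of "norm c" 3 1] by simp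
  then show ?thesis using that inv by blast
qed

section \<open>Products of Siegel functions\<close>

lemma ee_sum: "finite A \<Longrightarrow> ee (\<Sum>j\<in>A. f j) = (\<Prod>j\<in>A. ee (f j))"
  by (induction A rule: finite_induct) (simp_all add: ee_add)

lemma gcd_reflect_left: "k \<le> n \<Longrightarrow> gcd (n - k) n = gcd k (n::nat)"
  by (metis gcd.commute gcd_diff1_nat gcd_diff2_nat le_add_diff_inverse)

text \<open>\<open>level\<close> is the quadratic relation that makes the product
  \<open>Psi a b\<close> below depend on a and b only modulo n. Exponents that are functions of
  \<open>gcd j n\<close> are preserved when the index j is multiplied by a unit.\<close>

locale siegel_product =
  fixes n :: nat and e :: "nat \<Rightarrow> nat"
  assumes odd_n: "odd n" and n_gt_1: "n > 1"
    and level: "n dvd 2 * (\<Sum>j=1..(n - 1) div 2. e (gcd j n) * j\<^sup>2)"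
begin

definition M :: nat where "M = (n - 1) div 2"

definition wt :: nat where "wt = (\<Sum>j=1..M. e (gcd j n))"

text \<open>Since \<open>siegel\<close> is odd, half of the nonzero classes modulo \<open>n\<close> suffices. The factors \<open>2\<close> avoid
  signs in the translation by integers.\<close>

definition Psi :: "int \<Rightarrow> int \<Rightarrow> complex \<Rightarrow> complex" where
  "Psi a b \<tau> = (\<Prod>j=1..M. siegel (2 * real j * of_int a / real n) (2 * real j * of_int b / real n) \<tau> ^ e (gcd j n))"

lemma n_eq: "Suc (2 * M) = n"
  using odd_n n_gt_1 by (simp add: M_def odd_two_times_div_two_nat)

lemma Psi_holomorphic [holomorphic_intros]:
  assumes "f holomorphic_on A" "open A" "\<And>z. z \<in> A \<Longrightarrow> Im (f z) > 0"
  shows "(\<lambda>z. Psi a b (f z)) holomorphic_on A"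
  unfolding Psi_def using assms by (intro holomorphic_intros)

lemma Psi_translate: "Psi a b (\<tau> + 1) = ee (of_nat wt / 12) * Psi a (a + b) \<tau>"
proof -
  have "Psi a b (\<tau> + 1) = (\<Prod>j=1..M. ee (1 / 12) ^ e (gcd j n)) * Psi a (a + b) \<tau>"
    unfolding Psi_def siegel_translate power_mult_distrib prod.distrib
    by (simp add: algebra_simps add_divide_distrib)
  also have "(\<Prod>j=1..M. ee (1 / 12) ^ e (gcd j n)) = ee (1 / 12) ^ wt"
    unfolding wt_def power_sum ..
  also have "\<dots> = ee (of_nat wt / 12)" by (simp add: ee_power)
  finally show ?thesis .
qed

lemma Psi_translate_nat:
  "Psi a b (\<tau> + of_nat l) = ee (of_nat l * of_nat wt / 12) * Psi a (b + int l * a) \<tau>"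
proof (induction l arbitrary: b)
  case (Suc l)
  have "Psi a b (\<tau> + of_nat (Suc l)) = Psi a b ((\<tau> + of_nat l) + 1)" by (simp add: add_ac)
  also have "\<dots> = ee (of_nat wt / 12) * ee (of_nat l * of_nat wt / 12) * Psi a (a + b + int l * a) \<tau>"
    unfolding Psi_translate Suc by simp
  also have "ee (of_nat wt / 12) * ee (of_nat l * of_nat wt / 12) = ee (of_nat (Suc l) * of_nat wt / 12)"
    unfolding ee_add[symmetric] by (simp add: field_simps)
  finally show ?case by (simp add: algebra_simps)
qed simp

lemma Psi_inversion:
  assumes "Im \<tau> > 0"
  obtains c where "norm c = 1" "\<And>a b. Psi a b (- 1 / \<tau>) = c * Psi b (- a) \<tau>"
proof -
  obtain c where c: "norm c = 1" "\<And>a b. siegel a b (- 1 / \<tau>) = c * siegel b (- a) \<tau>"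
    using siegel_inversion[OF assms] by blast
  have "Psi a b (- 1 / \<tau>) = c ^ wt * Psi b (- a) \<tau>" for a b
    unfolding Psi_def c(2) power_mult_distrib prod.distrib wt_def power_sum by simp
  moreover have "norm (c ^ wt) = 1" by (simp add: norm_power c)
  ultimately show ?thesis using that by blast
qed

lemma level_real:
  obtains s :: int where "of_int s * real n = 2 * (\<Sum>j=1..M. real (e (gcd j n)) * (real j)\<^sup>2)"
proof -
  obtain s where "2 * (\<Sum>j=1..M. e (gcd j n) * j\<^sup>2) = n * s"
    using level unfolding M_def by blast
  then have "real (2 * (\<Sum>j=1..M. e (gcd j n) * j\<^sup>2)) = real (n * s)" by metis
  then have "of_int (int s) * real n = 2 * (\<Sum>j=1..M. real (e (gcd j n)) * (real j)\<^sup>2)"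
    by (simp add: mult_ac)
  then show ?thesis using that by blast
qed

text \<open>Translating an argument of \<open>Psi\<close> by a multiple of n multiplies the j-th
  factor by an exponential of this shape, quadratic in j; the level condition makes these constants
  cancel.\<close>

lemma level_ee:
  "(\<Prod>j=1..M. ee (of_real (2 * (real j)\<^sup>2 * of_int k / real n)) ^ e (gcd j n)) = 1"
proof -
  obtain s :: int where s: "of_int s * real n = 2 * (\<Sum>j=1..M. real (e (gcd j n)) * (real j)\<^sup>2)"
    by (rule level_real)
  have "(\<Prod>j=1..M. ee (of_real (2 * (real j)\<^sup>2 * of_int k / real n)) ^ e (gcd j n)) =
      ee (\<Sum>j=1..M. of_real (real (e (gcd j n)) * (2 * (real j)\<^sup>2 * of_int k / real n)))"
    by (simp add: ee_sum ee_power)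
  also have "(\<Sum>j=1..M. of_real (real (e (gcd j n)) * (2 * (real j)\<^sup>2 * of_int k / real n))) =
      complex_of_real (of_int k / real n * (2 * (\<Sum>j=1..M. real (e (gcd j n)) * (real j)\<^sup>2)))"
    unfolding of_real_sum[symmetric] sum_distrib_left by (intro arg_cong[of _ _ of_real] sum.cong) auto
  also have "\<dots> = complex_of_real (of_int (k * s))"
    unfolding s[symmetric] using n_gt_1 by simp
  finally show ?thesis by (simp del: of_int_mult)
qed

lemma Psi_period_left:
  assumes "Im \<tau> > 0"
  shows "Psi (a + int n * k) b \<tau> = Psi a b \<tau>"
proof -
  have "siegel (2 * real j * of_int (a + int n * k) / real n) y \<tau> =
      ee (- of_int (int j * k) * of_real y) * siegel (2 * real j * of_int a / real n) y \<tau>" for j y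
    using n_gt_1 siegel_add_even_left[OF assms, of "2 * real j * of_int a / real n" "int j * k" y]
    by (simp add: field_simps)
  then have F: "Psi (a + int n * k) b \<tau> =
      (\<Prod>j=1..M. ee (- of_int (int j * k) * of_real (2 * real j * of_int b / real n)) ^ e (gcd j n)) * Psi a b \<tau>"
    unfolding Psi_def prod.distrib[symmetric] power_mult_distrib[symmetric] by simp
  have E: "(- of_int (int j * k) * of_real (2 * real j * of_int b / real n)) =
      complex_of_real (2 * (real j)\<^sup>2 * of_int (- k * b) / real n)" for j
    by (simp add: power2_eq_square mult_ac)
  show ?thesis unfolding F E level_ee by simp
qed

lemma Psi_period_right: "Psi a (b + int n * k) \<tau> = Psi a b \<tau>"
proof -
  have "siegel y (2 * real j * of_int (b + int n * k) / real n) \<tau> =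
      ee (of_int (int j * k) * of_real y) * siegel y (2 * real j * of_int b / real n) \<tau>" for j y
    using n_gt_1 siegel_add_even_right[of y "2 * real j * of_int b / real n" "int j * k" \<tau>]
    by (simp add: field_simps)
  then have F: "Psi a (b + int n * k) \<tau> =
      (\<Prod>j=1..M. ee (of_int (int j * k) * of_real (2 * real j * of_int a / real n)) ^ e (gcd j n)) * Psi a b \<tau>"
    unfolding Psi_def prod.distrib[symmetric] power_mult_distrib[symmetric] by simp
  have E: "(of_int (int j * k) * of_real (2 * real j * of_int a / real n)) =
      complex_of_real (2 * (real j)\<^sup>2 * of_int (k * a) / real n)" for j
    by (simp add: power2_eq_square mult_ac)
  show ?thesis unfolding F E level_ee by simp
qed

lemma Psi_cong:
  assumes "Im \<tau> > 0" "[a = a'] (mod int n)" "[b = b'] (mod int n)"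
  shows "Psi a b \<tau> = Psi a' b' \<tau>"
proof -
  obtain k l where "a' = a + int n * k" "b' = b + int n * l"
    using assms(2,3) by (metis cong_iff_lin)
  then show ?thesis using Psi_period_left[OF assms(1)] Psi_period_right by metis
qed

text \<open>\<open>ord\<close> sums the Bernoulli values of \<open>norm_siegel_bound\<close>,
  multiplied by 6 n ^ 2 so that only integers occur. In terms of ee \<tau> the conclusion bounds the
  order of the pole by K / 12.\<close>

lemma norm_Psi_bound:
  assumes ord: "\<And>a. (\<Sum>j=1..M. int (e (gcd j n)) *
      (6 * ((2 * int j * a) mod int n)\<^sup>2 - 6 * ((2 * int j * a) mod int n) * int n + (int n)\<^sup>2)) \<ge> - K * (int n)\<^sup>2"
  shows "\<exists>C>0. \<forall>a b \<tau>. Im \<tau> \<ge> 1 / 2 \<longrightarrow> norm (Psi a b \<tau>) \<le> C * exp (pi * Im \<tau> * of_int K / 6)"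
proof -
  obtain C where C: "C > 0" "\<And>a b \<tau>. Im \<tau> \<ge> 1 / 2 \<Longrightarrow>
     norm (siegel a b \<tau>) \<le> C * exp (- pi * Im \<tau> * ((frac a)\<^sup>2 - frac a + 1 / 6))"
    using norm_siegel_bound by blast
  have "norm (Psi a b \<tau>) \<le> C ^ wt * exp (pi * Im \<tau> * of_int K / 6)" if tau: "Im \<tau> \<ge> 1 / 2" for a b \<tau>
  proof -
    define x where "x j = frac (2 * real j * of_int a / real n)" for j
    define y where "y j = (2 * int j * a) mod int n" for j
    define S where "S = (\<Sum>j=1..M. int (e (gcd j n)) * (6 * (y j)\<^sup>2 - 6 * y j * int n + (int n)\<^sup>2))"
    have xy: "x j = of_int (y j) / real n" for j
    proof -
      have "2 * real j * of_int a / real n = of_int (2 * int j * a) / of_int (int n)" by simp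
      then have "\<lfloor>2 * real j * of_int a / real n\<rfloor> = (2 * int j * a) div int n"
        by (metis floor_divide_of_int_eq)
      moreover have "real_of_int (2 * int j * a) =
          real_of_int ((2 * int j * a) div int n) * real n + real_of_int (y j)"
        unfolding y_def by (metis div_mult_mod_eq of_int_add of_int_mult of_int_of_nat_eq)
      ultimately show ?thesis using n_gt_1 by (simp add: x_def frac_def field_simps)
    qed
    have "norm (Psi a b \<tau>) = (\<Prod>j=1..M. norm (siegel (2 * real j * of_int a / real n)
        (2 * real j * of_int b / real n) \<tau>) ^ e (gcd j n))"
      by (simp add: Psi_def prod_norm[symmetric] norm_power)
    also have "\<dots> \<le> (\<Prod>j=1..M. (C * exp (- pi * Im \<tau> * ((x j)\<^sup>2 - x j + 1 / 6))) ^ e (gcd j n))"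
      unfolding x_def by (intro prod_mono conjI power_mono C(2)[OF tau]) auto
    also have "\<dots> = C ^ wt * exp (\<Sum>j=1..M. real (e (gcd j n)) * (- pi * Im \<tau> * ((x j)\<^sup>2 - x j + 1 / 6)))"
      unfolding power_mult_distrib prod.distrib wt_def power_sum exp_sum[OF finite_atLeastAtMost]
        exp_of_nat_mult ..
    also have "(\<Sum>j=1..M. real (e (gcd j n)) * (- pi * Im \<tau> * ((x j)\<^sup>2 - x j + 1 / 6))) =
        - pi * Im \<tau> / (6 * (real n)\<^sup>2) * of_int S"
      unfolding of_int_sum sum_distrib_left S_def
      by (intro sum.cong refl) (use n_gt_1 in \<open>simp add: xy field_simps power2_eq_square\<close>)
    also have "\<dots> \<le> - pi * Im \<tau> / (6 * (real n)\<^sup>2) * of_int (- K * (int n)\<^sup>2)"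
    proof (rule mult_left_mono_neg)
      show "real_of_int (- K * (int n)\<^sup>2) \<le> of_int S"
        unfolding of_int_le_iff S_def y_def by (rule ord)
      show "- pi * Im \<tau> / (6 * (real n)\<^sup>2) \<le> 0" using tau by (simp add: divide_nonneg_nonneg)
    qed
    also have "\<dots> = pi * Im \<tau> * of_int K / 6" using n_gt_1 by (simp add: field_simps)
    finally show ?thesis using C(1) by simp
  qed
  then show ?thesis using C(1) by (intro exI[of _ "C ^ wt"]) auto
qed

text \<open>\<open>Psi 1 0\<close> is \<open>Q (ee (\<tau> / n))\<close> up to a constant and the exponential with exponent \<open>lead\<close>.\<close>

definition Q :: "complex \<Rightarrow> complex" where
  "Q x = (\<Prod>k=1..<n. qpoch (x ^ k) (x ^ n) ^ e (gcd k n))"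

definition lead :: real where
  "lead = (\<Sum>j=1..M. real (e (gcd j n)) * ((2 * real j / real n)\<^sup>2 - 2 * real j / real n + 1 / 6) / 2)"

text \<open>As n is odd, 2 * j runs through the even and n - 2 * j through the odd numbers below n.
  This merges the two products of each theta factor into the single product
  \<open>Q\<close>.\<close>

lemma prod_fold: "(\<Prod>j=1..M. f (2 * j) * f (n - 2 * j)) = (\<Prod>k=1..<n. f k)"
proof -
  have inj: "inj_on (\<lambda>j. 2 * j) {1..M}" "inj_on (\<lambda>j. n - 2 * j) {1..M}"
    using n_eq by (auto simp: inj_on_def)
  have "(\<Prod>j=1..M. f (2 * j) * f (n - 2 * j)) =
      prod f ((\<lambda>j. 2 * j) ` {1..M}) * prod f ((\<lambda>j. n - 2 * j) ` {1..M})"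
    unfolding prod.distrib prod.reindex[OF inj(1)] prod.reindex[OF inj(2)] o_def ..
  also have "\<dots> = prod f ((\<lambda>j. 2 * j) ` {1..M} \<union> (\<lambda>j. n - 2 * j) ` {1..M})"
  proof (rule prod.union_disjoint[symmetric])
    show "(\<lambda>j. 2 * j) ` {1..M} \<inter> (\<lambda>j. n - 2 * j) ` {1..M} = {}"
    proof -
      have "2 * i \<noteq> n - 2 * j" if "j \<le> M" for i j
      proof
        assume "2 * i = n - 2 * j"
        then have "n = 2 * (i + j)" using that n_eq by arith
        then show False using odd_n by simp
      qed
      then show ?thesis by auto
    qed
  qed auto
  also have "(\<lambda>j. 2 * j) ` {1..M} \<union> (\<lambda>j. n - 2 * j) ` {1..M} = {1..<n}"
  proof (intro equalityI subsetI)
    fix k assume k: "k \<in> {1..<n}"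
    show "k \<in> (\<lambda>j. 2 * j) ` {1..M} \<union> (\<lambda>j. n - 2 * j) ` {1..M}"
    proof (cases "even k")
      case True
      then obtain i where i: "k = 2 * i" by blast
      then have "i \<in> {1..M}" using k n_eq by auto
      then show ?thesis using i by blast
    next
      case False
      define j where "j = (n - k) div 2"
      have "2 * j = n - k" using False odd_n k by (simp add: j_def)
      then have "k = n - 2 * j" "j \<in> {1..M}" using k n_eq by auto
      then show ?thesis by blast
    qed
  qed (use n_eq in auto)
  finally show ?thesis .
qed

lemma gcd_double: "gcd (2 * j) n = gcd j n"
  using odd_n by (simp add: gcd_mult_left_left_cancel coprime_commute)

lemma Psi_1_0:
  assumes "Im \<tau> > 0"
  shows "Psi 1 0 \<tau> = ee (of_real lead * \<tau>) * Q (ee (\<tau> / of_nat n))"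
proof -
  define X where "X = ee (\<tau> / of_nat n)"
  define f where "f k = qpoch (X ^ k) (X ^ n) ^ e (gcd k n)" for k
  define b where "b j = of_real (((2 * real j / real n)\<^sup>2 - 2 * real j / real n + 1 / 6) / 2) * \<tau>" for j
  have n0: "n \<noteq> 0" using n_gt_1 by simp
  have Xn: "X ^ n = ee \<tau>" using n0 by (simp add: X_def ee_power)
  have "siegel (2 * real j * of_int 1 / real n) (2 * real j * of_int 0 / real n) \<tau> ^ e (gcd j n) =
      ee (b j) ^ e (gcd j n) * (f (2 * j) * f (n - 2 * j))" if j: "j \<in> {1..M}" for j
  proof -
    define x where "x = 2 * real j / real n"
    have nj: "2 * j \<le> n" using j n_eq by auto
    have 1: "ee (of_real x * \<tau>) = X ^ (2 * j)" using n0 by (simp add: X_def ee_power x_def)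
    have 2: "ee (\<tau> - of_real x * \<tau>) = X ^ (n - 2 * j)"
      using n0 nj unfolding X_def ee_power
      by (intro arg_cong[of _ _ ee]) (simp add: x_def field_simps of_nat_diff)
    have 3: "ee (of_real x * (of_real x * \<tau>) / 2) * ee (\<tau> / 12 - of_real x * \<tau> / 2) = ee (b j)"
      unfolding ee_add[symmetric] b_def x_def[symmetric]
      by (intro arg_cong[of _ _ ee]) (simp add: field_simps power2_eq_square)
    have "siegel x 0 \<tau> = ee (b j) * (qpoch (X ^ (2 * j)) (X ^ n) * qpoch (X ^ (n - 2 * j)) (X ^ n))"
      unfolding siegel_def theta_def Xn by (simp add: 1 2 3[symmetric])
    then show ?thesis using nj
      by (simp add: x_def power_mult_distrib f_def gcd_double gcd_reflect_left)
  qed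
  then have "Psi 1 0 \<tau> = (\<Prod>j=1..M. ee (b j) ^ e (gcd j n)) * (\<Prod>j=1..M. f (2 * j) * f (n - 2 * j))"
    unfolding Psi_def prod.distrib[symmetric] by (intro prod.cong refl)
  also have "(\<Prod>j=1..M. ee (b j) ^ e (gcd j n)) = ee (\<Sum>j=1..M. of_nat (e (gcd j n)) * b j)"
    by (simp add: ee_sum ee_power)
  also have "(\<Sum>j=1..M. of_nat (e (gcd j n)) * b j) = of_real lead * \<tau>"
    unfolding lead_def of_real_sum sum_distrib_right
    by (intro sum.cong refl) (simp add: b_def)
  also have "(\<Prod>j=1..M. f (2 * j) * f (n - 2 * j)) = Q X" unfolding prod_fold by (simp add: Q_def f_def)
  finally show ?thesis by (simp add: X_def)
qed

end

section \<open>Functions with modular absolute value\<close>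

lemma norm_translate_int:
  fixes F :: "complex \<Rightarrow> complex"
  assumes T: "\<And>\<tau>. Im \<tau> > 0 \<Longrightarrow> norm (F (\<tau> + 1)) = norm (F \<tau>)" and "Im \<tau> > 0"
  shows "norm (F (\<tau> + of_int k)) = norm (F \<tau>)"
proof (induction k rule: int_induct[where k = 0])
  case (step1 i)
  then show ?case using T[of "\<tau> + of_int i"] assms(2) by (simp add: add.assoc)
next
  case (step2 i)
  then show ?case using T[of "\<tau> + of_int (i - 1)"] assms(2) by (simp add: add.assoc)
qed simp

text \<open>In the strip |Re| \<le> 1 / 2 a point below height 1 / 2 has squared modulus at most 1 /
  2, so inversion at least doubles its height; the induction is on the number of doublings.\<close>

lemma exists_reduced_point:
  fixes F :: "complex \<Rightarrow> complex"
  assumes T: "\<And>\<tau>. Im \<tau> > 0 \<Longrightarrow> norm (F (\<tau> + 1)) = norm (F \<tau>)"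
    and S: "\<And>\<tau>. Im \<tau> > 0 \<Longrightarrow> norm (F (- 1 / \<tau>)) = norm (F \<tau>)"
    and "Im \<tau> > 0"
  shows "\<exists>\<sigma>. \<bar>Re \<sigma>\<bar> \<le> 1 / 2 \<and> Im \<sigma> \<ge> 1 / 2 \<and> norm (F \<sigma>) = norm (F \<tau>)"
proof -
  have transl: "\<exists>\<sigma>. \<bar>Re \<sigma>\<bar> \<le> 1 / 2 \<and> Im \<sigma> = Im \<tau> \<and> norm (F \<sigma>) = norm (F \<tau>)"
    if "Im \<tau> > 0" for \<tau>
  proof -
    have "\<bar>Re (\<tau> + of_int (- round (Re \<tau>)))\<bar> \<le> 1 / 2"
      using of_int_round_abs_le[of "Re \<tau>"] by (simp add: abs_minus_commute)
    then show ?thesis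
      using norm_translate_int[where F = F, OF T that, of "- round (Re \<tau>)"]
      by (intro exI[of _ "\<tau> + of_int (- round (Re \<tau>))"]) simp
  qed
  have main: "\<exists>\<sigma>. \<bar>Re \<sigma>\<bar> \<le> 1 / 2 \<and> Im \<sigma> \<ge> 1 / 2 \<and> norm (F \<sigma>) = norm (F \<tau>)"
    if "Im \<tau> > 0" "2 ^ k * Im \<tau> \<ge> 1 / 2" for k \<tau>
    using that
  proof (induction k arbitrary: \<tau>)
    case 0
    then show ?case using transl[of \<tau>] by force
  next
    case (Suc k)
    obtain \<sigma> where s: "\<bar>Re \<sigma>\<bar> \<le> 1 / 2" "Im \<sigma> = Im \<tau>" "norm (F \<sigma>) = norm (F \<tau>)"
      using transl Suc.prems by blast
    show ?case
    proof (cases "Im \<sigma> \<ge> 1 / 2")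
      case False
      have s0: "Im \<sigma> > 0" using s Suc.prems by simp
      have "(Re \<sigma>)\<^sup>2 \<le> (1 / 2)\<^sup>2" using s(1) abs_le_square_iff[of "Re \<sigma>" "1 / 2"] by simp
      moreover have "(Im \<sigma>)\<^sup>2 \<le> (1 / 2)\<^sup>2" using s0 False by (intro power_mono) auto
      ultimately have n: "(Re \<sigma>)\<^sup>2 + (Im \<sigma>)\<^sup>2 \<le> 1 / 2" by (simp add: power2_eq_square)
      have p: "(Re \<sigma>)\<^sup>2 + (Im \<sigma>)\<^sup>2 > 0" using s0 by (simp add: add_nonneg_pos)
      have "Im (- 1 / \<sigma>) = Im \<sigma> / ((Re \<sigma>)\<^sup>2 + (Im \<sigma>)\<^sup>2)" by (simp add: Im_divide)
      also have "\<dots> \<ge> Im \<sigma> / (1 / 2)" using n p s0 by (intro divide_left_mono) auto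
      finally have i: "Im (- 1 / \<sigma>) \<ge> 2 * Im \<tau>" using s by simp
      have "2 ^ k * Im (- 1 / \<sigma>) \<ge> 2 ^ k * (2 * Im \<tau>)" by (intro mult_left_mono i) simp
      with Suc.prems have "2 ^ k * Im (- 1 / \<sigma>) \<ge> 1 / 2" by simp
      from Suc.IH[OF _ this] i Suc.prems obtain \<sigma>' where
        "\<bar>Re \<sigma>'\<bar> \<le> 1 / 2" "Im \<sigma>' \<ge> 1 / 2" "norm (F \<sigma>') = norm (F (- 1 / \<sigma>))" by auto
      then show ?thesis using S[OF s0] s by auto
    qed (use s in blast)
  qed
  obtain k where "2 ^ k > (1 / 2) / Im \<tau>" using real_arch_pow[of 2] by auto
  then have "2 ^ k * Im \<tau> \<ge> 1 / 2" using assms(3) by (simp add: field_simps)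
  then show ?thesis using main assms(3) by blast
qed

text \<open>Reduction brings every value of |F| into the strip. Above height \<open>Y\<close> the
  values are smaller than m, and below it a maximum is attained on a rectangle. This maximum is
  global and attained inside the half-plane, so F is constant, and its decay contradicts m >
  0.\<close>

lemma invariant_decay_imp_zero:
  fixes F :: "complex \<Rightarrow> complex"
  assumes hol: "F holomorphic_on {\<tau>. Im \<tau> > 0}"
    and T: "\<And>\<tau>. Im \<tau> > 0 \<Longrightarrow> norm (F (\<tau> + 1)) = norm (F \<tau>)"
    and S: "\<And>\<tau>. Im \<tau> > 0 \<Longrightarrow> norm (F (- 1 / \<tau>)) = norm (F \<tau>)"
    and decay: "\<And>\<tau>. Im \<tau> \<ge> 1 / 2 \<Longrightarrow> norm (F \<tau>) \<le> C * exp (- c * Im \<tau>)" and c: "c > 0"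
    and tau: "Im \<tau> > 0"
  shows "F \<tau> = 0"
proof (rule ccontr)
  assume nz: "F \<tau> \<noteq> 0"
  define m where "m = norm (F \<tau>)"
  have m: "m > 0" using nz by (simp add: m_def)
  have "((\<lambda>y. C * exp (- c * y)) \<longlongrightarrow> C * 0) at_top"
    using c by (intro tendsto_mult_left) real_asymp
  then have "\<forall>\<^sub>F y in at_top. C * exp (- c * y) < m" using m by (intro order_tendstoD) auto
  then obtain Y where Y: "\<And>y. y \<ge> Y \<Longrightarrow> C * exp (- c * y) < m"
    unfolding eventually_at_top_linorder by blast
  have small: "norm (F \<sigma>) < m" if "Im \<sigma> \<ge> 1 / 2" "Im \<sigma> \<ge> Y" for \<sigma>
    using decay[OF that(1)] Y[OF that(2)] by simp
  define R where "R = cbox (Complex (- 1 / 2) (1 / 2)) (Complex (1 / 2) Y)"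
  have R: "\<sigma> \<in> R \<longleftrightarrow> \<bar>Re \<sigma>\<bar> \<le> 1 / 2 \<and> 1 / 2 \<le> Im \<sigma> \<and> Im \<sigma> \<le> Y" for \<sigma>
    by (auto simp: R_def in_cbox_complex_iff abs_le_iff)
  obtain \<sigma>0 where s0: "\<bar>Re \<sigma>0\<bar> \<le> 1 / 2" "Im \<sigma>0 \<ge> 1 / 2" "norm (F \<sigma>0) = m"
    using exists_reduced_point[where F = F, OF T S tau] by (auto simp: m_def)
  then have s0R: "\<sigma>0 \<in> R" using small[of \<sigma>0] by (force simp: R)
  have "compact R" by (simp add: R_def)
  moreover have "continuous_on R (\<lambda>\<sigma>. norm (F \<sigma>))"
    by (intro continuous_intros holomorphic_on_imp_continuous_on holomorphic_on_subset[OF hol]) (auto simp: R)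
  ultimately obtain \<xi> where xi: "\<xi> \<in> R" "\<And>\<sigma>. \<sigma> \<in> R \<Longrightarrow> norm (F \<sigma>) \<le> norm (F \<xi>)"
    using continuous_attains_sup[of R "\<lambda>\<sigma>. norm (F \<sigma>)"] s0R by blast
  have max: "norm (F \<sigma>) \<le> norm (F \<xi>)" if "Im \<sigma> > 0" for \<sigma>
  proof -
    obtain \<sigma>' where s: "\<bar>Re \<sigma>'\<bar> \<le> 1 / 2" "Im \<sigma>' \<ge> 1 / 2" "norm (F \<sigma>') = norm (F \<sigma>)"
      using exists_reduced_point[where F = F, OF T S \<open>Im \<sigma> > 0\<close>] by blast
    show ?thesis
    proof (cases "Im \<sigma>' \<le> Y")
      case True
      then show ?thesis using xi(2)[of \<sigma>'] s by (simp add: R)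
    next
      case False
      then show ?thesis using small[of \<sigma>'] s xi(2)[OF s0R] s0 by simp
    qed
  qed
  have "F constant_on {\<tau>. Im \<tau> > 0}"
  proof (rule maximum_modulus_principle[OF hol])
    show "\<xi> \<in> {\<tau>. Im \<tau> > 0}" using xi(1) by (simp add: R)
  qed (use max in \<open>auto simp: open_halfspace_Im_gt convex_halfspace_Im_gt convex_connected\<close>)
  then obtain d where d: "\<And>\<sigma>. Im \<sigma> > 0 \<Longrightarrow> F \<sigma> = d" by (auto simp: constant_on_def)
  have "norm (F (Complex 0 (max (1 / 2) Y))) < m" by (intro small) auto
  then show False using d[OF tau] d[of "Complex 0 (max (1 / 2) Y)"] by (simp add: m_def max_def split: if_splits)
qed

text \<open>On the open set where one factor is nonzero the product of the others vanishes, and the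
  identity theorem extends this to all of A.\<close>

lemma holomorphic_prod_eq_0:
  assumes "finite I" "open A" "connected A" "A \<noteq> {}"
    and "\<And>i. i \<in> I \<Longrightarrow> f i holomorphic_on A" and "\<And>z. z \<in> A \<Longrightarrow> (\<Prod>i\<in>I. f i z) = (0::complex)"
  shows "\<exists>i\<in>I. \<forall>z\<in>A. f i z = 0"
  using assms(1,5,6)
proof (induction I rule: finite_induct)
  case (insert i I)
  show ?case
  proof (cases "\<forall>z\<in>A. f i z = 0")
    case False
    then obtain z0 where z0: "z0 \<in> A" "f i z0 \<noteq> 0" by blast
    define U where "U = A \<inter> f i -` (- {0})"
    have "open U" unfolding U_def
      by (intro continuous_open_preimage holomorphic_on_imp_continuous_on insert assms) auto
    have hol: "(\<lambda>z. \<Prod>i\<in>I. f i z) holomorphic_on A"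
      using insert by (auto intro!: holomorphic_intros)
    have U0: "(\<Prod>i\<in>I. f i z) = 0" if "z \<in> U" for z
    proof -
      have "(\<Prod>i\<in>insert i I. f i z) = 0" "f i z \<noteq> 0"
        using that insert.prems(2)[of z] by (auto simp: U_def simp del: prod.insert)
      then show ?thesis using insert.hyps by simp
    qed
    have "(\<Prod>i\<in>I. f i z) = 0" if "z \<in> A" for z
      by (rule analytic_continuation_open[of U A "\<lambda>z. \<Prod>i\<in>I. f i z" "\<lambda>_. 0"])
         (use \<open>open U\<close> z0 that assms(2,3) hol U0 in \<open>auto simp: U_def\<close>)
    then show ?thesis using insert by auto
  qed auto
qed (use assms(4) in auto)

text \<open>Translations and inversion carry out the Euclidean algorithm on (x, y).\<close>

lemma unimodular_transitive:
  fixes P :: "int \<Rightarrow> int \<Rightarrow> bool"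
  assumes T: "\<And>x y. P x y \<longleftrightarrow> P x (x + y)" and S: "\<And>x y. P x y \<longleftrightarrow> P y (- x)"
    and per: "\<And>x y. P x y \<longleftrightarrow> P (x + n) y"
    and "gcd (gcd x y) n = 1"
  shows "P x y \<longleftrightarrow> P 0 1"
proof -
  have neg: "P x y \<longleftrightarrow> P (- x) (- y)" for x y using S[of x y] S[of y "- x"] by simp
  have Tk: "P x (y + k * x) \<longleftrightarrow> P x y" for x y k
  proof (induction k rule: int_induct[where k = 0])
    case (step1 i)
    then show ?case using T[of x "y + i * x"] by (simp add: algebra_simps)
  next
    case (step2 i)
    then show ?case using T[of x "y + (i - 1) * x"] by (simp add: algebra_simps)
  qed simp
  have euclid: "P x y \<longleftrightarrow> P 0 (gcd x y)" for x y
  proof (induction "nat \<bar>x\<bar>" arbitrary: x y rule: less_induct)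
    case less
    show ?case
    proof (cases "x = 0")
      case True
      then show ?thesis using neg[of 0 y] by (cases "y \<ge> 0") auto
    next
      case False
      have "y mod x = y + (- (y div x)) * x" by (simp add: minus_div_mult_eq_mod[symmetric])
      then have "P x y \<longleftrightarrow> P x (y mod x)" using Tk[of x y "- (y div x)"] by simp
      also have "\<dots> \<longleftrightarrow> P (y mod x) (- x)" by (rule S)
      also have "\<dots> \<longleftrightarrow> P 0 (gcd (y mod x) (- x))"
        using False by (intro less) (auto simp: abs_mod_less)
      also have "gcd (y mod x) (- x) = gcd x y" by (simp add: gcd.commute gcd_red_int[symmetric])
      finally show ?thesis .
    qed
  qed
  have "P x y \<longleftrightarrow> P 0 (gcd x y)" by (rule euclid)
  \<comment> \<open>Periodicity replaces the entry 0 by n, and the algorithm runs once more, now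
    ending at the gcd of all three numbers, which is 1.\<close>
  also have "\<dots> \<longleftrightarrow> P n (gcd x y)" using per[of 0] by simp
  also have "\<dots> \<longleftrightarrow> P 0 1" using euclid[of n "gcd x y"] assms(4) by (simp add: gcd.commute)
  finally show ?thesis .
qed

section \<open>Residue classes of exponents\<close>

lemma sum_periodic_shift:
  fixes G :: "int \<Rightarrow> 'a :: ab_group_add"
  assumes "\<And>j. G (j + int n) = G j"
  shows "(\<Sum>j<n. G (int j + l)) = (\<Sum>j<n. G (int j))"
proof -
  have step: "(\<Sum>j<n. G (int j + (l + 1))) = (\<Sum>j<n. G (int j + l))" for l
  proof -
    have "(\<Sum>j<Suc n. G (int j + l)) = G l + (\<Sum>j<n. G (int j + (l + 1)))"
      by (subst sum.lessThan_Suc_shift) (simp add: algebra_simps)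
    moreover have "(\<Sum>j<Suc n. G (int j + l)) = G l + (\<Sum>j<n. G (int j + l))"
      using assms[of l] by (simp add: algebra_simps)
    ultimately show ?thesis by simp
  qed
  show ?thesis
  proof (induction l rule: int_induct[where k = 0])
    case (step1 i)
    then show ?case using step[of i] by simp
  next
    case (step2 i)
    then show ?case using step[of "i - 1"] by simp
  qed simp
qed

lemma sum_roots_of_unity:
  assumes "n > 0"
  shows "(\<Sum>j<n. ee (of_nat j * of_int k / of_nat n)) = (if int n dvd k then of_nat n else 0)"
proof -
  define w where "w = ee (of_int k / of_nat n)"
  have pow: "ee (of_nat j * of_int k / of_nat n) = w ^ j" for j
    by (simp add: w_def ee_power)
  have wn: "w ^ n = 1" using assms by (simp add: w_def ee_power)
  have "w = 1 \<longleftrightarrow> int n dvd k"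
  proof
    assume "w = 1"
    then obtain m where m: "of_int k / of_nat n = (of_int m :: complex)"
      by (auto simp: w_def ee_eq_1_iff elim: Ints_cases)
    then have "of_int k = (of_int (m * int n) :: complex)" using assms by (simp add: field_simps)
    then show "int n dvd k" by (metis dvd_triv_right of_int_eq_iff)
  next
    assume "int n dvd k"
    then obtain m where "k = int n * m" by blast
    then have "of_int k / of_nat n = (of_int m :: complex)" using assms by simp
    then show "w = 1" by (simp add: w_def)
  qed
  then show ?thesis using sum_gp_basic[of w n] geometric_sum[of w n] wn
    by (auto simp: pow)
qed

context siegel_product
begin

text \<open>These are the vectors that can be completed to a matrix of determinant one modulo
  n.\<close>

definition unimod :: "int \<Rightarrow> int \<Rightarrow> bool" where
  "unimod x y \<longleftrightarrow> gcd (gcd x y) (int n) = 1"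

text \<open>Summing over the \<open>n\<close> translates along \<open>(x, y)\<close> against a character keeps one residue class of
  exponents. Up to a constant of modulus one, the sum depends only on \<open>(x, y)\<close> if \<open>(a, b)\<close> completes
  \<open>(x, y)\<close> to determinant one.\<close>

definition H :: "int \<Rightarrow> int \<Rightarrow> int \<Rightarrow> int \<Rightarrow> int \<Rightarrow> complex \<Rightarrow> complex" where
  "H \<rho> a b x y \<tau> = (\<Sum>j<n. ee (- of_int (\<rho> * int j) / of_nat n) * Psi (a + int j * x) (b + int j * y) \<tau>)"

lemma H_holomorphic: "H \<rho> a b x y holomorphic_on {\<tau>. Im \<tau> > 0}"
  unfolding H_def by (intro holomorphic_intros) (auto simp: open_halfspace_Im_gt)

lemma H_translate: "H \<rho> a b x y (\<tau> + 1) = ee (of_nat wt / 12) * H \<rho> a (a + b) x (x + y) \<tau>"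
  unfolding H_def Psi_translate sum_distrib_left
  by (intro sum.cong refl) (simp add: algebra_simps)

lemma norm_H_inversion:
  assumes "Im \<tau> > 0"
  shows "norm (H \<rho> a b x y (- 1 / \<tau>)) = norm (H \<rho> b (- a) y (- x) \<tau>)"
proof -
  obtain c where c: "norm c = 1" "\<And>a b. Psi a b (- 1 / \<tau>) = c * Psi b (- a) \<tau>"
    using Psi_inversion[OF assms] by blast
  have "H \<rho> a b x y (- 1 / \<tau>) = c * H \<rho> b (- a) y (- x) \<tau>"
    unfolding H_def c(2) sum_distrib_left by (intro sum.cong refl) simp
  then show ?thesis by (simp add: norm_mult c)
qed

lemma H_cong:
  assumes "Im \<tau> > 0" "[a = a'] (mod int n)" "[b = b'] (mod int n)"
    "[x = x'] (mod int n)" "[y = y'] (mod int n)"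
  shows "H \<rho> a b x y \<tau> = H \<rho> a' b' x' y' \<tau>"
  unfolding H_def using assms
  by (intro sum.cong refl arg_cong2[of _ _ _ _ "(*)"] Psi_cong cong_add cong_mult cong_refl)

text \<open>A shift of (a, b) along (x, y) only renumbers the sum, at the price of a value of the
  character.\<close>

lemma H_shift:
  assumes "Im \<tau> > 0"
  shows "H \<rho> (a + l * x) (b + l * y) x y \<tau> = ee (of_int (\<rho> * l) / of_nat n) * H \<rho> a b x y \<tau>"
proof -
  define G where "G j = ee (- of_int (\<rho> * j) / of_nat n) * Psi (a + j * x) (b + j * y) \<tau>" for j
  have per: "G (j + int n) = G j" for j
  proof -
    have "ee (- of_int (\<rho> * (j + int n)) / of_nat n) = ee (- of_int (\<rho> * j) / of_nat n) * ee (of_int (- \<rho>))"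
      unfolding ee_add[symmetric] using n_gt_1 by (intro arg_cong[of _ _ ee]) (simp add: field_simps)
    moreover have "Psi (a + (j + int n) * x) (b + (j + int n) * y) \<tau> = Psi (a + j * x) (b + j * y) \<tau>"
      by (rule Psi_cong[OF assms]) (simp_all add: cong_iff_dvd_diff algebra_simps)
    ultimately show ?thesis by (simp only: G_def ee_of_int mult_1_right)
  qed
  have "H \<rho> (a + l * x) (b + l * y) x y \<tau> = (\<Sum>j<n. ee (of_int (\<rho> * l) / of_nat n) * G (int j + l))"
    unfolding H_def
  proof (intro sum.cong refl)
    fix j
    have "ee (- of_int (\<rho> * int j) / of_nat n) =
        ee (of_int (\<rho> * l) / of_nat n) * ee (- of_int (\<rho> * (int j + l)) / of_nat n)"
      unfolding ee_add[symmetric] using n_gt_1 by (intro arg_cong[of _ _ ee]) (simp add: field_simps)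
    then show "ee (- of_int (\<rho> * int j) / of_nat n) * Psi (a + l * x + int j * x) (b + l * y + int j * y) \<tau>
        = ee (of_int (\<rho> * l) / of_nat n) * G (int j + l)"
      by (simp add: G_def algebra_simps)
  qed
  also have "\<dots> = ee (of_int (\<rho> * l) / of_nat n) * (\<Sum>j<n. G (int j))"
    unfolding sum_distrib_left[symmetric] sum_periodic_shift[of G, OF per] ..
  finally show ?thesis by (simp add: H_def G_def)
qed

lemma norm_H_eq:
  assumes tau: "Im \<tau> > 0" and d: "[a * y - b * x = 1] (mod int n)" "[a' * y - b' * x = 1] (mod int n)"
  shows "norm (H \<rho> a b x y \<tau>) = norm (H \<rho> a' b' x y \<tau>)"
proof -
  \<comment> \<open>The difference of the two completions has determinant 0 with (x, y), so it is l
    * (x, y) modulo n; its determinant with (a, b) yields l.\<close>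
  define l where "l = a * (b' - b) - b * (a' - a)"
  have D: "[(a * y - b * x) * z = 1 * z] (mod int n)" for z using d(1) by (rule cong_scalar_right)
  have 0: "[(a' * y - b' * x) - (a * y - b * x) = 1 - 1] (mod int n)"
    using d by (intro cong_diff)
  have 1: "[a' = a + l * x] (mod int n)"
  proof -
    have "[a * ((a' * y - b' * x) - (a * y - b * x)) = a * (1 - 1)] (mod int n)"
      using 0 by (rule cong_scalar_left)
    from cong_diff[OF D[of "a' - a"] this] have "[l * x = a' - a] (mod int n)"
      by (simp add: l_def algebra_simps)
    then have "[a + l * x = a + (a' - a)] (mod int n)" by (intro cong_add cong_refl)
    then show ?thesis by (simp add: cong_sym)
  qed
  have 2: "[b' = b + l * y] (mod int n)"
  proof -
    have "[b * ((a' * y - b' * x) - (a * y - b * x)) = b * (1 - 1)] (mod int n)"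
      using 0 by (rule cong_scalar_left)
    from cong_diff[OF D[of "b' - b"] this] have "[l * y = b' - b] (mod int n)"
      by (simp add: l_def algebra_simps)
    then have "[b + l * y = b + (b' - b)] (mod int n)" by (intro cong_add cong_refl)
    then show ?thesis by (simp add: cong_sym)
  qed
  have "H \<rho> a' b' x y \<tau> = ee (of_real (of_int (\<rho> * l) / real n)) * H \<rho> a b x y \<tau>"
    unfolding H_cong[OF tau 1 2 cong_refl cong_refl] H_shift[OF tau] by simp
  then show ?thesis by (simp only: norm_mult norm_ee_real mult_1)
qed

lemma unimod_complement:
  assumes "unimod x y"
  shows "\<exists>a b. [a * y - b * x = 1] (mod int n)"
proof -
  obtain u v where uv: "u * gcd x y + v * int n = 1"
    using bezout_int[of "gcd x y" "int n"] assms unfolding unimod_def by metis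
  obtain p q where pq: "p * x + q * y = gcd x y" using bezout_int by blast
  have "(u * q) * y - (- (u * p)) * x = u * gcd x y" unfolding pq[symmetric] by (simp add: algebra_simps)
  also have "\<dots> = 1 + int n * (- v)" using uv by (simp add: algebra_simps)
  finally have "[(u * q) * y - (- (u * p)) * x = 1] (mod int n)" by (simp add: cong_iff_dvd_diff)
  then show ?thesis by blast
qed

text \<open>The completion is chosen arbitrarily. Only the absolute value of the result is
  canonical, which is why the lemmas below compare norms.\<close>

definition K :: "int \<Rightarrow> int \<Rightarrow> int \<Rightarrow> complex \<Rightarrow> complex" where
  "K \<rho> x y = (let p = (SOME p. [fst p * y - snd p * x = 1] (mod int n)) in H \<rho> (fst p) (snd p) x y)"

lemma norm_K_eq:
  assumes "Im \<tau> > 0" "[a * y - b * x = 1] (mod int n)"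
  shows "norm (K \<rho> x y \<tau>) = norm (H \<rho> a b x y \<tau>)"
proof -
  define p where "p = (SOME p. [fst p * y - snd p * x = 1] (mod int n))"
  have "[fst p * y - snd p * x = 1] (mod int n)"
    unfolding p_def by (rule someI[of _ "(a, b)"]) (use assms(2) in simp)
  then show ?thesis unfolding K_def p_def[symmetric] Let_def by (rule norm_H_eq[OF assms(1) _ assms(2)])
qed

lemma K_holomorphic: "K \<rho> x y holomorphic_on {\<tau>. Im \<tau> > 0}"
  unfolding K_def Let_def by (rule H_holomorphic)

lemma norm_K_translate:
  assumes "Im \<tau> > 0" "unimod x y"
  shows "norm (K \<rho> x y (\<tau> + 1)) = norm (K \<rho> x (x + y) \<tau>)"
proof -
  obtain a b where ab: "[a * y - b * x = 1] (mod int n)" using unimod_complement[OF assms(2)] by blast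
  then have ab': "[a * (x + y) - (a + b) * x = 1] (mod int n)" by (simp add: algebra_simps)
  have "norm (ee (of_nat wt / 12)) = 1" using norm_ee_real[of "real wt / 12"] by simp
  then show ?thesis using norm_K_eq[of "\<tau> + 1", OF _ ab] norm_K_eq[OF assms(1) ab'] assms(1)
    by (simp add: H_translate norm_mult)
qed

lemma norm_K_inversion:
  assumes "Im \<tau> > 0" "unimod x y"
  shows "norm (K \<rho> x y (- 1 / \<tau>)) = norm (K \<rho> y (- x) \<tau>)"
proof -
  obtain a b where ab: "[a * y - b * x = 1] (mod int n)" using unimod_complement[OF assms(2)] by blast
  then have ab': "[b * (- x) - (- a) * y = 1] (mod int n)" by (simp add: algebra_simps)
  show ?thesis
    unfolding norm_K_eq[OF Im_neg_inverse[OF assms(1)] ab] norm_K_eq[OF assms(1) ab']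
    by (rule norm_H_inversion[OF assms(1)])
qed

lemma unimod_cong:
  assumes "[x = x'] (mod int n)" "[y = y'] (mod int n)"
  shows "unimod x y \<longleftrightarrow> unimod x' y'"
proof -
  have "gcd (gcd x y) (int n) = gcd (gcd x (int n)) (gcd y (int n))" for x y
    by (metis gcd.assoc gcd.commute gcd.left_idem)
  then show ?thesis unfolding unimod_def using cong_gcd_eq[OF assms(1)] cong_gcd_eq[OF assms(2)]
    by (metis gcd.commute)
qed

lemma norm_K_cong:
  assumes "Im \<tau> > 0" "unimod x y" "[x = x'] (mod int n)" "[y = y'] (mod int n)"
  shows "norm (K \<rho> x y \<tau>) = norm (K \<rho> x' y' \<tau>)"
proof -
  obtain a b where ab: "[a * y - b * x = 1] (mod int n)" using unimod_complement[OF assms(2)] by blast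
  have "[a * y - b * x = a * y' - b * x'] (mod int n)"
    by (intro cong_diff cong_mult cong_refl assms)
  then have ab': "[a * y' - b * x' = 1] (mod int n)" using ab by (meson cong_sym cong_trans)
  show ?thesis
    unfolding norm_K_eq[OF assms(1) ab] norm_K_eq[OF assms(1) ab']
    using H_cong[OF assms(1) cong_refl cong_refl assms(3,4)] by simp
qed

lemma unimod_translate: "unimod x (x + y) \<longleftrightarrow> unimod x y"
  unfolding unimod_def by (metis add.commute gcd_add2)

lemma unimod_inversion: "unimod y (- x) \<longleftrightarrow> unimod x y"
  by (simp add: unimod_def gcd.commute)

section \<open>Products over all primitive vectors modulo n\<close>

definition vecs :: "(int \<times> int) set" where
  "vecs = {(x, y). 0 \<le> x \<and> x < int n \<and> 0 \<le> y \<and> y < int n \<and> unimod x y}"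

lemma finite_vecs: "finite vecs"
  by (rule finite_subset[of _ "{0..<int n} \<times> {0..<int n}"]) (auto simp: vecs_def)

text \<open>A map of primitive vectors that is injective modulo n permutes the finite set of
  representatives. Translation and inversion are the two instances.\<close>

lemma prod_vecs_reindex:
  fixes g :: "int \<Rightarrow> int \<Rightarrow> real"
  assumes g: "\<And>x y x' y'. unimod x y \<Longrightarrow> [x = x'] (mod int n) \<Longrightarrow> [y = y'] (mod int n) \<Longrightarrow> g x y = g x' y'"
    and A: "\<And>x y. unimod x y \<Longrightarrow> unimod (f1 x y) (f2 x y)"
    and inj: "\<And>x y x' y'. [f1 x y = f1 x' y'] (mod int n) \<Longrightarrow> [f2 x y = f2 x' y'] (mod int n) \<Longrightarrow>
        [x = x'] (mod int n) \<and> [y = y'] (mod int n)"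
  shows "(\<Prod>(x, y)\<in>vecs. g (f1 x y) (f2 x y)) = (\<Prod>(x, y)\<in>vecs. g x y)"
proof -
  define h where "h = (\<lambda>(x, y). (f1 x y mod int n, f2 x y mod int n))"
  have n0: "int n > 0" using n_gt_1 by simp
  have into: "h ` vecs \<subseteq> vecs"
  proof (rule image_subsetI)
    fix p assume "p \<in> vecs"
    then obtain x y where p: "p = (x, y)" and xy: "(x, y) \<in> vecs" by (cases p) auto
    have "unimod (f1 x y mod int n) (f2 x y mod int n) \<longleftrightarrow> unimod (f1 x y) (f2 x y)"
      by (rule unimod_cong) (simp_all add: cong_def)
    then show "h p \<in> vecs" unfolding p using xy n0 A by (simp add: h_def vecs_def)
  qed
  have "inj_on h vecs"
  proof (rule inj_onI, clarify)
    fix x y x' y' assume v: "(x, y) \<in> vecs" "(x', y') \<in> vecs" and eq: "h (x, y) = h (x', y')"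
    have "[x = x'] (mod int n) \<and> [y = y'] (mod int n)"
      by (rule inj) (use eq in \<open>simp_all add: h_def cong_def\<close>)
    then show "x = x' \<and> y = y'" using v by (auto simp: vecs_def cong_def)
  qed
  then have bij: "bij_betw h vecs vecs"
    using endo_inj_surj[OF finite_vecs into] by (simp add: bij_betw_def)
  have "(\<Prod>(x, y)\<in>vecs. g x y) = (\<Prod>p\<in>vecs. (case h p of (x, y) \<Rightarrow> g x y))"
    using prod.reindex_bij_betw[OF bij, of "\<lambda>(x, y). g x y"] by simp
  also have "\<dots> = (\<Prod>(x, y)\<in>vecs. g (f1 x y) (f2 x y))"
  proof (intro prod.cong refl, clarify)
    fix x y assume "(x, y) \<in> vecs"
    then have "unimod (f1 x y) (f2 x y)" using A by (simp add: vecs_def)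
    then have "g (f1 x y) (f2 x y) = g (f1 x y mod int n) (f2 x y mod int n)"
      by (rule g) (simp_all add: cong_def)
    then show "(case h (x, y) of (x, y) \<Rightarrow> g x y) = g (f1 x y) (f2 x y)" by (simp add: h_def)
  qed
  finally show ?thesis ..
qed

definition orbit_prod :: "int \<Rightarrow> complex \<Rightarrow> complex" where
  "orbit_prod \<rho> \<tau> = (\<Prod>(x, y)\<in>vecs. K \<rho> x y \<tau>)"

lemma norm_orbit_prod: "norm (orbit_prod \<rho> \<tau>) = (\<Prod>(x, y)\<in>vecs. norm (K \<rho> x y \<tau>))"
  by (simp add: orbit_prod_def prod_norm[symmetric] case_prod_unfold)

lemma norm_orbit_prod_translate:
  assumes "Im \<tau> > 0"
  shows "norm (orbit_prod \<rho> (\<tau> + 1)) = norm (orbit_prod \<rho> \<tau>)"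
proof -
  have "norm (orbit_prod \<rho> (\<tau> + 1)) = (\<Prod>(x, y)\<in>vecs. norm (K \<rho> x (x + y) \<tau>))"
    unfolding norm_orbit_prod
    by (intro prod.cong refl) (auto simp: vecs_def norm_K_translate[OF assms])
  also have "\<dots> = (\<Prod>(x, y)\<in>vecs. norm (K \<rho> x y \<tau>))"
  proof (rule prod_vecs_reindex)
    fix x y x' y' assume "[x = x'] (mod int n)" "[x + y = x' + y'] (mod int n)"
    then show "[x = x'] (mod int n) \<and> [y = y'] (mod int n)"
      using cong_diff[of "x + y" "x' + y'" "int n" x x'] by simp
  qed (auto simp: unimod_translate intro: norm_K_cong[OF assms])
  finally show ?thesis by (simp add: norm_orbit_prod)
qed

lemma norm_orbit_prod_inversion:
  assumes "Im \<tau> > 0"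
  shows "norm (orbit_prod \<rho> (- 1 / \<tau>)) = norm (orbit_prod \<rho> \<tau>)"
proof -
  have "norm (orbit_prod \<rho> (- 1 / \<tau>)) = (\<Prod>(x, y)\<in>vecs. norm (K \<rho> y (- x) \<tau>))"
    unfolding norm_orbit_prod
    by (intro prod.cong refl) (auto simp: vecs_def norm_K_inversion[OF assms, simplified])
  also have "\<dots> = (\<Prod>(x, y)\<in>vecs. norm (K \<rho> x y \<tau>))"
  proof (rule prod_vecs_reindex)
    fix x y x' y' assume "[y = y'] (mod int n)" "[- x = - x'] (mod int n)"
    then show "[x = x'] (mod int n) \<and> [y = y'] (mod int n)"
      by (simp add: cong_minus_minus_iff)
  qed (auto simp: unimod_inversion intro: norm_K_cong[OF assms])
  finally show ?thesis by (simp add: norm_orbit_prod)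
qed

text \<open>Identical vanishing passes along translations and inversion, under which all primitive
  vectors modulo n are equivalent.\<close>

lemma K_eq_0_transitive:
  assumes "unimod x y" "\<And>\<tau>. Im \<tau> > 0 \<Longrightarrow> K \<rho> x y \<tau> = 0" "Im \<tau> > 0"
  shows "K \<rho> 0 1 \<tau> = 0"
proof -
  define P where "P x y \<longleftrightarrow> unimod x y \<and> (\<forall>\<tau>. Im \<tau> > 0 \<longrightarrow> K \<rho> x y \<tau> = 0)" for x y
  have 1: "K \<rho> x y (\<tau> + 1) = 0 \<longleftrightarrow> K \<rho> x (x + y) \<tau> = 0" if "unimod x y" "Im \<tau> > 0" for x y \<tau>
    using norm_K_translate[OF that(2,1), of \<rho>] by (metis norm_eq_zero)
  have 2: "K \<rho> x y (- 1 / \<tau>) = 0 \<longleftrightarrow> K \<rho> y (- x) \<tau> = 0" if "unimod x y" "Im \<tau> > 0" for x y \<tau>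
    using norm_K_inversion[OF that(2,1), of \<rho>] by (metis norm_eq_zero)
  have 3: "K \<rho> x y \<tau> = 0 \<longleftrightarrow> K \<rho> (x + int n) y \<tau> = 0" if "unimod x y" "Im \<tau> > 0" for x y \<tau>
    using norm_K_cong[OF that(2,1), of "x + int n" y \<rho>] by (auto simp: cong_def)
  have "P x y \<longleftrightarrow> P 0 1"
  proof (rule unimodular_transitive[where n = "int n"])
    fix x y
    show "P x y \<longleftrightarrow> P x (x + y)"
    proof
      assume "P x y" then show "P x (x + y)" unfolding P_def unimod_translate
        using 1[of x y] by force
    next
      assume p: "P x (x + y)"
      then have u: "unimod x y" by (simp add: P_def unimod_translate)
      have "K \<rho> x y \<tau> = 0" if "Im \<tau> > 0" for \<tau>
        using 1[OF u, of "\<tau> - 1"] p that by (simp add: P_def)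
      then show "P x y" using u by (simp add: P_def)
    qed
    show "P x y \<longleftrightarrow> P y (- x)"
    proof
      assume "P x y" then show "P y (- x)" unfolding P_def unimod_inversion
        using 2[of x y] Im_neg_inverse by blast
    next
      assume p: "P y (- x)"
      then have u: "unimod x y" by (simp add: P_def unimod_inversion)
      have "K \<rho> x y \<tau> = 0" if "Im \<tau> > 0" for \<tau>
      proof -
        have "- 1 / (- 1 / \<tau>) = \<tau>" using that by simp
        then show ?thesis using 2[OF u Im_neg_inverse[OF that]] p Im_neg_inverse[OF that]
          by (simp add: P_def)
      qed
      then show "P x y" using u by (simp add: P_def)
    qed
    have "unimod x y \<longleftrightarrow> unimod (x + int n) y" by (rule unimod_cong) (simp_all add: cong_def)
    then show "P x y \<longleftrightarrow> P (x + int n) y" unfolding P_def using 3 by auto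
  qed (use assms(1) in \<open>simp add: unimod_def\<close>)
  then show ?thesis using assms by (simp add: P_def)
qed

end

section \<open>Multiplication by units and expansions at the vectors (0, d)\<close>

context siegel_product
begin

text \<open>The representative of j * d up to sign among 1..M, as in Gauss's lemma on quadratic
  residues.\<close>

definition fold_index :: "nat \<Rightarrow> nat \<Rightarrow> nat" where
  "fold_index d j = (if (j * d) mod n \<le> M then (j * d) mod n else n - (j * d) mod n)"

lemma fold_index_bij:
  assumes "coprime d n"
  shows "bij_betw (fold_index d) {1..M} {1..M}"
    and "j \<in> {1..M} \<Longrightarrow> gcd (fold_index d j) n = gcd j n"
    and "\<exists>s q. (s = 1 \<or> s = -1) \<and> int j * int d = int n * q + s * int (fold_index d j)"
proof -
  have lt: "(j * d) mod n < n" for j using n_gt_1 by simp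
  have ex: "\<exists>s q. (s = 1 \<or> s = -1) \<and> int j * int d = int n * q + s * int (fold_index d j)" for j
  proof -
    have jd: "int j * int d = int n * int (j * d div n) + int (j * d mod n)"
      by (metis mult_div_mod_eq of_nat_add of_nat_mult)
    show ?thesis
    proof (cases "(j * d) mod n \<le> M")
      case True
      then show ?thesis using jd
        by (intro exI[of _ 1] exI[of _ "int (j * d div n)"]) (simp add: fold_index_def)
    next
      case False
      then show ?thesis using jd lt[of j]
        by (intro exI[of _ "-1"] exI[of _ "int (j * d div n) + 1"])
           (simp add: fold_index_def of_nat_diff algebra_simps)
    qed
  qed
  then show "\<exists>s q. (s = 1 \<or> s = -1) \<and> int j * int d = int n * q + s * int (fold_index d j)" .
  have into: "fold_index d j \<in> {1..M}" if j: "j \<in> {1..M}" for j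
  proof -
    have "\<not> n dvd j * d"
    proof
      assume "n dvd j * d"
      then have "n dvd j" using assms by (simp add: coprime_dvd_mult_left_iff coprime_commute)
      then show False using j n_eq by (auto dest: dvd_imp_le)
    qed
    define m where "m = (j * d) mod n"
    have "m \<noteq> 0" "m < n" using \<open>\<not> n dvd j * d\<close> lt[of j] by (simp_all add: m_def dvd_eq_mod_eq_0)
    then show ?thesis using n_eq by (auto simp: fold_index_def m_def[symmetric])
  qed
  have "inj_on (fold_index d) {1..M}"
  proof (rule inj_onI)
    fix i j assume ij: "i \<in> {1..M}" "j \<in> {1..M}" and eq: "fold_index d i = fold_index d j"
    obtain s q where s: "s = 1 \<or> s = -1" "int i * int d = int n * q + s * int (fold_index d i)"
      using ex by blast
    obtain s' q' where s': "s' = 1 \<or> s' = -1" "int j * int d = int n * q' + s' * int (fold_index d j)"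
      using ex by blast
    have "\<exists>u. (u = 1 \<or> u = -1) \<and> int n dvd (int i - u * int j) * int d"
    proof (cases "s = s'")
      case True
      then have "(int i - 1 * int j) * int d = int n * (q - q')"
        using s(2) s'(2) eq by (simp add: algebra_simps)
      then show ?thesis by (metis dvd_triv_left)
    next
      case False
      then have "s' = - s" using s(1) s'(1) by auto
      then have "(int i - (-1) * int j) * int d = int n * (q + q')"
        using s(2) s'(2) eq by (simp add: algebra_simps)
      then show ?thesis by (metis dvd_triv_left)
    qed
    then obtain u where u: "u = 1 \<or> u = -1" "int n dvd (int i - u * int j) * int d" by blast
    then have "int n dvd int i - u * int j"
      using assms by (simp add: coprime_dvd_mult_left_iff coprime_commute)
    moreover have "\<bar>int i - u * int j\<bar> < int n" using u(1) ij n_eq by auto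
    ultimately have "int i - u * int j = 0" using zdvd_not_zless[of "\<bar>int i - u * int j\<bar>" "int n"] by force
    then show "i = j" using u(1) ij by auto
  qed
  then show "bij_betw (fold_index d) {1..M} {1..M}"
    using endo_inj_surj[of "{1..M}" "fold_index d"] image_subsetI[of "{1..M}" "fold_index d", OF into]
    by (simp add: bij_betw_def)
  show "gcd (fold_index d j) n = gcd j n" if "j \<in> {1..M}"
  proof -
    have "gcd (fold_index d j) n = gcd ((j * d) mod n) n"
      using lt[of j] by (simp add: fold_index_def gcd_reflect_left)
    also have "\<dots> = gcd (j * d) n" by (simp add: gcd.commute gcd_red_nat[symmetric])
    also have "\<dots> = gcd j n" using assms by (simp add: gcd_mult_right_right_cancel gcd_mult_left_right_cancel coprime_commute)
    finally show ?thesis .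
  qed
qed

text \<open>A unit permutes the half system 1..M up to signs. As \<open>siegel\<close> is odd and
  the exponents depend only on the gcd, the constant is a product of signs.\<close>

lemma Psi_dilate:
  assumes d: "coprime d n"
  shows "\<exists>c. norm c = 1 \<and> (\<forall>\<tau>. Im \<tau> > 0 \<longrightarrow> Psi (int d) 0 \<tau> = c * Psi 1 0 \<tau>)"
proof -
  have "\<exists>s q. (s = 1 \<or> s = -1) \<and> int j * int d = int n * q + s * int (fold_index d j)" for j
    by (rule fold_index_bij(3)[OF d])
  then obtain s q where s: "\<And>j. s j = 1 \<or> s j = (-1 :: int)"
      "\<And>j. int j * int d = int n * q j + s j * int (fold_index d j)" by metis
  have sg: "siegel (2 * real j * of_int (int d) / real n) 0 \<tau> =
      of_int (s j) * siegel (2 * real (fold_index d j) / real n) 0 \<tau>" if "Im \<tau> > 0" for j \<tau>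
  proof -
    define x where "x = 2 * real (fold_index d j) / real n"
    have "real_of_int (int j * int d) = real_of_int (int n * q j + s j * int (fold_index d j))"
      using s(2)[of j] by metis
    then have "2 * real j * of_int (int d) / real n = of_int (s j) * x + 2 * of_int (q j)"
      using n_gt_1 by (simp add: x_def field_simps)
    then have "siegel (2 * real j * of_int (int d) / real n) 0 \<tau> = siegel (of_int (s j) * x) 0 \<tau>"
      using siegel_add_even_left[OF that, of "of_int (s j) * x" "q j" 0] by simp
    also have "\<dots> = of_int (s j) * siegel x 0 \<tau>"
      using s(1)[of j] siegel_minus[OF that, of x 0] by auto
    finally show ?thesis by (simp add: x_def)
  qed
  define c where "c = (\<Prod>j=1..M. (of_int (s j) :: complex) ^ e (gcd j n))"
  have "norm (of_int (s j) :: complex) = 1" for j using s(1)[of j] by auto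
  then have "norm c = 1" by (simp add: c_def prod_norm[symmetric] norm_power)
  moreover have "Psi (int d) 0 \<tau> = c * Psi 1 0 \<tau>" if "Im \<tau> > 0" for \<tau>
  proof -
    have "Psi (int d) 0 \<tau> = (\<Prod>j=1..M. (of_int (s j) :: complex) ^ e (gcd j n) *
        siegel (2 * real (fold_index d j) / real n) 0 \<tau> ^ e (gcd (fold_index d j) n))"
      unfolding Psi_def using sg[OF that]
      by (intro prod.cong refl) (simp add: power_mult_distrib fold_index_bij(2)[OF d])
    also have "\<dots> = c * (\<Prod>j=1..M. siegel (2 * real (fold_index d j) / real n) 0 \<tau> ^ e (gcd (fold_index d j) n))"
      by (simp add: prod.distrib c_def)
    also have "(\<Prod>j=1..M. siegel (2 * real (fold_index d j) / real n) 0 \<tau> ^ e (gcd (fold_index d j) n))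
        = Psi 1 0 \<tau>"
      using prod.reindex_bij_betw[OF fold_index_bij(1)[OF d],
        of "\<lambda>j. siegel (2 * real j / real n) 0 \<tau> ^ e (gcd j n)"] by (simp add: Psi_def)
    finally show ?thesis .
  qed
  ultimately show ?thesis by blast
qed

text \<open>The leading exponent of \<open>Psi 1 0\<close> in powers of ee (\<tau> / n) once the
  factor ee (wt * \<tau> / 12), common to all vectors, is removed; the level condition makes it an
  integer.\<close>

definition shift :: int where
  "shift = int (2 * (\<Sum>j=1..M. e (gcd j n) * j\<^sup>2) div n) - int (\<Sum>j=1..M. e (gcd j n) * j)"

lemma lead_eq: "lead = of_int shift / real n + real wt / 12"
proof -
  have "n dvd 2 * (\<Sum>j=1..M. e (gcd j n) * j\<^sup>2)" using level by (simp add: M_def)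
  then have "real (2 * (\<Sum>j=1..M. e (gcd j n) * j\<^sup>2) div n) = real (2 * (\<Sum>j=1..M. e (gcd j n) * j\<^sup>2)) / real n"
    by (rule real_of_nat_div)
  then have sh: "real_of_int shift = 2 * (\<Sum>j=1..M. real (e (gcd j n)) * (real j)\<^sup>2) / real n
      - (\<Sum>j=1..M. real (e (gcd j n)) * real j)"
    by (simp add: shift_def)
  have "lead = (\<Sum>j=1..M. 2 * (real (e (gcd j n)) * (real j)\<^sup>2) / (real n)\<^sup>2
      - real (e (gcd j n)) * real j / real n + real (e (gcd j n)) / 12)"
    unfolding lead_def using n_gt_1 by (intro sum.cong refl) (simp add: field_simps power2_eq_square)
  also have "\<dots> = 2 * (\<Sum>j=1..M. real (e (gcd j n)) * (real j)\<^sup>2) / (real n)\<^sup>2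
      - (\<Sum>j=1..M. real (e (gcd j n)) * real j) / real n + real wt / 12"
    by (simp add: sum.distrib sum_subtractf wt_def sum_divide_distrib sum_distrib_left)
  also have "\<dots> = of_int shift / real n + real wt / 12"
    unfolding sh using n_gt_1 by (simp add: field_simps power2_eq_square)
  finally show ?thesis .
qed

text \<open>The vector (d, l * d) arises from (d, 0) by the translation \<tau> + l, and (d, 0) from
  (1, 0) by \<open>Psi_dilate\<close>.\<close>

lemma Psi_expand:
  assumes d: "coprime d n"
  shows "\<exists>C. norm C = 1 \<and> (\<forall>l \<tau>. Im \<tau> > 0 \<longrightarrow> Psi (int d) (int l * int d) \<tau> =
    C * ee (of_nat l * of_int shift / of_nat n) * ee (of_real lead * \<tau>) * Q (ee ((\<tau> + of_nat l) / of_nat n)))"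
proof -
  obtain c where c: "norm c = 1" "\<And>\<tau>. Im \<tau> > 0 \<Longrightarrow> Psi (int d) 0 \<tau> = c * Psi 1 0 \<tau>"
    using Psi_dilate[OF d] by blast
  have "Psi (int d) (int l * int d) \<tau> =
    c * ee (of_nat l * of_int shift / of_nat n) * ee (of_real lead * \<tau>) * Q (ee ((\<tau> + of_nat l) / of_nat n))"
    if tau: "Im \<tau> > 0" for l \<tau>
  proof -
    have t: "Im (\<tau> + of_nat l) > 0" using tau by simp
    have "ee (of_nat l * of_nat wt / 12) * Psi (int d) (int l * int d) \<tau> = Psi (int d) 0 (\<tau> + of_nat l)"
      by (simp add: Psi_translate_nat)
    also have "\<dots> = c * (ee (of_real lead * (\<tau> + of_nat l)) * Q (ee ((\<tau> + of_nat l) / of_nat n)))"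
      unfolding c(2)[OF t] Psi_1_0[OF t] ..
    also have "ee (of_real lead * (\<tau> + of_nat l)) =
        ee (of_nat l * of_nat wt / 12) * (ee (of_nat l * of_int shift / of_nat n) * ee (of_real lead * \<tau>))"
      unfolding ee_add[symmetric] lead_eq
      by (intro arg_cong[of _ _ ee]) (simp add: add_divide_distrib ring_distribs mult_ac)
    finally show ?thesis by (simp add: mult_ac)
  qed
  then show ?thesis using c(1) by blast
qed

definition a :: "nat \<Rightarrow> complex" where "a m = (deriv ^^ m) Q 0 / fact m"

lemma Q_holomorphic: "Q holomorphic_on ball 0 1"
  unfolding Q_def using n_gt_1
  by (intro holomorphic_intros) (auto intro!: norm_power_less_one)

lemma Q_sums:
  assumes "norm x < 1"
  shows "(\<lambda>m. a m * x ^ m) sums Q x"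
  using holomorphic_power_series[OF Q_holomorphic, of x] assms by (simp add: a_def)

text \<open>(d', 0) completes (0, d). Since j * d is congruent to j * d ^ 2 * d', the j-th term of
  the sum is the translate of \<open>Psi d' 0\<close> by j * d ^ 2, up to a constant. Orthogonality
  of characters then keeps the exponents m with (shift + m) * d ^ 2 congruent to \<rho>.\<close>

lemma H_expand:
  assumes d: "[d' * d = 1] (mod n)"
  shows "\<exists>C. norm C = 1 \<and> (\<forall>\<tau>. Im \<tau> > 0 \<longrightarrow>
    (\<lambda>m. (if int n dvd (shift + int m) * (int d)\<^sup>2 - \<rho> then of_nat n * a m else 0) * ee (\<tau> / of_nat n) ^ m) sums
      (H \<rho> (int d') 0 0 (int d) \<tau> / (C * ee (of_real lead * \<tau>))))"
proof -
  have cop: "coprime d' n" using d by (metis One_nat_def coprime_iff_invertible_nat)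
  obtain C where C: "norm C = 1" "\<And>l \<tau>. Im \<tau> > 0 \<Longrightarrow> Psi (int d') (int l * int d') \<tau> =
    C * ee (of_nat l * of_int shift / of_nat n) * ee (of_real lead * \<tau>) * Q (ee ((\<tau> + of_nat l) / of_nat n))"
    using Psi_expand[OF cop] by blast
  have n0: "n > 0" using n_gt_1 by simp
  have "(\<lambda>m. (if int n dvd (shift + int m) * (int d)\<^sup>2 - \<rho> then of_nat n * a m else 0) * ee (\<tau> / of_nat n) ^ m) sums
      (H \<rho> (int d') 0 0 (int d) \<tau> / (C * ee (of_real lead * \<tau>)))" if tau: "Im \<tau> > 0" for \<tau>
  proof -
    define X where "X = ee (\<tau> / of_nat n)"
    have X: "norm (ee ((\<tau> + of_nat l) / of_nat n)) < 1" for l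
      using tau n0 by (intro norm_ee_less_1) (simp add: Im_divide_of_nat)
    define w where "w j = ee (- of_int (\<rho> * int j) / of_nat n) * ee (of_nat (j * d\<^sup>2) * of_int shift / of_nat n)" for j
    have "H \<rho> (int d') 0 0 (int d) \<tau> =
        (\<Sum>j<n. C * ee (of_real lead * \<tau>) * (w j * Q (ee ((\<tau> + of_nat (j * d\<^sup>2)) / of_nat n))))"
      unfolding H_def
    proof (intro sum.cong refl)
      fix j
      have "[int j * int d * 1 = int j * int d * int (d' * d)] (mod int n)"
        using d by (intro cong_mult cong_refl) (metis cong_int_iff cong_sym of_nat_1)
      then have "Psi (int d' + int j * 0) (0 + int j * int d) \<tau> = Psi (int d') (int (j * d\<^sup>2) * int d') \<tau>"
        by (intro Psi_cong[OF tau]) (simp_all add: power2_eq_square mult_ac)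
      then show "ee (- of_int (\<rho> * int j) / of_nat n) * Psi (int d' + int j * 0) (0 + int j * int d) \<tau> =
          C * ee (of_real lead * \<tau>) * (w j * Q (ee ((\<tau> + of_nat (j * d\<^sup>2)) / of_nat n)))"
        unfolding C(2)[OF tau] w_def by (simp only: mult_ac)
    qed
    then have H: "H \<rho> (int d') 0 0 (int d) \<tau> / (C * ee (of_real lead * \<tau>)) =
        (\<Sum>j<n. w j * Q (ee ((\<tau> + of_nat (j * d\<^sup>2)) / of_nat n)))"
      using C(1) unfolding sum_distrib_left[symmetric] by auto
    have "(\<lambda>m. \<Sum>j<n. w j * (a m * ee ((\<tau> + of_nat (j * d\<^sup>2)) / of_nat n) ^ m)) sums
        (\<Sum>j<n. w j * Q (ee ((\<tau> + of_nat (j * d\<^sup>2)) / of_nat n)))"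
      by (intro sums_sum sums_mult Q_sums X)
    moreover have "(\<Sum>j<n. w j * (a m * ee ((\<tau> + of_nat (j * d\<^sup>2)) / of_nat n) ^ m)) =
        (if int n dvd (shift + int m) * (int d)\<^sup>2 - \<rho> then of_nat n * a m else 0) * X ^ m" for m
    proof -
      have "w j * (a m * ee ((\<tau> + of_nat (j * d\<^sup>2)) / of_nat n) ^ m) =
          a m * X ^ m * ee (of_nat j * of_int ((shift + int m) * (int d)\<^sup>2 - \<rho>) / of_nat n)" for j
      proof -
        have "w j * ee ((\<tau> + of_nat (j * d\<^sup>2)) / of_nat n) ^ m =
            X ^ m * ee (of_nat j * of_int ((shift + int m) * (int d)\<^sup>2 - \<rho>) / of_nat n)"
          unfolding w_def X_def ee_power ee_add[symmetric] using n0
          by (intro arg_cong[of _ _ ee]) (simp add: field_simps)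
        then show ?thesis by (simp add: mult_ac)
      qed
      then have "(\<Sum>j<n. w j * (a m * ee ((\<tau> + of_nat (j * d\<^sup>2)) / of_nat n) ^ m)) =
          a m * X ^ m * (\<Sum>j<n. ee (of_nat j * of_int ((shift + int m) * (int d)\<^sup>2 - \<rho>) / of_nat n))"
        by (simp only: sum_distrib_left)
      then show ?thesis unfolding sum_roots_of_unity[OF n0] by simp
    qed
    ultimately show ?thesis unfolding H X_def by simp
  qed
  then show ?thesis using C(1) by blast
qed

lemma powser_tail_bound:
  fixes c :: "nat \<Rightarrow> complex"
  assumes "summable (\<lambda>m. norm (c m) * r ^ m)" "r > 0" "\<And>m. m < B \<Longrightarrow> c m = 0" "norm x \<le> r"
    and "(\<lambda>m. c m * x ^ m) sums s"
  shows "norm s \<le> suminf (\<lambda>m. norm (c m) * r ^ m) / r ^ B * norm x ^ B"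
proof -
  have le: "norm (c m * x ^ m) \<le> norm (c m) * r ^ m * (norm x ^ B / r ^ B)" for m
  proof (cases "m < B")
    case False
    then have B: "m = B + (m - B)" by simp
    have "norm (c m * x ^ m) = norm (c m) * (norm x ^ B * norm x ^ (m - B))"
      by (subst (2) B) (simp add: norm_mult norm_power power_add)
    also have "\<dots> \<le> norm (c m) * (norm x ^ B * r ^ (m - B))"
      using assms by (intro mult_left_mono power_mono) auto
    also have "\<dots> = norm (c m) * r ^ m * (norm x ^ B / r ^ B)"
      using assms(2) by (subst (2) B) (simp add: power_add)
    finally show ?thesis .
  qed (use assms in simp)
  have sm: "summable (\<lambda>m. norm (c m) * r ^ m * (norm x ^ B / r ^ B))"
    by (rule summable_mult2[OF assms(1)])
  have "norm s = norm (suminf (\<lambda>m. c m * x ^ m))" using assms(5) by (simp add: sums_iff)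
  also have "\<dots> \<le> suminf (\<lambda>m. norm (c m) * r ^ m * (norm x ^ B / r ^ B))"
    by (rule norm_suminf_le[OF le sm])
  also have "\<dots> = suminf (\<lambda>m. norm (c m) * r ^ m) * (norm x ^ B / r ^ B)"
    by (rule suminf_mult2[symmetric, OF assms(1)])
  finally show ?thesis by simp
qed

lemma norm_K_bound_good:
  assumes "coprime d n"
    and van: "\<And>m. m < B \<Longrightarrow> int n dvd (shift + int m) * (int d)\<^sup>2 - \<rho> \<Longrightarrow> a m = 0"
  shows "\<exists>C>0. \<forall>\<tau>. Im \<tau> \<ge> 1 / 2 \<longrightarrow>
    norm (K \<rho> 0 (int d) \<tau>) \<le> C * exp (- (2 * pi * (lead + real B / real n)) * Im \<tau>)"
proof -
  have n0: "n > 0" using n_gt_1 by simp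
  obtain d' where "[d * d' = 1] (mod n)" using cong_solve_coprime_nat[OF assms(1)] by auto
  then have d': "[d' * d = 1] (mod n)" by (simp add: mult.commute)
  define c where "c m = (if int n dvd (shift + int m) * (int d)\<^sup>2 - \<rho> then of_nat n * a m else 0)" for m
  obtain C where C: "norm C = 1" "\<And>\<tau>. Im \<tau> > 0 \<Longrightarrow> (\<lambda>m. c m * ee (\<tau> / of_nat n) ^ m) sums
      (H \<rho> (int d') 0 0 (int d) \<tau> / (C * ee (of_real lead * \<tau>)))"
    using H_expand[OF d', of \<rho>] unfolding c_def by blast
  \<comment> \<open>The modulus of ee (\<tau> / n) at Im \<tau> = 1 / 2, the largest one in the
    region considered.\<close>
  define r where "r = exp (- pi / real n)"
  have r: "0 < r" "r < 1" using n0 by (simp_all add: r_def)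
  have "summable (\<lambda>m. norm (a m * of_real r ^ m))"
  proof (rule powser_insidea)
    have "norm (complex_of_real ((1 + r) / 2)) < 1" unfolding norm_of_real using r by simp
    from sums_summable[OF Q_sums[OF this]]
    show "summable (\<lambda>m. a m * of_real ((1 + r) / 2) ^ m)" .
    show "norm (complex_of_real r) < norm (complex_of_real ((1 + r) / 2))"
      unfolding norm_of_real using r by simp
  qed
  then have "summable (\<lambda>m. norm (a m) * r ^ m)" using r by (simp add: norm_mult norm_power)
  then have "summable (\<lambda>m. real n * (norm (a m) * r ^ m))" by (rule summable_mult)
  then have sm: "summable (\<lambda>m. norm (c m) * r ^ m)"
    by (rule summable_comparison_test'[of _ 0]) (use r in \<open>auto simp: c_def norm_mult\<close>)
  define D where "D = suminf (\<lambda>m. norm (c m) * r ^ m) / r ^ B"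
  have D: "D \<ge> 0" unfolding D_def using r by (intro divide_nonneg_nonneg suminf_nonneg sm) auto
  \<comment> \<open>\<open>D\<close> can be zero, while a positive constant is claimed; hence D +
    1.\<close>
  have "norm (K \<rho> 0 (int d) \<tau>) \<le> (D + 1) * exp (- (2 * pi * (lead + real B / real n)) * Im \<tau>)"
    if tau: "Im \<tau> \<ge> 1 / 2" for \<tau>
  proof -
    have t0: "Im \<tau> > 0" using tau by simp
    define X where "X = ee (\<tau> / of_nat n)"
    have nX: "norm X = exp (- 2 * pi * Im \<tau> / real n)" by (simp add: X_def norm_ee Im_divide_of_nat)
    have "norm X \<le> r" unfolding nX r_def using tau n0 by (simp add: divide_right_mono)
    then have b: "norm (H \<rho> (int d') 0 0 (int d) \<tau> / (C * ee (of_real lead * \<tau>))) \<le> D * norm X ^ B"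
      unfolding D_def by (intro powser_tail_bound[OF sm r(1) _ _ C(2)[OF t0, folded X_def]])
        (use van in \<open>auto simp: c_def\<close>)
    have cd: "[int d' * int d - 0 * 0 = 1] (mod int n)"
      using d' by (metis cong_int_iff diff_zero mult_zero_left of_nat_1 of_nat_mult)
    have nl: "norm (ee (of_real lead * \<tau>)) = exp (- 2 * pi * lead * Im \<tau>)" by (simp add: norm_ee)
    have "norm (K \<rho> 0 (int d) \<tau>) = norm (H \<rho> (int d') 0 0 (int d) \<tau>)"
      by (rule norm_K_eq[OF t0 cd])
    also have "\<dots> = norm (H \<rho> (int d') 0 0 (int d) \<tau> / (C * ee (of_real lead * \<tau>))) * exp (- 2 * pi * lead * Im \<tau>)"
      unfolding norm_divide norm_mult C(1) nl by simp
    also have "\<dots> \<le> D * norm X ^ B * exp (- 2 * pi * lead * Im \<tau>)"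
      by (intro mult_right_mono b) simp
    also have "\<dots> = D * exp (- (2 * pi * (lead + real B / real n)) * Im \<tau>)"
      unfolding nX exp_of_nat_mult[symmetric] mult.assoc exp_add[symmetric] by (simp add: field_simps)
    also have "\<dots> \<le> (D + 1) * exp (- (2 * pi * (lead + real B / real n)) * Im \<tau>)"
      by (intro mult_right_mono) auto
    finally show ?thesis .
  qed
  then show ?thesis using D by (intro exI[of _ "D + 1"]) auto
qed

end

section \<open>Vanishing of all coefficients in a class\<close>

text \<open>The point x = 0 is left out because \<open>ee\<close> has no zeros. The limit at 0 gives
  the first coefficient, and dividing by powers of x gives the others.\<close>

lemma powser_eq_0:
  fixes c :: "nat \<Rightarrow> complex"
  assumes "\<And>x. x \<noteq> 0 \<Longrightarrow> norm x < 1 \<Longrightarrow> (\<lambda>m. c m * x ^ m) sums 0"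
  shows "c m = 0"
proof (induction m rule: less_induct)
  case (less m)
  have "(\<lambda>i. c (i + m) * x ^ i) sums 0" if x: "x \<noteq> 0" "norm x < 1" for x
  proof -
    have "(\<lambda>i. c (i + m) * x ^ (i + m)) sums 0"
      using assms[OF x] sums_iff_shift'[of "\<lambda>m. c m * x ^ m" m 0] less by simp
    from sums_mult[OF this, of "inverse (x ^ m)"] show ?thesis using x by (simp add: power_add field_simps)
  qed
  from powser_limit_0_strong[OF zero_less_one this]
  have "((\<lambda>_. 0) \<longlongrightarrow> c (0 + m)) (at (0 :: complex))" by simp
  then show ?case by (metis LIM_const_eq add_0)
qed

context siegel_product
begin

text \<open>The product of \<open>K \<rho> x y\<close> over all \<open>(x, y)\<close> has modular absolute value. At each \<open>(0, d)\<close> it decays like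
  \<open>exp (- 2 * pi * (lead + B / n) * Im \<tau>)\<close> by the vanishing of the first \<open>B\<close> coefficients, elsewhere it grows
  at most like \<open>exp (pi * \<kappa> / 6 * Im \<tau>)\<close>; the inequality says that decay wins.\<close>

theorem coeffs_vanish:
  fixes B :: nat and \<kappa> :: int
  defines "G \<equiv> card {d \<in> {1..<n}. coprime d n}"
  assumes ord: "\<And>x. (\<Sum>j=1..M. int (e (gcd j n)) *
      (6 * ((2 * int j * x) mod int n)\<^sup>2 - 6 * ((2 * int j * x) mod int n) * int n + (int n)\<^sup>2)) \<ge> - \<kappa> * (int n)\<^sup>2"
    and van: "\<And>m d. m < B \<Longrightarrow> coprime d n \<Longrightarrow> int n dvd (shift + int m) * (int d)\<^sup>2 - \<rho> \<Longrightarrow> a m = 0"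
    and card_bound: "of_int \<kappa> * (real (card vecs) - real G) < 12 * real G * (lead + real B / real n)"
    and m: "int n dvd shift + int m - \<rho>"
  shows "a m = 0"
proof -
  have n0: "n > 0" using n_gt_1 by simp
  define D where "D = pi * of_int \<kappa> / 6"
  define A where "A = 2 * pi * (lead + real B / real n)"
  obtain C where C: "C > 0" "\<And>x y \<tau>. Im \<tau> \<ge> 1 / 2 \<Longrightarrow> norm (Psi x y \<tau>) \<le> C * exp (D * Im \<tau>)"
    using norm_Psi_bound[OF ord] by (auto simp: D_def mult_ac)
  have Kb: "norm (K \<rho> x y \<tau>) \<le> real n * C * exp (D * Im \<tau>)" if u: "unimod x y" and tau: "Im \<tau> \<ge> 1 / 2" for x y \<tau>
  proof -
    obtain p q where pq: "[p * y - q * x = 1] (mod int n)" using unimod_complement[OF u] by blast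
    have "norm (K \<rho> x y \<tau>) = norm (H \<rho> p q x y \<tau>)" using norm_K_eq[OF _ pq] tau by simp
    also have "\<dots> \<le> (\<Sum>j<n. C * exp (D * Im \<tau>))"
      unfolding H_def
    proof (rule sum_norm_le)
      fix j
      have "norm (ee (- of_int (\<rho> * int j) / of_nat n)) = 1"
        using norm_ee_real[of "- of_int (\<rho> * int j) / real n"] by simp
      then show "norm (ee (- of_int (\<rho> * int j) / of_nat n) * Psi (p + int j * x) (q + int j * y) \<tau>) \<le> C * exp (D * Im \<tau>)"
        using C(2)[OF tau] by (simp add: norm_mult)
    qed
    finally show ?thesis by simp
  qed
  \<comment> \<open>The vectors at which the expansion is known, one for each unit modulo n.\<close>
  define good where "good = (\<lambda>d. (0 :: int, int d)) ` {d \<in> {1..<n}. coprime d n}"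
  have card_good: "card good = G"
    unfolding good_def G_def by (rule card_image) (auto simp: inj_on_def)
  have sub: "good \<subseteq> vecs"
    by (auto simp: good_def vecs_def unimod_def coprime_iff_gcd_eq_1 gcd_int_int_eq)
  have fg: "finite good" by (simp add: good_def)
  have "\<forall>p\<in>vecs. \<exists>c>0. \<forall>\<tau>. Im \<tau> \<ge> 1 / 2 \<longrightarrow>
      norm (K \<rho> (fst p) (snd p) \<tau>) \<le> c * exp ((if p \<in> good then - A else D) * Im \<tau>)"
  proof
    fix p assume p: "p \<in> vecs"
    show "\<exists>c>0. \<forall>\<tau>. Im \<tau> \<ge> 1 / 2 \<longrightarrow>
      norm (K \<rho> (fst p) (snd p) \<tau>) \<le> c * exp ((if p \<in> good then - A else D) * Im \<tau>)"
    proof (cases "p \<in> good")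
      case True
      then obtain d where d: "p = (0, int d)" "coprime d n" by (auto simp: good_def)
      show ?thesis using norm_K_bound_good[OF d(2), of B \<rho>] van[OF _ d(2)] True
        by (simp add: d(1) A_def)
    next
      case False
      have "unimod (fst p) (snd p)" using p by (auto simp: vecs_def)
      then show ?thesis using Kb False C(1) n0 by (intro exI[of _ "real n * C"]) auto
    qed
  qed
  then obtain c where c: "\<And>p. p \<in> vecs \<Longrightarrow> c p > 0"
    "\<And>p \<tau>. p \<in> vecs \<Longrightarrow> Im \<tau> \<ge> 1 / 2 \<Longrightarrow>
      norm (K \<rho> (fst p) (snd p) \<tau>) \<le> c p * exp ((if p \<in> good then - A else D) * Im \<tau>)"
    by metis
  \<comment> \<open>The total rate of decay: A from each of the G good vectors, less the growth D
    allowed at each of the others. \<open>card_bound\<close> states that it is positive, up to the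
    factor pi / 6.\<close>
  define E where "E = real G * A - (real (card vecs) - real G) * D"
  have E: "E > 0"
  proof -
    have "pi / 6 * (of_int \<kappa> * (real (card vecs) - real G)) < pi / 6 * (12 * real G * (lead + real B / real n))"
      by (intro mult_strict_left_mono card_bound) simp
    then show ?thesis by (simp add: E_def A_def D_def algebra_simps)
  qed
  have decay: "norm (orbit_prod \<rho> \<tau>) \<le> (\<Prod>p\<in>vecs. c p) * exp (- E * Im \<tau>)" if tau: "Im \<tau> \<ge> 1 / 2" for \<tau>
  proof -
    have "norm (orbit_prod \<rho> \<tau>) = (\<Prod>p\<in>vecs. norm (K \<rho> (fst p) (snd p) \<tau>))"
      by (simp add: norm_orbit_prod case_prod_unfold)
    also have "\<dots> \<le> (\<Prod>p\<in>vecs. c p * exp ((if p \<in> good then - A else D) * Im \<tau>))"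
      by (intro prod_mono) (use c tau in auto)
    also have "\<dots> = (\<Prod>p\<in>vecs. c p) * exp ((\<Sum>p\<in>vecs. (if p \<in> good then - A else D)) * Im \<tau>)"
      unfolding prod.distrib sum_distrib_right exp_sum[OF finite_vecs] ..
    also have "(\<Sum>p\<in>vecs. (if p \<in> good then - A else D)) = (\<Sum>p\<in>good. - A) + (\<Sum>p\<in>vecs - good. D)"
      using sub fg finite_vecs
      by (subst sum.If_cases) (auto simp: Int_absorb1 Diff_eq[symmetric])
    also have "\<dots> = - E"
      using card_Diff_subset[OF fg sub] card_mono[OF finite_vecs sub]
      by (simp add: card_good E_def of_nat_diff algebra_simps)
    finally show ?thesis .
  qed
  have hol: "orbit_prod \<rho> holomorphic_on {\<tau>. Im \<tau> > 0}"
    unfolding orbit_prod_def case_prod_unfold by (intro holomorphic_intros K_holomorphic)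
  have zero: "orbit_prod \<rho> \<tau> = 0" if "Im \<tau> > 0" for \<tau>
    by (rule invariant_decay_imp_zero[OF hol norm_orbit_prod_translate norm_orbit_prod_inversion decay E that])
  have "\<exists>p\<in>vecs. \<forall>\<tau>\<in>{\<tau>. Im \<tau> > 0}. K \<rho> (fst p) (snd p) \<tau> = 0"
  proof (rule holomorphic_prod_eq_0[OF finite_vecs])
    show "{\<tau>. Im \<tau> > 0} \<noteq> {}" by (auto intro: exI[of _ \<i>])
  qed (use zero in \<open>auto simp: open_halfspace_Im_gt convex_halfspace_Im_gt convex_connected
        orbit_prod_def case_prod_unfold intro: K_holomorphic\<close>)
  then obtain p where p: "p \<in> vecs" "\<And>\<tau>. Im \<tau> > 0 \<Longrightarrow> K \<rho> (fst p) (snd p) \<tau> = 0" by blast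
  have u: "unimod (fst p) (snd p)" using p(1) by (auto simp: vecs_def)
  have K0: "K \<rho> 0 1 \<tau> = 0" if "Im \<tau> > 0" for \<tau>
    by (rule K_eq_0_transitive[OF u p(2) that])
  have H0: "H \<rho> 1 0 0 1 \<tau> = 0" if "Im \<tau> > 0" for \<tau>
    using norm_K_eq[OF that, of 1 1 0 0 \<rho>] K0[OF that] by simp
  define b where "b m = (if int n dvd (shift + int m) * (int 1)\<^sup>2 - \<rho> then of_nat n * a m else 0)" for m
  have "[1 * 1 = (1 :: nat)] (mod n)" by simp
  from H_expand[OF this, of \<rho>] have sums0: "(\<lambda>m. b m * ee (\<tau> / of_nat n) ^ m) sums 0" if "Im \<tau> > 0" for \<tau>
    using that H0[OF that] unfolding b_def by auto
  have "b m = 0" for m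
  proof (rule powser_eq_0)
    fix x :: complex assume x: "x \<noteq> 0" "norm x < 1"
    \<comment> \<open>Every point of the punctured unit disc is ee (\<tau> / n) for some \<tau> in
      the upper half-plane.\<close>
    define \<tau> where "\<tau> = of_nat n * (Ln x / (2 * of_real pi * \<i>))"
    have "ee (\<tau> / of_nat n) = x" using x n0 by (simp add: \<tau>_def ee_def)
    moreover have "Im \<tau> > 0"
    proof -
      have "\<tau> = of_real (- real n / (2 * pi)) * (\<i> * Ln x)"
        by (simp add: \<tau>_def field_simps)
      then have "Im \<tau> = - real n / (2 * pi) * Re (Ln x)" by simp
      also have "\<dots> > 0" using x n0 mult_pos_neg[of "real n" "ln (norm x)"] by (simp add: zero_less_mult_iff field_simps)
      finally show ?thesis .
    qed
    ultimately show "(\<lambda>m. b m * x ^ m) sums 0" using sums0[of \<tau>] by simp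
  qed
  from this[of m] show ?thesis using m n0 by (simp add: b_def)
qed

end

section \<open>Euler's product as a formal and as a convergent series\<close>

definition fps_euler :: "nat \<Rightarrow> 'a :: idom fps" where
  "fps_euler d = q_product (\<lambda>i. 1 - fps_X ^ (d * i))"

text \<open>The partial products converge uniformly on a disc as functions and coefficientwise as
  formal series, so the Taylor series of the limit is the formal product.\<close>

lemma has_fps_expansion_euler:
  assumes "d > 0"
  shows "(\<lambda>x. qpoch (x ^ d) (x ^ d)) has_fps_expansion fps_euler d"
proof -
  define f :: "nat \<Rightarrow> complex fps" where "f N = (\<Prod>m<N. 1 - fps_X ^ (d * Suc m))" for N
  define f' :: "nat \<Rightarrow> complex \<Rightarrow> complex" where "f' N x = (\<Prod>m<N. 1 - x ^ d * (x ^ d) ^ m)" for N x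
  have one: "one_mod_q i (1 - fps_X ^ (d * i) :: complex fps)" for i
    using assms by (intro one_mod_q_linear') simp
  have "fps_expansion (\<lambda>x. qpoch (x ^ d) (x ^ d)) 0 = fps_euler d"
  proof (rule uniform_limit_imp_fps_expansion_eq[where A = "ball 0 (1/2)" and f = f and f' = f'])
    show "f \<longlonglongrightarrow> fps_euler d"
      using has_prod_imp_tendsto'[OF q_product_limit(1)[OF one]] unfolding f_def fps_euler_def .
    have "uniform_limit (cball 0 (1/2)) f' (\<lambda>x. qpoch (x ^ d) (x ^ d)) sequentially"
      unfolding f'_def
    proof (rule qpoch_uniform_limit)
      fix x :: complex assume "x \<in> cball 0 (1/2)"
      then show "norm (x ^ d) < 1" using assms by (intro norm_power_less_one) auto
    qed (auto intro!: continuous_intros)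
    then show "uniform_limit (ball 0 (1/2)) f' (\<lambda>x. qpoch (x ^ d) (x ^ d)) sequentially"
      by (rule uniform_limit_on_subset) auto
    show "\<forall>\<^sub>F N in sequentially. f' N has_fps_expansion f N"
    proof (intro always_eventually allI)
      fix N
      have "f' N = (\<lambda>x. \<Prod>m<N. 1 - x ^ (d * Suc m))"
        by (intro ext) (simp add: f'_def power_add power_mult)
      then show "f' N has_fps_expansion f N"
        unfolding f_def by (auto intro!: fps_expansion_intros simp del: mult_Suc_right)
    qed
    show "\<forall>\<^sub>F N in sequentially. f' N holomorphic_on ball 0 (1/2)"
      unfolding f'_def by (intro always_eventually allI holomorphic_intros)
    have "(\<lambda>x. qpoch (x ^ d) (x ^ d)) holomorphic_on ball 0 1"
      using assms by (intro holomorphic_intros) (auto intro!: norm_power_less_one)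
    then show "(\<lambda>x. qpoch (x ^ d) (x ^ d)) has_fps_expansion fps_expansion (\<lambda>x. qpoch (x ^ d) (x ^ d)) 0"
      by (intro has_fps_expansion_fps_expansion[of "ball 0 1"]) auto
  qed auto
  moreover have "(\<lambda>x. qpoch (x ^ d) (x ^ d)) has_fps_expansion fps_expansion (\<lambda>x. qpoch (x ^ d) (x ^ d)) 0"
    using assms by (intro has_fps_expansion_fps_expansion[of "ball 0 1"] holomorphic_intros)
      (auto intro!: norm_power_less_one)
  ultimately show ?thesis by simp
qed

section \<open>Pentagonal numbers\<close>

definition tri :: "nat \<Rightarrow> nat" where "tri s = s * (s + 1) div 2"

lemma tri_0 [simp]: "tri 0 = 0" and tri_Suc: "tri (Suc s) = tri s + Suc s"
  by (simp_all add: tri_def)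

text \<open>Shanks' finite form of the pentagonal number theorem.\<close>

lemma pentagonal_finite:
  fixes y :: "'a :: comm_ring_1"
  shows "(\<Sum>s\<le>n. (-1) ^ s * (\<Prod>i=Suc s..n. 1 - y ^ i) * y ^ (s * n + tri s)) =
    1 + (\<Sum>s=1..n. (-1) ^ s * (y ^ (s * (s - 1) + tri s) + y ^ (s * s + tri s)))"
proof (induction n)
  case (Suc n)
  define R where "R s = (\<Prod>i=Suc s..n. 1 - y ^ i)" for s
  \<comment> \<open>The s-th summand for n + 1 is T s - W s - V s. As W (s + 1) = - V s, the sums of
    W and V cancel except for V n, which supplies the smaller of the two new pentagonal
    terms.\<close>
  define T where "T s = (-1) ^ s * R s * y ^ (s * n + tri s)" for s
  define V where "V s = (-1) ^ s * R s * y ^ (Suc s * Suc n + tri s)" for s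
  define W where "W s = (-1) ^ s * R s * (1 - y ^ s) * y ^ (s * n + tri s)" for s
  have T1: "(-1) ^ s * (\<Prod>i=Suc s..Suc n. 1 - y ^ i) * y ^ (s * Suc n + tri s) = T s - W s - V s"
    if "s \<le> n" for s
  proof -
    have P: "(\<Prod>i=Suc s..Suc n. 1 - y ^ i) = R s * (1 - y ^ Suc n)"
      using that by (simp add: R_def)
    show ?thesis unfolding P T_def V_def W_def by (simp add: algebra_simps power_add)
  qed
  have W0: "W 0 = 0" by (simp add: W_def)
  have WS: "W (Suc s) = - V s" if "s < n" for s
  proof -
    have "R s = (1 - y ^ Suc s) * R (Suc s)"
      using that by (simp add: R_def prod.atLeast_Suc_atMost)
    moreover have "y ^ (Suc s * n + tri (Suc s)) = y ^ (Suc s * Suc n + tri s)"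
      by (simp add: tri_Suc algebra_simps)
    moreover have "(-1 :: 'a) ^ Suc s = - ((-1) ^ s)" by simp
    ultimately show ?thesis by (simp add: V_def W_def mult_ac del: power_Suc mult_Suc)
  qed
  have "(\<Sum>s\<le>n. W s) = W 0 + (\<Sum>s<n. W (Suc s))"
    by (subst lessThan_Suc_atMost[symmetric]) (rule sum.lessThan_Suc_shift)
  also have "\<dots> = - (\<Sum>s<n. V s)" by (simp add: W0 WS sum_negf)
  finally have SW: "(\<Sum>s\<le>n. W s) = - (\<Sum>s<n. V s)" .
  have SV: "(\<Sum>s\<le>n. V s) = (\<Sum>s<n. V s) + V n"
    by (subst lessThan_Suc_atMost[symmetric]) simp
  have Vn: "- V n = (-1) ^ Suc n * y ^ (Suc n * (Suc n - 1) + tri (Suc n))"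
    by (simp add: V_def R_def tri_Suc algebra_simps)
  have "(\<Sum>s\<le>Suc n. (-1) ^ s * (\<Prod>i=Suc s..Suc n. 1 - y ^ i) * y ^ (s * Suc n + tri s)) =
      (\<Sum>s\<le>n. T s - W s - V s) + (-1) ^ Suc n * y ^ (Suc n * Suc n + tri (Suc n))"
    by (subst sum.atMost_Suc) (simp add: T1 del: power_Suc mult_Suc prod.cl_ivl_Suc mult_Suc_right)
  also have "\<dots> = (\<Sum>s\<le>n. T s) - V n + (-1) ^ Suc n * y ^ (Suc n * Suc n + tri (Suc n))"
    unfolding sum_subtractf SW SV by simp
  also have "\<dots> = 1 + (\<Sum>s=1..n. (-1) ^ s * (y ^ (s * (s - 1) + tri s) + y ^ (s * s + tri s))) +
      (-1) ^ Suc n * (y ^ (Suc n * (Suc n - 1) + tri (Suc n)) + y ^ (Suc n * Suc n + tri (Suc n)))"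
  proof -
    have IH: "(\<Sum>s\<le>n. T s) = 1 + (\<Sum>s=1..n. (-1) ^ s * (y ^ (s * (s - 1) + tri s) + y ^ (s * s + tri s)))"
      using Suc by (simp add: T_def R_def)
    show ?thesis unfolding diff_conv_add_uminus IH Vn by (simp only: distrib_left add.assoc)
  qed
  finally show ?case by (simp add: add.assoc del: power_Suc mult_Suc mult_Suc_right)
qed simp

lemma tri_ge: "s \<le> tri s" by (induction s) (simp_all add: tri_Suc)

lemma fps_euler_one_mod_q: "d > 0 \<Longrightarrow> n \<ge> 1 \<Longrightarrow> one_mod_q n (1 - fps_X ^ (d * n) :: 'a :: idom fps)"
  by (intro one_mod_q_linear') simp

lemma fps_mult_nth_cong:
  assumes "\<And>i. i \<le> m \<Longrightarrow> fps_nth f i = fps_nth g i"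
  shows "fps_nth (f * h) m = fps_nth (g * h) m"
  unfolding fps_mult_nth by (intro sum.cong refl) (simp add: assms)

text \<open>s * (s - 1) + tri s and s * s + tri s are the pentagonal numbers s (3 s - 1) / 2 and s
  (3 s + 1) / 2. Up to the m-th coefficient the infinite product agrees with the product of its
  first m factors, to which \<open>pentagonal_finite\<close> applies.\<close>

lemma fps_euler_nth:
  fixes f :: "'a :: idom fps"
  assumes d: "d > 0"
  shows "fps_nth (fps_euler d * f) m = fps_nth f m + (\<Sum>s=1..m. (-1) ^ s *
    ((if d * (s * (s - 1) + tri s) \<le> m then fps_nth f (m - d * (s * (s - 1) + tri s)) else 0) +
     (if d * (s * s + tri s) \<le> m then fps_nth f (m - d * (s * s + tri s)) else 0)))"
proof -
  define y :: "'a fps" where "y = fps_X ^ d"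
  define P where "P = (1 :: 'a fps) + (\<Sum>s=1..m. (-1) ^ s * (y ^ (s * (s - 1) + tri s) + y ^ (s * s + tri s)))"
  have "fps_nth (fps_euler d) i = fps_nth P i" if i: "i \<le> m" for i
  proof -
    have one: "one_mod_q j (1 - y ^ j)" if "j \<ge> 1" for j
      using fps_euler_one_mod_q[OF d that] by (simp add: y_def power_mult)
    have E: "fps_nth (fps_euler d) i = fps_nth (\<Prod>j=1..i. 1 - y ^ j) i"
      unfolding fps_euler_def y_def power_mult[symmetric]
      by (rule q_product_limit(2)) (rule fps_euler_one_mod_q[OF d])
    have "one_mod_q (Suc i) (\<Prod>j=Suc i..N. 1 - y ^ j)" for N
    proof (induction N)
      case (Suc N)
      have "one_mod_q (Suc i) (1 - y ^ Suc N)" if "i \<le> N"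
      proof -
        have "Suc i \<le> d * Suc N" using mult_le_mono[of 1 d "Suc i" "Suc N"] d that by simp
        then show ?thesis unfolding y_def power_mult[symmetric] by (rule one_mod_q_linear')
      qed
      then show ?case using Suc by (auto intro: one_mod_q_mult simp: one_mod_q_1)
    qed (simp add: one_mod_q_1)
    then have tail: "fps_nth (\<Prod>j=Suc i..m. 1 - y ^ j) l = fps_nth 1 l" if "l \<le> i" for l
      using one_mod_q_nth[of "Suc i" "\<Prod>j=Suc i..m. 1 - y ^ j" l] that by simp
    have "(\<Prod>j=1..m. 1 - y ^ j) = (\<Prod>j=1..i. 1 - y ^ j) * (\<Prod>j=Suc i..m. 1 - y ^ j)"
      using prod.ub_add_nat[of 1 i "\<lambda>j. 1 - y ^ j" "m - i"] i by simp
    then have "fps_nth (\<Prod>j=1..m. 1 - y ^ j) i = fps_nth ((\<Prod>j=Suc i..m. 1 - y ^ j) * (\<Prod>j=1..i. 1 - y ^ j)) i"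
      by (simp only: mult.commute)
    also have "\<dots> = fps_nth (1 * (\<Prod>j=1..i. 1 - y ^ j)) i"
      by (rule fps_mult_nth_cong) (rule tail)
    finally have "fps_nth (\<Prod>j=1..m. 1 - y ^ j) i = fps_nth (1 * (\<Prod>j=1..i. 1 - y ^ j)) i" .
    with E have E': "fps_nth (fps_euler d) i = fps_nth (\<Prod>j=1..m. 1 - y ^ j) i" by simp
    \<comment> \<open>For s \<ge> 1 the exponent d * (s * m + tri s) exceeds m, so that only the
      summand s = 0, the finite product itself, is visible.\<close>
    have big: "fps_nth ((-1) ^ s * (\<Prod>j=Suc s..m. 1 - y ^ j) * y ^ (s * m + tri s)) i = 0"
      if s: "s \<in> {1..m}" for s
    proof -
      have "1 * m + 1 \<le> s * m + tri s" using s tri_ge[of s] by (intro add_mono mult_le_mono1) auto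
      also have "\<dots> \<le> d * (s * m + tri s)" using mult_le_mono1[of 1 d "s * m + tri s"] d by simp
      finally have "i < d * (s * m + tri s)" using i by simp
      then show ?thesis unfolding y_def power_mult[symmetric] by (simp add: fps_X_power_mult_right_nth)
    qed
    have "P = (\<Sum>s\<le>m. (-1) ^ s * (\<Prod>j=Suc s..m. 1 - y ^ j) * y ^ (s * m + tri s))"
      unfolding P_def by (rule pentagonal_finite[symmetric])
    also have "{..m} = insert 0 {1..m}" by auto
    finally have "fps_nth P i = fps_nth (\<Prod>j=1..m. 1 - y ^ j) i"
      using big by (simp add: fps_sum_nth)
    with E' show ?thesis by simp
  qed
  then have "fps_nth (fps_euler d * f) m = fps_nth (P * f) m" by (rule fps_mult_nth_cong)
  also have "P * f = f + (\<Sum>s=1..m. (-1) ^ s * (fps_X ^ (d * (s * (s - 1) + tri s)) * f + fps_X ^ (d * (s * s + tri s)) * f))"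
    by (simp add: P_def y_def power_mult[symmetric] ring_distribs sum_distrib_right mult.assoc)
  also have "fps_nth \<dots> m = fps_nth f m + (\<Sum>s=1..m. (-1) ^ s *
    ((if d * (s * (s - 1) + tri s) \<le> m then fps_nth f (m - d * (s * (s - 1) + tri s)) else 0) +
     (if d * (s * s + tri s) \<le> m then fps_nth f (m - d * (s * s + tri s)) else 0)))"
  proof -
    have sg: "fps_nth ((-1) ^ s * h) m = (-1) ^ s * fps_nth h m" for s and h :: "'a fps"
      by (cases "even s") simp_all
    show ?thesis unfolding fps_add_nth fps_sum_nth sg fps_X_power_mult_nth
      by (intro arg_cong2[of _ _ _ _ "(+)"] sum.cong refl) auto
  qed
  finally show ?thesis .
qed

text \<open>\<open>f m - pent_sum d f (m - d) d\<close> is the \<open>m\<close>-th coefficient of the product of \<open>f\<close> with Euler's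
  product in \<open>q\<^sup>d\<close>: the index \<open>m\<close> decreases along the smaller pentagonal numbers times \<open>d\<close>, and \<open>k\<close> is
  the distance to the larger one.  All indices are integers because the simplifier computes faster
  with them than with naturals.\<close>

function pent_sum :: "int \<Rightarrow> (int \<Rightarrow> int) \<Rightarrow> int \<Rightarrow> int \<Rightarrow> int" where
  "pent_sum d f m k = (if m < 0 \<or> d \<le> 0 \<or> k < 0 then 0 else
     (f m + (if m < k then 0 else f (m - k))) - pent_sum d f (m - (3 * k + d)) (k + d))"
  by auto
termination by (relation "Wellfounded.measure (\<lambda>(d, f, m, k). nat (m + 1))") auto

declare pent_sum.simps [simp del]

text \<open>From s to s + 1 the smaller pentagonal number grows by 3 s + 1, and the larger one
  exceeds it by s. With k = d * s these are the steps 3 * k + d and k of the recursion.\<close>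

lemma pent_sum_eq:
  assumes d: "d > 0" and "s \<ge> 1"
  shows "(-1) ^ s * pent_sum (int d) f (int m - int (d * (s * (s - 1) + tri s))) (int (d * s)) = (\<Sum>i=s..m. (-1) ^ i *
      ((if d * (i * (i - 1) + tri i) \<le> m then f (int (m - d * (i * (i - 1) + tri i))) else 0) +
       (if d * (i * i + tri i) \<le> m then f (int (m - d * (i * i + tri i))) else 0)))"
  using assms(2)
proof (induction "Suc m - s" arbitrary: s rule: less_induct)
  case less
  define g where "g i = i * (i - 1) + tri i" for i
  define h where "h i = i * i + tri i" for i
  define F where "F i = (-1) ^ i * ((if d * g i \<le> m then f (int (m - d * g i)) else 0) +
      (if d * h i \<le> m then f (int (m - d * h i)) else 0))" for i
  have tri_mono: "tri i \<le> tri j" if "i \<le> j" for i j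
    unfolding tri_def using that by (intro div_le_mono mult_le_mono) auto
  have g_mono: "g i \<le> g j" if "i \<le> j" for i j
    unfolding g_def using that by (intro add_mono mult_le_mono tri_mono diff_le_mono)
  have gh: "g i \<le> h i" for i
    unfolding g_def h_def by (intro add_mono mult_le_mono) auto
  have "(-1) ^ s * pent_sum (int d) f (int m - int (d * g s)) (int (d * s)) = (\<Sum>i=s..m. F i)"
  proof (cases "m < d * g s")
    case True
    have "F i = 0" if "s \<le> i" for i
    proof -
      have "m < d * g i" using True g_mono[OF that] by (meson less_le_trans mult_le_mono2)
      moreover from this have "m < d * h i" using gh[of i] by (meson less_le_trans mult_le_mono2)
      ultimately show ?thesis by (simp add: F_def)
    qed
    moreover have "int m - int (d * g s) < 0" using True by linarith
    ultimately show ?thesis by (subst pent_sum.simps) simp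
  next
    case False
    have "s \<le> 1 * g s" unfolding g_def using tri_ge[of s] by simp
    also have "\<dots> \<le> d * g s" using d by (intro mult_le_mono1) simp
    finally have sm: "s \<le> m" using False by simp
    have dh: "d * g s + d * s = d * h s"
    proof -
      have "g s + s = h s" using less.prems by (cases s) (simp_all add: g_def h_def)
      then show ?thesis by (metis distrib_left)
    qed
    have dn: "d * g s + (3 * (d * s) + d) = d * g (Suc s)"
    proof -
      have "g s + (3 * s + 1) = g (Suc s)" using less.prems
        by (cases s) (simp_all add: g_def tri_Suc)
      then have "d * (g s + (3 * s + 1)) = d * g (Suc s)" by (rule arg_cong)
      then show ?thesis by (simp add: algebra_simps)
    qed
    have c: "\<not> (int m - int (d * g s) < 0 \<or> int d \<le> 0 \<or> int (d * s) < 0)" using False d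
      by (simp del: of_nat_mult)
    have f1: "int m - int (d * g s) = int (m - d * g s)" using False by (simp only: of_nat_diff not_less)
    have f2: "(if int m - int (d * g s) < int (d * s) then 0 else f (int m - int (d * g s) - int (d * s))) =
        (if d * h s \<le> m then f (int (m - d * h s)) else 0)"
    proof -
      define N where "N = m - d * g s"
      have "d * h s \<le> m \<longleftrightarrow> d * s \<le> N" "m - d * h s = N - d * s"
        unfolding dh[symmetric] N_def using False by auto
      then show ?thesis unfolding f1 of_nat_less_iff N_def[symmetric]
        by (simp add: not_less of_nat_diff del: of_nat_mult)
    qed
    have f3: "int m - int (d * g s) - (3 * int (d * s) + int d) = int m - int (d * g (Suc s))"
      unfolding dn[symmetric] by simp
    have f4: "int (d * s) + int d = int (d * Suc s)" by simp
    have "(-1) ^ s * pent_sum (int d) f (int m - int (d * g s)) (int (d * s)) =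
        F s + (-1) ^ Suc s * pent_sum (int d) f (int m - int (d * g (Suc s))) (int (d * Suc s))"
      unfolding pent_sum.simps[of "int d" f "int m - int (d * g s)"] if_not_P[OF c] f2 f3 f4 unfolding f1
      using False by (simp add: F_def not_less algebra_simps)
    also have "(-1) ^ Suc s * pent_sum (int d) f (int m - int (d * g (Suc s))) (int (d * Suc s)) = (\<Sum>i=Suc s..m. F i)"
      unfolding F_def g_def h_def by (rule less.hyps) (use sm in auto)
    finally show ?thesis using sm by (simp add: sum.atLeast_Suc_atMost)
  qed
  then show ?case unfolding F_def g_def h_def .
qed

definition coef :: "int fps \<Rightarrow> int \<Rightarrow> int" where
  "coef f i = (if i < 0 then 0 else fps_nth f (nat i))"

lemma coef_euler_mult:
  assumes "d > 0"
  shows "coef (fps_euler (nat d) * f) m = coef f m - pent_sum d (coef f) (m - d) d"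
proof (cases "m < 0")
  case True
  then show ?thesis using assms by (subst pent_sum.simps) (simp add: coef_def)
next
  case False
  define d' m' where "d' = nat d" and "m' = nat m"
  have dm: "d = int d'" "m = int m'" "d' > 0" using assms False by (simp_all add: d'_def m'_def)
  have A: "d' * (1 * (1 - 1) + tri 1) = d'" "d' * 1 = d'" by (simp_all add: tri_def)
  have c: "coef f (int i) = fps_nth f i" for f i by (simp add: coef_def)
  show ?thesis
    using pent_sum_eq[OF dm(3) order_refl, of "coef f" m'] fps_euler_nth[OF dm(3), of f m']
    unfolding A unfolding dm c nat_int by simp
qed

text \<open>Only arguments between 0 and m are inspected; hence a recursion f m = num m + pent_sum d
  f (m - d) d determines f.\<close>

lemma pent_sum_cong:
  "d > 0 \<Longrightarrow> k > 0 \<Longrightarrow> (\<And>i. 0 \<le> i \<Longrightarrow> i \<le> m \<Longrightarrow> f i = g i) \<Longrightarrow> pent_sum d f m k = pent_sum d g m k"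
proof (induction d f m k rule: pent_sum.induct)
  case (1 d f m k)
  show ?case
  proof (cases "m < 0")
    case False
    have "pent_sum d f (m - (3 * k + d)) (k + d) = pent_sum d g (m - (3 * k + d)) (k + d)"
      using False 1 by (intro 1(1)) auto
    moreover have "f m = g m" "\<not> m < k \<Longrightarrow> f (m - k) = g (m - k)" using 1(2-4) False by auto
    ultimately show ?thesis unfolding pent_sum.simps[of d f m k] pent_sum.simps[of d g m k] by auto
  next
    case True
    then show ?thesis unfolding pent_sum.simps[of d f m k] pent_sum.simps[of d g m k] by simp
  qed
qed

text \<open>Subtracting three times a pentagonal number does not leave the residue class 2 modulo
  3.\<close>

lemma pent_sum_trisect:
  "pent_sum 3 f (3 * m + 2) (3 * k) = pent_sum 1 (\<lambda>i. f (3 * i + 2)) m k"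
proof (induction "1 :: int" "\<lambda>i. f (3 * i + 2)" m k rule: pent_sum.induct)
  case (1 m k)
  show ?case
  proof (cases "m < 0 \<or> k < 0")
    case False
    have IH: "pent_sum 3 f (3 * (m - (3 * k + 1)) + 2) (3 * (k + 1)) = pent_sum 1 (\<lambda>i. f (3 * i + 2)) (m - (3 * k + 1)) (k + 1)"
      using False by (intro 1) auto
    have E: "3 * m + 2 - (3 * (3 * k) + 3) = 3 * (m - (3 * k + 1)) + 2" "3 * k + 3 = 3 * (k + 1)"
      "3 * m + 2 - 3 * k = 3 * (m - k) + 2" by simp_all
    have c: "3 * m + 2 < 0 \<longleftrightarrow> m < 0" "3 * k < 0 \<longleftrightarrow> k < 0" "3 * m + 2 < 3 * k \<longleftrightarrow> m < k" by auto
    show ?thesis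
      unfolding pent_sum.simps[of 3 f "3 * m + 2" "3 * k"] pent_sum.simps[of 1 "\<lambda>i. f (3 * i + 2)" m k] E IH c
      by simp
  next
    case True
    then show ?thesis
      unfolding pent_sum.simps[of 3 f "3 * m + 2" "3 * k"] pent_sum.simps[of 1 "\<lambda>i. f (3 * i + 2)" m k] by auto
  qed
qed

section \<open>Evaluation of Laurent polynomials\<close>

text \<open>\<psi> k plays the role of the k-th power of the point of evaluation: the constant 1 for
  \<zeta> = 1, and \<open>omega powi k\<close> for a cube root of unity.\<close>

definition laurent_eval :: "(int \<Rightarrow> 'a :: comm_ring_1) \<Rightarrow> laurent \<Rightarrow> 'a" where
  "laurent_eval \<psi> L = (\<Sum>k\<in>Poly_Mapping.keys L. of_int (Poly_Mapping.lookup L k) * \<psi> k)"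

lemma laurent_eval_superset:
  "finite S \<Longrightarrow> Poly_Mapping.keys L \<subseteq> S \<Longrightarrow>
    laurent_eval \<psi> L = (\<Sum>k\<in>S. of_int (Poly_Mapping.lookup L k) * \<psi> k)"
  unfolding laurent_eval_def by (rule sum.mono_neutral_left) (auto simp: in_keys_iff)

lemma laurent_eval_0 [simp]: "laurent_eval \<psi> 0 = 0"
  by (simp add: laurent_eval_def)

lemma laurent_eval_diff: "laurent_eval \<psi> (L - K) = laurent_eval \<psi> L - laurent_eval \<psi> K"
proof -
  define S where "S = Poly_Mapping.keys L \<union> Poly_Mapping.keys K"
  have "finite S" "Poly_Mapping.keys L \<subseteq> S" "Poly_Mapping.keys K \<subseteq> S" "Poly_Mapping.keys (L - K) \<subseteq> S"
    using keys_diff[of L K] by (auto simp: S_def)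
  then show ?thesis
    by (simp add: laurent_eval_superset[of S] lookup_minus algebra_simps sum_subtractf)
qed

lemma laurent_eval_uminus: "laurent_eval \<psi> (- L) = - laurent_eval \<psi> L"
  using laurent_eval_diff[of \<psi> 0 L] by simp

lemma laurent_eval_add: "laurent_eval \<psi> (L + K) = laurent_eval \<psi> L + laurent_eval \<psi> K"
  using laurent_eval_diff[of \<psi> L "- K"] by (simp add: laurent_eval_uminus)

lemma laurent_eval_single: "laurent_eval \<psi> (Poly_Mapping.single k c) = of_int c * \<psi> k"
  by (cases "c = 0") (simp_all add: laurent_eval_def)

lemma laurent_eval_1 [simp]: "laurent_eval \<psi> 1 = \<psi> 0"
  using laurent_eval_single[of \<psi> 0 1] by simp

text \<open>Additively, Laurent polynomials form the free abelian group on the powers of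
  \<zeta>.\<close>

lemma laurent_induct [case_names zero single diff]:
  fixes L :: laurent
  assumes "P 0" "\<And>k. P (Poly_Mapping.single k 1)" "\<And>L K. P L \<Longrightarrow> P K \<Longrightarrow> P (L - K)"
  shows "P L"
  using frag_induction[of L UNIV P] assms by auto

lemma laurent_eval_mult:
  assumes "\<And>k l. \<psi> (k + l) = \<psi> k * \<psi> l"
  shows "laurent_eval \<psi> (L * K) = laurent_eval \<psi> L * laurent_eval \<psi> K"
proof (induction L rule: laurent_induct)
  case (single k)
  show ?case
    by (induction K rule: laurent_induct)
       (simp_all add: mult_single laurent_eval_single assms right_diff_distrib laurent_eval_diff)
qed (simp_all add: left_diff_distrib laurent_eval_diff)

lemma at_zeta_one_eq: "at_zeta_one L = laurent_eval (\<lambda>_. 1) L"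
  by (simp add: at_zeta_one_def laurent_eval_def)

lemma zeta_pow_mult: "zeta_pow k * zeta_pow l = zeta_pow (k + l)"
  by (simp add: zeta_pow_def mult_single)

lemma zeta_pow_0: "zeta_pow 0 = 1"
  by (simp add: zeta_pow_def)

section \<open>Divisibility by the third cyclotomic polynomial\<close>

lemma poly_at_zeta_phi3: "poly_at_zeta [:1, 1, 1:] = 1 + zeta_pow 1 + zeta_pow 2"
  by (simp add: poly_at_zeta_def map_poly_pCons algebra_simps zeta_pow_mult)

lemma phi3_dvd_zeta_pow_diff: "1 + zeta_pow 1 + zeta_pow 2 dvd zeta_pow (k + 3) - zeta_pow k"
proof -
  have "zeta_pow (k + 3) - zeta_pow k = (1 + zeta_pow 1 + zeta_pow 2) * (zeta_pow (k + 1) - zeta_pow k)"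
    by (simp add: algebra_simps zeta_pow_mult)
  then show ?thesis by simp
qed

lemma phi3_dvd_zeta_pow_mod: "1 + zeta_pow 1 + zeta_pow 2 dvd zeta_pow (k + 3 * j) - zeta_pow k"
proof (induction j rule: int_induct[where k = 0])
  case (step1 i)
  have "zeta_pow (k + 3 * (i + 1)) - zeta_pow k =
      (zeta_pow ((k + 3 * i) + 3) - zeta_pow (k + 3 * i)) + (zeta_pow (k + 3 * i) - zeta_pow k)"
    by (simp add: algebra_simps)
  then show ?case using step1 phi3_dvd_zeta_pow_diff by (metis dvd_add)
next
  case (step2 i)
  have "zeta_pow (k + 3 * (i - 1)) - zeta_pow k =
      (zeta_pow (k + 3 * i) - zeta_pow k) - (zeta_pow ((k + 3 * (i - 1)) + 3) - zeta_pow (k + 3 * (i - 1)))"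
    by (simp add: algebra_simps)
  then show ?case using step2 phi3_dvd_zeta_pow_diff by (metis dvd_diff)
qed simp

text \<open>Division with remainder a + b * \<zeta>: exponents are reduced modulo 3, and \<zeta> ^ 2
  is replaced by - 1 - \<zeta>.\<close>

lemma laurent_reduce_phi3:
  "\<exists>a b. 1 + zeta_pow 1 + zeta_pow 2 dvd L - (Poly_Mapping.single 0 a + Poly_Mapping.single 1 b)"
proof (induction L rule: laurent_induct)
  case zero
  show ?case by (intro exI[of _ 0]) simp
next
  case (single k)
  have k: "k = k mod 3 + 3 * (k div 3)" by simp
  have d: "1 + zeta_pow 1 + zeta_pow 2 dvd zeta_pow k - zeta_pow (k mod 3)"
    using phi3_dvd_zeta_pow_mod[of "k mod 3" "k div 3"] k by simp
  have "k mod 3 = 0 \<or> k mod 3 = 1 \<or> k mod 3 = 2" by auto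
  then consider "k mod 3 = 0" | "k mod 3 = 1" | "k mod 3 = 2" by blast
  then show ?case
  proof cases
    case 1
    then show ?thesis using d by (intro exI[of _ 1] exI[of _ 0]) (simp add: zeta_pow_def)
  next
    case 2
    then show ?thesis using d by (intro exI[of _ 0] exI[of _ 1]) (simp add: zeta_pow_def)
  next
    case 3
    have "zeta_pow k - (Poly_Mapping.single 0 (-1) + Poly_Mapping.single 1 (-1)) =
        (zeta_pow k - zeta_pow 2) + (1 + zeta_pow 1 + zeta_pow 2)"
      by (simp add: zeta_pow_def single_uminus)
    then have "1 + zeta_pow 1 + zeta_pow 2 dvd zeta_pow k - (Poly_Mapping.single 0 (-1) + Poly_Mapping.single 1 (-1))"
      using d 3 by (metis dvd_add dvd_refl)
    then show ?thesis unfolding zeta_pow_def by blast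
  qed
next
  case (diff L K)
  then obtain a b a' b' where
    ab: "1 + zeta_pow 1 + zeta_pow 2 dvd L - (Poly_Mapping.single 0 a + Poly_Mapping.single 1 b)"
      "1 + zeta_pow 1 + zeta_pow 2 dvd K - (Poly_Mapping.single 0 a' + Poly_Mapping.single 1 b')" by blast
  have "L - K - (Poly_Mapping.single 0 (a - a') + Poly_Mapping.single 1 (b - b')) =
      (L - (Poly_Mapping.single 0 a + Poly_Mapping.single 1 b)) -
      (K - (Poly_Mapping.single 0 a' + Poly_Mapping.single 1 b'))"
    by (simp add: single_diff)
  then show ?case using ab by (metis dvd_diff)
qed

definition omega :: complex where "omega = cis (2 * pi / 3)"

lemma omega_eq: "omega = Complex (- 1 / 2) (sqrt 3 / 2)"
  using cos_120 sin_120 by (simp add: omega_def complex_eq_iff)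

lemma omega_nz [simp]: "omega \<noteq> 0" by (simp add: omega_def)

lemma omega_sum: "1 + omega + omega\<^sup>2 = 0"
  by (simp add: omega_eq complex_eq_iff power2_eq_square)

lemma omega_cube: "omega ^ 3 = 1"
proof -
  have "omega ^ 3 - 1 = (omega - 1) * (1 + omega + omega\<^sup>2)"
    by (simp add: algebra_simps power2_eq_square power3_eq_cube)
  then show ?thesis by (simp add: omega_sum)
qed

abbreviation eval_omega :: "laurent \<Rightarrow> complex" where
  "eval_omega \<equiv> laurent_eval (\<lambda>k. omega powi k)"

text \<open>The remainder a + b * \<zeta> vanishes at \<open>omega\<close>, and 1 and
  \<open>omega\<close> are linearly independent over the rationals.\<close>

lemma phi3_dvd_iff:
  assumes "eval_omega L = 0"
  shows "poly_at_zeta [:1, 1, 1:] dvd L"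
proof -
  have mult: "omega powi (k + l) = omega powi k * omega powi l" for k l
    by (simp add: power_int_add)
  obtain a b where ab: "1 + zeta_pow 1 + zeta_pow 2 dvd L - (Poly_Mapping.single 0 a + Poly_Mapping.single 1 b)"
    using laurent_reduce_phi3 by blast
  then obtain K where K: "L - (Poly_Mapping.single 0 a + Poly_Mapping.single 1 b) = (1 + zeta_pow 1 + zeta_pow 2) * K"
    by blast
  have "eval_omega (1 + zeta_pow 1 + zeta_pow 2) = 0"
    unfolding zeta_pow_0[symmetric] laurent_eval_add
    using omega_sum by (simp add: zeta_pow_def laurent_eval_single)
  then have "eval_omega (L - (Poly_Mapping.single 0 a + Poly_Mapping.single 1 b)) = 0"
    unfolding K laurent_eval_mult[OF mult] by simp
  then have e: "of_int a + of_int b * omega = 0"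
    using assms by (simp add: laurent_eval_diff laurent_eval_add laurent_eval_single add_eq_0_iff)
  then have "b = 0" by (simp add: omega_eq complex_eq_iff)
  moreover from this e have "a = 0" by simp
  ultimately show ?thesis using ab by (simp add: poly_at_zeta_phi3)
qed

text \<open>The cyclotomic polynomial has the value 3 at \<zeta> = 1; this turns divisibility into
  the congruence modulo 3.\<close>

lemma at_zeta_one_phi3_dvd:
  assumes "poly_at_zeta [:1, 1, 1:] dvd L"
  shows "3 dvd at_zeta_one L"
proof -
  obtain K where K: "L = (1 + zeta_pow 1 + zeta_pow 2) * K" using assms unfolding poly_at_zeta_phi3 by blast
  have "at_zeta_one L = at_zeta_one (1 + zeta_pow 1 + zeta_pow 2) * at_zeta_one K"
    unfolding K at_zeta_one_eq by (rule laurent_eval_mult) simp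
  also have "at_zeta_one (1 + zeta_pow 1 + zeta_pow 2) = 3"
    unfolding zeta_pow_0[symmetric] at_zeta_one_eq laurent_eval_add by (simp add: zeta_pow_def laurent_eval_single)
  finally show ?thesis by simp
qed

section \<open>Coefficientwise morphisms and infinite products\<close>

definition fps_map :: "('a \<Rightarrow> 'b) \<Rightarrow> 'a fps \<Rightarrow> 'b fps" where
  "fps_map h f = Abs_fps (\<lambda>n. h (fps_nth f n))"

lemma fps_map_nth [simp]: "fps_nth (fps_map h f) n = h (fps_nth f n)"
  by (simp add: fps_map_def)

text \<open>The instances are evaluation at \<zeta> = 1, evaluation at \<open>omega\<close>, and the
  embedding of the integers into the complex numbers.\<close>

locale ring_morphism =
  fixes h :: "'a :: idom \<Rightarrow> 'b :: idom"
  assumes add: "h (x + y) = h x + h y" and mult: "h (x * y) = h x * h y" and one [simp]: "h 1 = 1"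
begin

lemma zero [simp]: "h 0 = 0"
proof -
  have "h 0 + h 0 = h 0 + 0" using add[of 0 0] by simp
  then show ?thesis unfolding add_left_cancel .
qed

lemma uminus: "h (- x) = - h x" using add[of x "- x"] by (simp add: add_eq_0_iff)

lemma sum: "h (sum f A) = (\<Sum>i\<in>A. h (f i))"
  by (induction A rule: infinite_finite_induct) (simp_all add: add)

lemma fps_map_mult: "fps_map h (f * g) = fps_map h f * fps_map h g"
  by (rule fps_ext) (simp add: fps_mult_nth sum mult)

lemma fps_map_1 [simp]: "fps_map h 1 = 1"
  by (rule fps_ext) simp

lemma fps_map_diff: "fps_map h (f - g) = fps_map h f - fps_map h g"
  by (rule fps_ext) (simp add: add[of _ "- _", simplified] uminus)

lemma fps_map_const [simp]: "fps_map h (fps_const c) = fps_const (h c)"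
  by (rule fps_ext) simp

lemma fps_map_power: "fps_map h (f ^ k) = fps_map h f ^ k"
  by (induction k) (simp_all add: fps_map_mult)

lemma fps_map_X_power [simp]: "fps_map h (fps_X ^ k) = fps_X ^ k"
  by (rule fps_ext) simp

lemma fps_map_X [simp]: "fps_map h fps_X = fps_X"
  using fps_map_X_power[of 1] by simp

lemma fps_map_prod: "fps_map h (prod f A) = (\<Prod>i\<in>A. fps_map h (f i))"
  by (induction A rule: infinite_finite_induct) (simp_all add: fps_map_mult)

lemma fps_map_one_mod_q: "one_mod_q n f \<Longrightarrow> one_mod_q n (fps_map h f)"
  unfolding one_mod_q_def by (metis dvdE dvdI fps_map_1 fps_map_X_power fps_map_diff fps_map_mult)

lemma fps_map_recip:
  assumes "fps_nth f 0 = 1"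
  shows "fps_map h (fps_recip f) = fps_recip (fps_map h f)"
proof -
  have "f * fps_recip f = 1" by (rule fps_right_inverse) (simp add: assms)
  then have 1: "fps_map h f * fps_map h (fps_recip f) = 1"
    by (metis fps_map_1 fps_map_mult)
  have 2: "fps_map h f * fps_recip (fps_map h f) = 1" by (rule fps_right_inverse) (simp add: assms)
  have "fps_map h f \<noteq> 0" using 1 by auto
  then show ?thesis using 1 2 by (metis mult_left_cancel)
qed

lemma fps_map_q_product:
  assumes "\<And>n. n \<ge> 1 \<Longrightarrow> one_mod_q n (f n)"
  shows "fps_map h (q_product f) = q_product (\<lambda>n. fps_map h (f n))"
proof (rule fps_ext)
  fix m
  have "fps_nth (q_product (\<lambda>n. fps_map h (f n))) m = fps_nth (\<Prod>n=1..m. fps_map h (f n)) m"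
    by (rule q_product_limit(2)) (rule fps_map_one_mod_q[OF assms])
  also have "\<dots> = fps_nth (fps_map h (\<Prod>n=1..m. f n)) m" by (simp only: fps_map_prod)
  also have "\<dots> = h (fps_nth (q_product f) m)"
    using q_product_limit(2)[of f m, OF assms] by simp
  finally show "fps_nth (fps_map h (q_product f)) m = fps_nth (q_product (\<lambda>n. fps_map h (f n))) m"
    by simp
qed

end

text \<open>All factors beyond the i-th one are 1 modulo q ^ (i + 1).\<close>

lemma q_product_nth_stable:
  fixes f :: "nat \<Rightarrow> 'a :: idom fps"
  assumes f: "\<And>n. n \<ge> 1 \<Longrightarrow> one_mod_q n (f n)" and i: "i \<le> N"
  shows "fps_nth (q_product f) i = fps_nth (\<Prod>n=1..N. f n) i"
proof -
  have "one_mod_q (Suc i) (f n)" if "Suc i \<le> n" for n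
  proof -
    have "fps_X ^ Suc i dvd (fps_X ^ n :: 'a fps)" by (rule le_imp_power_dvd[OF that])
    also have "fps_X ^ n dvd f n - 1" using f[of n] that by (simp add: one_mod_q_def)
    finally show ?thesis by (simp only: one_mod_q_def)
  qed
  then have "one_mod_q (Suc i) (\<Prod>n=Suc i..K. f n)" for K
    by (induction K) (auto intro: one_mod_q_mult simp: one_mod_q_1)
  from one_mod_q_nth[OF this] have tail: "fps_nth (\<Prod>n=Suc i..N. f n) l = fps_nth 1 l" if "l \<le> i" for l
    using that by simp
  have "(\<Prod>n=1..N. f n) = (\<Prod>n=Suc i..N. f n) * (\<Prod>n=1..i. f n)"
    using prod.ub_add_nat[of 1 i f "N - i"] i by (simp add: mult.commute)
  then have "fps_nth (\<Prod>n=1..N. f n) i = fps_nth ((\<Prod>n=Suc i..N. f n) * (\<Prod>n=1..i. f n)) i"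
    by (rule arg_cong)
  also have "\<dots> = fps_nth (1 * (\<Prod>n=1..i. f n)) i"
    by (rule fps_mult_nth_cong) (rule tail)
  also have "\<dots> = fps_nth (q_product f) i" using q_product_limit(2)[of f i, OF f] by simp
  finally show ?thesis ..
qed

lemma q_product_mult:
  fixes f g :: "nat \<Rightarrow> 'a :: idom fps"
  assumes f: "\<And>n. n \<ge> 1 \<Longrightarrow> one_mod_q n (f n)" and g: "\<And>n. n \<ge> 1 \<Longrightarrow> one_mod_q n (g n)"
  shows "q_product f * q_product g = q_product (\<lambda>n. f n * g n)"
proof (rule fps_ext)
  fix m
  have "fps_nth (q_product (\<lambda>n. f n * g n)) m = fps_nth (\<Prod>n=1..m. f n * g n) m"
    by (rule q_product_limit(2)) (intro one_mod_q_mult f g)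
  also have "\<dots> = fps_nth ((\<Prod>n=1..m. f n) * (\<Prod>n=1..m. g n)) m" by (simp only: prod.distrib)
  also have "\<dots> = fps_nth (q_product f * q_product g) m"
    unfolding fps_mult_nth
    by (intro sum.cong refl) (simp add: q_product_nth_stable[OF f, of _ m] q_product_nth_stable[OF g, of _ m])
  finally show "fps_nth (q_product f * q_product g) m = fps_nth (q_product (\<lambda>n. f n * g n)) m" ..
qed

lemma q_product_power:
  fixes f :: "nat \<Rightarrow> 'a :: idom fps"
  assumes f: "\<And>n. n \<ge> 1 \<Longrightarrow> one_mod_q n (f n)"
  shows "q_product f ^ k = q_product (\<lambda>n. f n ^ k)"
proof (induction k)
  case 0
  have "fps_nth (q_product (\<lambda>n. 1 :: 'a fps)) m = fps_nth 1 m" for m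
    by (subst q_product_limit(2)) (simp_all add: one_mod_q_1)
  then show ?case by (simp add: fps_eq_iff)
next
  case (Suc k)
  then show ?case by (simp add: q_product_mult f one_mod_q_power)
qed

lemma q_product_cong: "(\<And>n. n \<ge> 1 \<Longrightarrow> f n = g n) \<Longrightarrow> q_product f = q_product g"
  unfolding q_product_def by (intro prodinf_cong) simp

interpretation eval1: ring_morphism at_zeta_one
  by unfold_locales
     (simp_all add: at_zeta_one_eq laurent_eval_add laurent_eval_mult laurent_eval_single)

interpretation evalw: ring_morphism eval_omega
  by unfold_locales
     (simp_all add: laurent_eval_add laurent_eval_mult power_int_add laurent_eval_single)

interpretation cplx: ring_morphism "of_int :: int \<Rightarrow> complex"
  by unfold_locales simp_all

lemma fps_map_euler_of_int: "d > 0 \<Longrightarrow> fps_map of_int (fps_euler d) = (fps_euler d :: complex fps)"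
  unfolding fps_euler_def
  by (subst cplx.fps_map_q_product) (simp_all add: fps_euler_one_mod_q cplx.fps_map_diff)

lemma fps_at_zeta_one_eq: "fps_at_zeta_one C = fps_map at_zeta_one C"
  by (simp add: fps_at_zeta_one_def fps_map_def)

lemma eval1_pm: "fps_map at_zeta_one (pm k m) = (1 - fps_X ^ m)\<^sup>2"
proof -
  have "at_zeta_one (zeta_pow k) = 1" for k
    by (simp add: at_zeta_one_eq zeta_pow_def laurent_eval_single)
  then show ?thesis by (simp add: pm_def eval1.fps_map_mult eval1.fps_map_diff power2_eq_square)
qed

lemma quadratic_expand:
  fixes X Z Y :: "'a :: comm_ring_1"
  assumes "X + Z = -1" "X * Z = 1"
  shows "(1 - X * Y) * (1 - Z * Y) = 1 + Y + Y\<^sup>2"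
proof -
  have "(1 - X * Y) * (1 - Z * Y) = 1 - (X + Z) * Y + (X * Z) * Y\<^sup>2"
    by (simp add: algebra_simps power2_eq_square)
  then show ?thesis unfolding assms by simp
qed

text \<open>If 3 does not divide k, the powers of \<open>omega\<close> with exponents k and - k are
  the two primitive cube roots of unity, and 1 - q ^ m is the missing third factor of 1 - q ^ (3
  m).\<close>

lemma evalw_pm:
  assumes "\<not> 3 dvd k"
  shows "fps_map eval_omega (pm k m) * (1 - fps_X ^ m) = 1 - fps_X ^ (3 * m)"
proof -
  define x y where "x = omega powi k" and "y = omega powi (- k)"
  have xy: "x * y = 1" by (simp add: x_def y_def power_int_minus)
  have o3: "omega powi (3 * j) = 1" for j
    using omega_cube by (simp add: power_int_mult power_int_numeral)
  have x3: "x ^ 3 = 1"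
  proof -
    have "x ^ 3 = omega powi (3 * k)"
      by (simp add: x_def power3_eq_cube power_int_add[symmetric])
    then show ?thesis by (simp only: o3)
  qed
  have "x \<noteq> 1"
  proof -
    have "x = omega powi (3 * (k div 3)) * omega powi (k mod 3)"
      unfolding x_def by (subst power_int_add[symmetric]) simp_all
    then have xr: "x = omega powi (k mod 3)" by (simp only: o3 mult_1)
    have "k mod 3 \<noteq> 0" "0 \<le> k mod 3" "k mod 3 < 3" using assms by (simp_all add: dvd_eq_mod_eq_0)
    then have "k mod 3 = 1 \<or> k mod 3 = 2" by linarith
    then show ?thesis unfolding xr by (auto simp: omega_eq complex_eq_iff power_int_numeral power2_eq_square)
  qed
  moreover have "(x - 1) * (1 + x + x\<^sup>2) = x ^ 3 - 1"
    by (simp add: algebra_simps power2_eq_square power3_eq_cube)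
  ultimately have s: "1 + x + x\<^sup>2 = 0" using x3 by simp
  have "y = y * x ^ 3" using x3 by simp
  also have "\<dots> = (x * y) * x\<^sup>2" by (simp add: power2_eq_square power3_eq_cube mult_ac)
  finally have "y = x\<^sup>2" using xy by simp
  with s have sum: "x + y = - 1" by (simp add: add_eq_0_iff algebra_simps)
  have c: "fps_const x + fps_const y = -1" "fps_const x * fps_const y = 1"
    using sum xy by (simp_all add: fps_const_add fps_const_neg flip: fps_const_1_eq_1)
  define Y :: "complex fps" where "Y = fps_X ^ m"
  have "eval_omega (zeta_pow j) = omega powi j" for j
    by (simp add: zeta_pow_def laurent_eval_single)
  then have "fps_map eval_omega (pm k m) = (1 - fps_const x * Y) * (1 - fps_const y * Y)"
    by (simp add: pm_def evalw.fps_map_mult evalw.fps_map_diff x_def y_def Y_def)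
  also have "\<dots> = 1 + Y + Y\<^sup>2" by (rule quadratic_expand[OF c])
  finally have "fps_map eval_omega (pm k m) * (1 - Y) = 1 - Y ^ 3"
    by (simp add: algebra_simps power2_eq_square power3_eq_cube)
  then show ?thesis by (simp add: Y_def power_mult[symmetric] mult.commute)
qed

text \<open>Collects the identities between single factors; the denominators stand on the left, so
  that only products of series occur.\<close>

lemma eval_omega_product:
  fixes F :: "nat \<Rightarrow> laurent fps"
  assumes t: "t > 0" and one: "\<And>n. n \<ge> 1 \<Longrightarrow> one_mod_q n (F n)"
    and F: "\<And>n. n \<ge> 1 \<Longrightarrow> fps_map eval_omega (F n) * (1 - fps_X ^ (3 * n)) * (1 - fps_X ^ (t * n)) =
      (1 - fps_X ^ n)\<^sup>2 * (1 - fps_X ^ (t * n)) ^ v * (1 - fps_X ^ (3 * t * n)) ^ b"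
  shows "fps_map eval_omega (q_product F) * fps_euler 3 * fps_euler t =
    fps_euler 1 ^ 2 * fps_euler t ^ v * fps_euler (3 * t) ^ b"
proof -
  let ?e = "\<lambda>d n. 1 - fps_X ^ (d * n) :: complex fps"
  let ?C = "\<lambda>n. fps_map eval_omega (F n)"
  have C: "one_mod_q n (?C n)" if "n \<ge> 1" for n by (rule evalw.fps_map_one_mod_q[OF one[OF that]])
  have e: "one_mod_q n (?e d n)" if "d > 0" "n \<ge> 1" for d n by (rule fps_euler_one_mod_q[OF that])
  have l1: "q_product ?C * fps_euler 3 = q_product (\<lambda>n. ?C n * ?e 3 n)"
    unfolding fps_euler_def by (rule q_product_mult) (auto intro: C e)
  have l2: "q_product (\<lambda>n. ?C n * ?e 3 n) * fps_euler t = q_product (\<lambda>n. ?C n * ?e 3 n * ?e t n)"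
    unfolding fps_euler_def by (rule q_product_mult) (intro one_mod_q_mult C e t zero_less_numeral; assumption)+
  have p: "fps_euler d ^ k = q_product (\<lambda>n. ?e d n ^ k)" if "d > 0" for d k
    unfolding fps_euler_def by (rule q_product_power) (rule e[OF that])
  have r1: "fps_euler 1 ^ 2 * fps_euler t ^ v = q_product (\<lambda>n. ?e 1 n ^ 2 * ?e t n ^ v)"
    unfolding p[OF t] p[OF zero_less_one]
    by (rule q_product_mult) (intro one_mod_q_power e zero_less_one t; assumption)+
  have r2: "q_product (\<lambda>n. ?e 1 n ^ 2 * ?e t n ^ v) * fps_euler (3 * t) ^ b =
      q_product (\<lambda>n. ?e 1 n ^ 2 * ?e t n ^ v * ?e (3 * t) n ^ b)"
    using t by (subst p, simp, intro q_product_mult one_mod_q_mult one_mod_q_power e) auto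
  have "q_product (\<lambda>n. ?C n * ?e 3 n * ?e t n) = q_product (\<lambda>n. ?e 1 n ^ 2 * ?e t n ^ v * ?e (3 * t) n ^ b)"
    by (rule q_product_cong) (simp add: F)
  then have "q_product ?C * fps_euler 3 * fps_euler t =
      fps_euler 1 ^ 2 * fps_euler t ^ v * fps_euler (3 * t) ^ b"
    unfolding l1 l2 r1 r2 .
  moreover have "fps_map eval_omega (q_product F) = q_product ?C"
    by (rule evalw.fps_map_q_product[OF one])
  ultimately show ?thesis by simp
qed

text \<open>With Y = q ^ (t n), each of the b pairs in P contributes (1 - Y ^ 3) / (1 - Y), and the
  reciprocal contributes (1 - q ^ n) / (1 - q ^ (3 n)). The net exponent a - b of 1 - Y equals v -
  1, which is negative for v = 0; hence the form Suc a = b + v.\<close>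

lemma eval_omega_factor:
  fixes P :: "laurent fps"
  assumes n: "n \<ge> 1" and P: "fps_map eval_omega P * (1 - fps_X ^ (t * n)) ^ b = (1 - fps_X ^ (3 * t * n)) ^ b"
    and ab: "Suc a = b + v" and t: "t > 0"
  shows "fps_map eval_omega ((1 - fps_X ^ n) * (1 - fps_X ^ (t * n)) ^ a * P * fps_recip (pm 1 n)) *
      (1 - fps_X ^ (3 * n)) * (1 - fps_X ^ (t * n)) =
      (1 - fps_X ^ n)\<^sup>2 * (1 - fps_X ^ (t * n)) ^ v * (1 - fps_X ^ (3 * t * n)) ^ b"
proof -
  define y Y Z :: "complex fps" where "y = 1 - fps_X ^ n" and "Y = 1 - fps_X ^ (t * n)" and "Z = 1 - fps_X ^ (3 * t * n)"
  define S where "S = fps_map eval_omega (pm 1 n)"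
  define R where "R = fps_map eval_omega P"
  have p0: "fps_nth (pm 1 n) 0 = 1" using one_mod_q_nth[OF one_mod_q_pm[OF order_refl, of n 1], of 0] n by simp
  have rec: "fps_map eval_omega (fps_recip (pm 1 n)) = fps_recip S"
    unfolding S_def by (rule evalw.fps_map_recip[OF p0])
  have SS: "S * fps_recip S = 1" by (rule fps_right_inverse) (simp add: S_def p0)
  have Sy: "S * y = 1 - fps_X ^ (3 * n)" unfolding S_def y_def by (rule evalw_pm) simp
  have "fps_map eval_omega ((1 - fps_X ^ n) * (1 - fps_X ^ (t * n)) ^ a * P * fps_recip (pm 1 n)) *
      (1 - fps_X ^ (3 * n)) * (1 - fps_X ^ (t * n)) = y * Y ^ a * R * fps_recip S * (S * y) * Y"
    unfolding evalw.fps_map_mult rec Sy[symmetric]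
    by (simp only: evalw.fps_map_diff evalw.fps_map_power evalw.fps_map_1 evalw.fps_map_X R_def Y_def y_def)
  also have "\<dots> = (S * fps_recip S) * y\<^sup>2 * Y ^ Suc a * R" by (simp add: power2_eq_square mult_ac)
  also have "\<dots> = y\<^sup>2 * Y ^ v * (R * Y ^ b)" unfolding SS ab by (simp add: power_add mult_ac)
  also have "R * Y ^ b = Z ^ b" using P by (simp add: R_def Y_def Z_def)
  finally show ?thesis by (simp add: y_def Y_def Z_def)
qed

section \<open>The quotients attached to cores\<close>

text \<open>Brings every Euler product to the common base x ^ n, so that different ones can be
  compared factor by factor; exponents 0 and 1 keep the index set the same for all d.\<close>

lemma qpoch_power_dissect:
  assumes x: "norm x < 1" and d: "d dvd n" "n > 0"
  shows "qpoch (x ^ d) (x ^ d) = (\<Prod>k=1..n. qpoch (x ^ k) (x ^ n) ^ (if d dvd k then 1 else 0))"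
proof -
  obtain c where n: "n = d * c" using d(1) by blast
  have c: "c > 0" "d > 0" using n d(2) by simp_all
  have "qpoch (x ^ d) (x ^ d) = (\<Prod>i<c. qpoch (x ^ d * (x ^ d) ^ i) ((x ^ d) ^ c))"
    by (rule qpoch_dissect) (use x c norm_power_less_one in auto)
  also have "\<dots> = (\<Prod>i<c. qpoch (x ^ (d * Suc i)) (x ^ n))"
    by (simp add: n power_add power_mult)
  also have "\<dots> = (\<Prod>k\<in>{k\<in>{1..n}. d dvd k}. qpoch (x ^ k) (x ^ n))"
  proof (rule prod.reindex_bij_witness[of _ "\<lambda>k. k div d - 1" "\<lambda>i. d * Suc i"])
    fix i assume "i \<in> {..<c}"
    then have "d * Suc i \<le> d * c" by (intro mult_le_mono2) simp
    then show "d * Suc i \<in> {k \<in> {1..n}. d dvd k}" using c n by (simp del: mult_Suc_right)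
  next
    fix k assume "k \<in> {k \<in> {1..n}. d dvd k}"
    then obtain j where j: "k = d * j" "1 \<le> d * j" "d * j \<le> d * c" using n by auto
    have "j \<ge> 1" using j(2) by (cases j) auto
    moreover have "j \<le> c" using j(3) c by simp
    moreover have "k div d = j" using j(1) c by simp
    ultimately show "d * Suc (k div d - 1) = k" "k div d - 1 \<in> {..<c}" using j(1) by auto
  qed (use c in auto)
  also have "\<dots> = (\<Prod>k=1..n. if d dvd k then qpoch (x ^ k) (x ^ n) else 1)"
    by (rule prod.inter_filter) simp
  also have "\<dots> = (\<Prod>k=1..n. qpoch (x ^ k) (x ^ n) ^ (if d dvd k then 1 else 0))"
    by (intro prod.cong refl) simp
  finally show ?thesis .
qed

text \<open>U is a series in q ^ n, so a coefficient of X * U involves only coefficients of X in the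
  same residue class.\<close>

lemma class_mult_vanish:
  fixes X U :: "'a :: comm_ring_1 fps"
  assumes U: "\<And>i. \<not> n dvd i \<Longrightarrow> fps_nth U i = 0"
    and X: "\<And>m. m < B \<Longrightarrow> m mod n = r \<Longrightarrow> fps_nth X m = 0"
    and m: "m < B" "m mod n = r"
  shows "fps_nth (X * U) m = 0"
proof -
  have "fps_nth X i * fps_nth U (m - i) = 0" if "i \<le> m" for i
  proof (cases "n dvd m - i")
    case True
    then have "i mod n = r" using that m by (metis mod_eq_dvd_iff_nat)
    then show ?thesis using X[of i] that m by simp
  qed (simp add: U)
  then show ?thesis by (simp add: fps_mult_nth)
qed

text \<open>The converse of \<open>class_mult_vanish\<close>, by recursion on m: as U starts with 1,
  the coefficient of X at m is determined by earlier ones in its class.\<close>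

lemma class_cancel_vanish:
  fixes X U :: "'a :: comm_ring_1 fps"
  assumes U: "\<And>i. \<not> n dvd i \<Longrightarrow> fps_nth U i = 0" and U0: "fps_nth U 0 = 1"
    and X: "\<And>m. m < B \<Longrightarrow> m mod n = r \<Longrightarrow> fps_nth (X * U) m = 0"
  shows "m < B \<Longrightarrow> m mod n = r \<Longrightarrow> fps_nth X m = 0"
proof (induction m rule: less_induct)
  case (less m)
  have "fps_nth X i * fps_nth U (m - i) = 0" if "i < m" for i
  proof (cases "n dvd m - i")
    case True
    then have "i mod n = r" using that less.prems by (metis mod_eq_dvd_iff_nat less_imp_le)
    then show ?thesis using less that by simp
  qed (simp add: U)
  then have "fps_nth (X * U) m = fps_nth X m"
    by (simp add: fps_mult_nth atLeast0AtMost lessThan_Suc_atMost[symmetric] U0)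
  then show ?case using X less.prems by simp
qed

lemma fps_power_support:
  fixes U :: "'a :: comm_ring_1 fps"
  assumes "\<And>i. \<not> n dvd i \<Longrightarrow> fps_nth U i = 0"
  shows "\<not> n dvd i \<Longrightarrow> fps_nth (U ^ k) i = 0"
proof (induction k arbitrary: i)
  case 0
  then show ?case by (cases "i = 0") auto
next
  case (Suc k)
  have "fps_nth U j * fps_nth (U ^ k) (i - j) = 0" if "j \<le> i" for j
  proof (cases "n dvd j")
    case True
    then have "\<not> n dvd i - j" using Suc.prems that by (metis dvd_diffD)
    then show ?thesis using Suc.IH by simp
  qed (simp add: assms)
  then show ?case by (simp add: fps_mult_nth)
qed

lemma fps_euler_support:
  assumes d: "d > 0" and i: "\<not> d dvd i"
  shows "fps_nth (fps_euler d :: 'a :: idom fps) i = 0"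
proof -
  have "fps_nth (fps_euler d * 1 :: 'a fps) i = 0"
  proof -
    have "i \<noteq> d * x" for x using i by auto
    moreover have "i \<noteq> 0" using i by (metis dvd_0_right)
    ultimately show ?thesis unfolding fps_euler_nth[OF d] by (auto intro!: sum.neutral simp: le_less)
  qed
  then show ?thesis by simp
qed

lemma fps_euler_nth_0 [simp]:
  assumes "d > 0"
  shows "fps_nth (fps_euler d :: 'a :: idom fps) 0 = 1"
  using fps_euler_nth[OF assms, of "1 :: 'a fps" 0] by simp

text \<open>With \<open>w = v + 1\<close>, these exponents make \<open>Q\<close> the product in \<open>Q_fps_identity\<close> below.\<close>

definition expo :: "nat \<Rightarrow> nat \<Rightarrow> nat \<Rightarrow> nat" where
  "expo t w g = (if 3 dvd g then 1 else if t dvd g then w else 2)"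

locale core_product =
  fixes t v :: nat
  assumes t: "prime t" "t > 3"
    and core_level: "3 * t dvd 2 * (\<Sum>j=1..(3 * t - 1) div 2. expo t (Suc v) (gcd j (3 * t)) * j\<^sup>2)"
begin

lemma odd_t: "odd t" using t prime_odd_nat by auto

sublocale siegel_product "3 * t" "expo t (Suc v)"
  by unfold_locales (use odd_t t core_level in auto)

lemma coprime_3_t: "coprime 3 t"
proof -
  have "\<not> t dvd 3" using t dvd_imp_le[of t 3] by auto
  then have "coprime t 3" by (rule prime_imp_coprime[OF t(1)])
  then show ?thesis by (rule coprime_commute[THEN iffD1])
qed

lemma Q_euler_identity:
  assumes x: "norm x < 1"
  shows "Q x * qpoch (x ^ 3) (x ^ 3) * qpoch (x ^ t) (x ^ t) * qpoch (x ^ (3 * t)) (x ^ (3 * t)) ^ v =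
    qpoch x x ^ 2 * qpoch (x ^ t) (x ^ t) ^ v"
proof -
  define f where "f k = qpoch (x ^ k) (x ^ (3 * t))" for k
  have t0: "3 * t > 0" using t by simp
  note dis = qpoch_power_dissect[OF x _ t0, folded f_def]
  have d1: "qpoch x x = (\<Prod>k=1..3 * t. f k)" using dis[of 1] by simp
  have iv: "{1..3 * t} = insert (3 * t) {1..<3 * t}" using t by auto
  have Q: "Q x = (\<Prod>k=1..3 * t. f k ^ (if k = 3 * t then 0 else expo t (Suc v) (gcd k (3 * t))))"
    unfolding Q_def f_def[symmetric] iv by (subst prod.insert) (auto intro!: prod.cong)
  \<comment> \<open>Both sides of the identity have the same exponent at each k. At k = 3 t the
    product \<open>Q\<close> has no factor, and the three Euler products supply 1 + 1 + v.\<close>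
  have "(if k = 3 * t then 0 else expo t (Suc v) (gcd k (3 * t))) + (if 3 dvd k then 1 else 0) +
      (if t dvd k then 1 else 0) + (if 3 * t dvd k then 1 else 0) * v = 2 + (if t dvd k then 1 else 0) * v"
    if k: "k \<in> {1..3 * t}" for k
  proof -
    have a: "3 * t dvd k \<longleftrightarrow> 3 dvd k \<and> t dvd k" using coprime_3_t
      by (metis divides_mult dvd_mult_left dvd_mult_right)
    have b: "3 * t dvd k \<longleftrightarrow> k = 3 * t" using k by (auto dest: dvd_imp_le)
    show ?thesis unfolding expo_def using a b by auto
  qed
  then have "(\<Prod>k=1..3 * t. f k ^ ((if k = 3 * t then 0 else expo t (Suc v) (gcd k (3 * t))) + (if 3 dvd k then 1 else 0) +
      (if t dvd k then 1 else 0) + (if 3 * t dvd k then 1 else 0) * v)) =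
      (\<Prod>k=1..3 * t. f k ^ (2 + (if t dvd k then 1 else 0) * v))"
    by (intro prod.cong refl arg_cong2[of _ _ _ _ "(^)"])
  from this[unfolded power_add power_mult[of _ _ v] prod.distrib prod_power_distrib[symmetric],
      folded Q d1 dis[of 3, OF dvd_triv_left] dis[of t, OF dvd_triv_right] dis[of "3 * t", OF dvd_refl]]
  show ?thesis .
qed

lemma Q_fps_identity:
  "fps_expansion Q 0 * fps_euler 3 * fps_euler t * fps_euler (3 * t) ^ v = fps_euler 1 ^ 2 * fps_euler t ^ v"
proof (rule fps_expansion_unique_complex)
  have t0: "t > 0" using t by simp
  have e1: "(\<lambda>x. qpoch x x) has_fps_expansion fps_euler 1" using has_fps_expansion_euler[of 1] by simp
  have "Q has_fps_expansion fps_expansion Q 0"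
    by (rule has_fps_expansion_fps_expansion[OF _ _ Q_holomorphic]) auto
  then show "(\<lambda>x. Q x * qpoch (x ^ 3) (x ^ 3) * qpoch (x ^ t) (x ^ t) * qpoch (x ^ (3 * t)) (x ^ (3 * t)) ^ v)
    has_fps_expansion fps_expansion Q 0 * fps_euler 3 * fps_euler t * fps_euler (3 * t) ^ v"
    using t0 by (intro fps_expansion_intros has_fps_expansion_euler) auto
  have "(\<lambda>x. qpoch x x ^ 2 * qpoch (x ^ t) (x ^ t) ^ v) has_fps_expansion fps_euler 1 ^ 2 * fps_euler t ^ v"
    using t0 by (intro fps_expansion_intros has_fps_expansion_euler e1) auto
  note E = this
  have ev: "\<forall>\<^sub>F x in nhds 0. qpoch x x ^ 2 * qpoch (x ^ t) (x ^ t) ^ v =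
      Q x * qpoch (x ^ 3) (x ^ 3) * qpoch (x ^ t) (x ^ t) * qpoch (x ^ (3 * t)) (x ^ (3 * t)) ^ v"
    using Q_euler_identity by (intro eventually_nhds_in_open[of "ball 0 1", THEN eventually_mono]) auto
  show "(\<lambda>x. Q x * qpoch (x ^ 3) (x ^ 3) * qpoch (x ^ t) (x ^ t) * qpoch (x ^ (3 * t)) (x ^ (3 * t)) ^ v)
    has_fps_expansion fps_euler 1 ^ 2 * fps_euler t ^ v"
    by (rule has_fps_expansion_cong[THEN iffD1, OF ev refl E])
qed

text \<open>Inclusion and exclusion: of the 9 t ^ 2 pairs, the t ^ 2 with both entries divisible by
  3 and the 9 with both divisible by t are removed, and (0, 0) belongs to both kinds.\<close>

lemma card_vecs_le: "card vecs \<le> 8 * (t\<^sup>2 - 1)"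
proof -
  define S where "S = {0..<int (3 * t)} \<times> {0..<int (3 * t)}"
  define A where "A = (\<lambda>(i, j). (3 * i, 3 * j)) ` ({0..<int t} \<times> {0..<int t})"
  define B where "B = (\<lambda>(i, j). (int t * i, int t * j)) ` ({0..<3} \<times> {0..<3 :: int})"
  have t0: "t > 0" using t by simp
  have cA: "card A = t * t" unfolding A_def
    by (subst card_image) (auto simp: inj_on_def)
  have cB: "card B = 9" unfolding B_def
    by (subst card_image) (use t0 in \<open>auto simp: inj_on_def\<close>)
  have fin: "finite A" "finite B" "finite S" by (simp_all add: A_def B_def S_def)
  have AB: "A \<inter> B \<subseteq> {(0, 0)}"
  proof clarify
    fix x y assume xy: "(x, y) \<in> A" "(x, y) \<in> B"
    obtain i j where ij: "x = 3 * i" "y = 3 * j" "0 \<le> i" "i < int t" "0 \<le> j" "j < int t"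
      using xy(1) by (auto simp: A_def)
    obtain k l where kl: "x = int t * k" "y = int t * l" using xy(2) by (auto simp: B_def)
    have cop: "coprime (int t) 3" using coprime_3_t by (metis coprime_commute coprime_int_iff of_nat_numeral)
    have "int t dvd 3 * i" "int t dvd 3 * j" using ij(1,2) kl by (metis dvd_triv_left)+
    then have "int t dvd i" "int t dvd j" using cop by (simp_all add: coprime_dvd_mult_right_iff)
    then have "i = 0" "j = 0" using ij zdvd_not_zless[of i "int t"] zdvd_not_zless[of j "int t"] by force+
    then show "x = 0 \<and> y = 0" using ij by simp
  qed
  then have "card (A \<inter> B) \<le> 1" using card_mono[of "{(0 :: int, 0 :: int)}" "A \<inter> B"] by simp
  then have cAB: "card (A \<union> B) \<ge> t * t + 8" using card_Un_Int[OF fin(1,2)] cA cB by simp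
  have ABS: "A \<union> B \<subseteq> S" using t0 by (auto simp: A_def B_def S_def) 
  have "vecs \<subseteq> S - (A \<union> B)"
  proof clarify
    fix x y assume v: "(x, y) \<in> vecs"
    then have u: "gcd (gcd x y) (int (3 * t)) = 1" by (simp add: vecs_def unimod_def)
    have "\<not> (3 dvd x \<and> 3 dvd y)"
    proof
      assume "3 dvd x \<and> 3 dvd y"
      then have "3 dvd gcd (gcd x y) (int (3 * t))" by simp
      then show False unfolding u by simp
    qed
    moreover have "\<not> (int t dvd x \<and> int t dvd y)"
    proof
      assume "int t dvd x \<and> int t dvd y"
      then have "int t dvd gcd (gcd x y) (int (3 * t))" by simp
      then show False unfolding u using t by simp
    qed
    ultimately show "(x, y) \<in> S - (A \<union> B)" using v by (auto simp: vecs_def S_def A_def B_def)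
  qed
  then have "card vecs \<le> card (S - (A \<union> B))" using fin by (intro card_mono) auto
  also have "\<dots> = card S - card (A \<union> B)" using fin ABS by (intro card_Diff_subset) auto
  also have "\<dots> \<le> 3 * t * (3 * t) - (t * t + 8)" proof -
    have "card S = 3 * t * (3 * t)" by (simp add: S_def nat_mult_distrib)
    then show ?thesis using cAB by (simp only: diff_le_mono2)
  qed
  also have "\<dots> = 8 * (t\<^sup>2 - 1)" by (simp add: power2_eq_square algebra_simps)
  finally show ?thesis .
qed

lemma card_units: "card {d \<in> {1..<3 * t}. coprime d (3 * t)} = 2 * (t - 1)"
proof -
  have "{d \<in> {1..<3 * t}. coprime d (3 * t)} = totatives (3 * t)"
    using t by (auto simp: totatives_def le_less)
  moreover have "totient (3 * t) = totient 3 * totient t"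
    by (rule totient_mult_coprime[OF coprime_3_t])
  moreover have "totient 3 = 2" by (subst totient_prime) auto
  ultimately show ?thesis using totient_prime[OF t(1)] by (simp add: totient_def)
qed

end

section \<open>Tables of coefficients\<close>

text \<open>Unfolds into one equation per entry, so that a proved table can be reused as a family of
  rewrite rules.\<close>

primrec tabulates :: "(int \<Rightarrow> int) \<Rightarrow> int \<Rightarrow> int list \<Rightarrow> bool" where
  "tabulates f i [] \<longleftrightarrow> True"
| "tabulates f i (x # xs) \<longleftrightarrow> f i = x \<and> tabulates f (i + 1) xs"

lemma tabulates_append:
  "tabulates f i (xs @ ys) \<longleftrightarrow> tabulates f i xs \<and> tabulates f (i + int (length xs)) ys"
  by (induction xs arbitrary: i) (simp_all add: add_ac)

lemma tabulates_nth: "tabulates f i xs \<Longrightarrow> k < length xs \<Longrightarrow> f (i + int k) = xs ! k"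
proof (induction xs arbitrary: i k)
  case (Cons x xs)
  then show ?case by (cases k) (auto simp: add.assoc dest!: Cons.IH[of "i + 1"])
qed simp

definition entry :: "int list \<Rightarrow> int \<Rightarrow> int" where "entry xs i = xs ! nat i"

lemma tabulates_entry: "xs = ys \<Longrightarrow> tabulates (entry xs) 0 ys"
proof -
  have "tabulates (\<lambda>i. (zs @ ys) ! nat i) (int (length zs)) ys" for zs
  proof (induction ys arbitrary: zs)
    case (Cons y ys)
    show ?case using Cons[of "zs @ [y]"] by (simp add: nth_append add.commute)
  qed simp
  from this[of "[]"] show "xs = ys \<Longrightarrow> tabulates (entry xs) 0 ys" by (simp add: entry_def[abs_def])
qed

lemma int_length_simps: "int (length []) = 0" "int (length (x # xs)) = int (length xs) + 1"
  by simp_all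

lemmas arith_eval = arith_simps arith_special diff_numeral_special rel_simps if_True if_False simp_thms numeral_One
  Num.inc.simps
  mult_1_left mult_1_right add_0_left add_0_right diff_0 diff_0_right minus_minus minus_zero

lemmas table_eval = tabulates.simps tabulates_append int_length_simps arith_eval

lemma division_unique:
  assumes d: "d > 0"
    and f: "\<And>m. f m = num m + pent_sum d f (m - d) d"
    and g: "\<And>m. 0 \<le> m \<Longrightarrow> m < N \<Longrightarrow> g m = num m + pent_sum d g (m - d) d"
  shows "0 \<le> m \<Longrightarrow> m < N \<Longrightarrow> f m = g m"
proof (induction "nat m" arbitrary: m rule: less_induct)
  case less
  have "pent_sum d f (m - d) d = pent_sum d g (m - d) d"
    by (rule pent_sum_cong) (use d less in auto)
  then show ?case using f[of m] g[of m] less.prems by simp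
qed

text \<open>The quotient by Euler's product satisfies the recursion \<open>f\<close>, which has one
  solution. A list that satisfies it with its own entries on the right-hand side is therefore the
  list of coefficients.\<close>

lemma division_table:
  assumes d: "d > 0"
    and f: "\<And>m. f m = num m + pent_sum d f (m - d) d"
    and tab: "tabulates (\<lambda>m. num m + pent_sum d (entry xs) (m - d) d) 0 xs"
  shows "tabulates f 0 xs"
proof -
  have g: "entry xs m = num m + pent_sum d (entry xs) (m - d) d" if "0 \<le> m" "m < int (length xs)" for m
    using tabulates_nth[OF tab, of "nat m"] that by (simp add: entry_def nat_less_iff)
  have e: "f m = entry xs m" if "0 \<le> m" "m < int (length xs)" for m
    by (rule division_unique[OF d f g that])
  have "tabulates f (int i) ys \<longleftrightarrow> tabulates (entry xs) (int i) ys" if "i + length ys \<le> length xs" for i ys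
    using that
  proof (induction ys arbitrary: i)
    case (Cons y ys)
    then show ?case using Cons.IH[of "Suc i"] e[of "int i"] by (simp add: add.commute)
  qed simp
  from this[of 0 xs] show ?thesis using tabulates_entry[OF refl, of xs] by simp
qed

definition pent_coef :: "int \<Rightarrow> int" where "pent_coef = coef (fps_euler 1)"

definition square_coef :: "int \<Rightarrow> int" where "square_coef = coef (fps_euler 1 * fps_euler 1)"

definition delta :: "int \<Rightarrow> int" where "delta m = (if m = 0 then 1 else 0)"

lemma pent_coef_eq: "pent_coef m = delta m - pent_sum 1 delta (m - 1) 1"
proof -
  have "coef 1 = delta" by (rule ext) (simp add: coef_def delta_def)
  then show ?thesis using coef_euler_mult[of 1 1 m] by (simp add: pent_coef_def)
qed

lemma square_coef_eq: "square_coef m = pent_coef m - pent_sum 1 pent_coef (m - 1) 1"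
  using coef_euler_mult[of 1 "fps_euler 1" m] by (simp add: pent_coef_def square_coef_def)

text \<open>This table and the next one have to reach q ^ 1505, the last exponent below the bound
  1506 for t = 19.\<close>

definition pent_list :: "int list" where
  "pent_list =
     [1, -1, -1, 0, 0, 1, 0, 1, 0, 0, 0, 0, -1, 0, 0, -1, 0, 0, 0, 0, 0, 0, 1, 0, 0, 0, 1, 0, 0, 0,
     0, 0, 0, 0, 0, -1, 0, 0, 0, 0, -1, 0, 0, 0, 0, 0, 0, 0, 0, 0, 0, 1, 0, 0, 0, 0, 0, 1, 0, 0, 0,
     0, 0, 0, 0, 0, 0, 0, 0, 0, -1, 0, 0, 0, 0, 0, 0, -1, 0, 0, 0, 0, 0, 0, 0, 0, 0, 0, 0, 0, 0, 0,
     1, 0, 0, 0, 0, 0, 0, 0] @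
     [1, 0, 0, 0, 0, 0, 0, 0, 0, 0, 0, 0, 0, 0, 0, 0, 0, -1, 0, 0, 0, 0, 0, 0, 0, 0, -1, 0, 0, 0, 0,
     0, 0, 0, 0, 0, 0, 0, 0, 0, 0, 0, 0, 0, 0, 1, 0, 0, 0, 0, 0, 0, 0, 0, 0, 1, 0, 0, 0, 0, 0, 0, 0,
     0, 0, 0, 0, 0, 0, 0, 0, 0, 0, 0, 0, 0, -1, 0, 0, 0, 0, 0, 0, 0, 0, 0, 0, -1, 0, 0, 0, 0, 0, 0,
     0, 0, 0, 0, 0, 0] @
     [0, 0, 0, 0, 0, 0, 0, 0, 0, 0, 1, 0, 0, 0, 0, 0, 0, 0, 0, 0, 0, 0, 1, 0, 0, 0, 0, 0, 0, 0, 0, 0,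
     0, 0, 0, 0, 0, 0, 0, 0, 0, 0, 0, 0, 0, 0, 0, -1, 0, 0, 0, 0, 0, 0, 0, 0, 0, 0, 0, 0, -1, 0, 0,
     0, 0, 0, 0, 0, 0, 0, 0, 0, 0, 0, 0, 0, 0, 0, 0, 0, 0, 0, 0, 0, 0, 0, 0, 1, 0, 0, 0, 0, 0, 0, 0,
     0, 0, 0, 0, 0] @
     [0, 1, 0, 0, 0, 0, 0, 0, 0, 0, 0, 0, 0, 0, 0, 0, 0, 0, 0, 0, 0, 0, 0, 0, 0, 0, 0, 0, 0, 0, -1,
     0, 0, 0, 0, 0, 0, 0, 0, 0, 0, 0, 0, 0, 0, -1, 0, 0, 0, 0, 0, 0, 0, 0, 0, 0, 0, 0, 0, 0, 0, 0, 0,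
     0, 0, 0, 0, 0, 0, 0, 0, 0, 0, 0, 0, 0, 1, 0, 0, 0, 0, 0, 0, 0, 0, 0, 0, 0, 0, 0, 0, 0, 1, 0, 0,
     0, 0, 0, 0, 0] @
     [0, 0, 0, 0, 0, 0, 0, 0, 0, 0, 0, 0, 0, 0, 0, 0, 0, 0, 0, 0, 0, 0, 0, 0, 0, -1, 0, 0, 0, 0, 0,
     0, 0, 0, 0, 0, 0, 0, 0, 0, 0, 0, -1, 0, 0, 0, 0, 0, 0, 0, 0, 0, 0, 0, 0, 0, 0, 0, 0, 0, 0, 0, 0,
     0, 0, 0, 0, 0, 0, 0, 0, 0, 0, 0, 0, 0, 0, 1, 0, 0, 0, 0, 0, 0, 0, 0, 0, 0, 0, 0, 0, 0, 0, 0, 0,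
     1, 0, 0, 0, 0] @
     [0, 0, 0, 0, 0, 0, 0, 0, 0, 0, 0, 0, 0, 0, 0, 0, 0, 0, 0, 0, 0, 0, 0, 0, 0, 0, 0, 0, 0, 0, 0, 0,
     -1, 0, 0, 0, 0, 0, 0, 0, 0, 0, 0, 0, 0, 0, 0, 0, 0, 0, 0, -1, 0, 0, 0, 0, 0, 0, 0, 0, 0, 0, 0,
     0, 0, 0, 0, 0, 0, 0, 0, 0, 0, 0, 0, 0, 0, 0, 0, 0, 0, 0, 0, 0, 0, 0, 0, 0, 0, 0, 1, 0, 0, 0, 0,
     0, 0, 0, 0, 0] @
     [0, 0, 0, 0, 0, 0, 0, 0, 0, 0, 1, 0, 0, 0, 0, 0, 0, 0, 0, 0, 0, 0, 0, 0, 0, 0, 0, 0, 0, 0, 0, 0,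
     0, 0, 0, 0, 0, 0, 0, 0, 0, 0, 0, 0, 0, 0, 0, 0, 0, 0, 0, -1, 0, 0, 0, 0, 0, 0, 0, 0, 0, 0, 0, 0,
     0, 0, 0, 0, 0, 0, 0, 0, -1, 0, 0, 0, 0, 0, 0, 0, 0, 0, 0, 0, 0, 0, 0, 0, 0, 0, 0, 0, 0, 0, 0, 0,
     0, 0, 0, 0] @
     [0, 0, 0, 0, 0, 0, 0, 0, 0, 0, 0, 0, 0, 0, 0, 1, 0, 0, 0, 0, 0, 0, 0, 0, 0, 0, 0, 0, 0, 0, 0, 0,
     0, 0, 0, 0, 0, 1, 0, 0, 0, 0, 0, 0, 0, 0, 0, 0, 0, 0, 0, 0, 0, 0, 0, 0, 0, 0, 0, 0, 0, 0, 0, 0,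
     0, 0, 0, 0, 0, 0, 0, 0, 0, 0, 0, 0, 0, 0, 0, 0, 0, 0, -1, 0, 0, 0, 0, 0, 0, 0, 0, 0, 0, 0, 0, 0,
     0, 0, 0, 0] @
     [0, 0, 0, 0, 0, -1, 0, 0, 0, 0, 0, 0, 0, 0, 0, 0, 0, 0, 0, 0, 0, 0, 0, 0, 0, 0, 0, 0, 0, 0, 0,
     0, 0, 0, 0, 0, 0, 0, 0, 0, 0, 0, 0, 0, 0, 0, 0, 0, 0, 0, 0, 0, 1, 0, 0, 0, 0, 0, 0, 0, 0, 0, 0,
     0, 0, 0, 0, 0, 0, 0, 0, 0, 0, 0, 0, 0, 1, 0, 0, 0, 0, 0, 0, 0, 0, 0, 0, 0, 0, 0, 0, 0, 0, 0, 0,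
     0, 0, 0, 0, 0] @
     [0, 0, 0, 0, 0, 0, 0, 0, 0, 0, 0, 0, 0, 0, 0, 0, 0, 0, 0, 0, 0, 0, 0, 0, 0, -1, 0, 0, 0, 0, 0,
     0, 0, 0, 0, 0, 0, 0, 0, 0, 0, 0, 0, 0, 0, 0, 0, 0, 0, 0, -1, 0, 0, 0, 0, 0, 0, 0, 0, 0, 0, 0, 0,
     0, 0, 0, 0, 0, 0, 0, 0, 0, 0, 0, 0, 0, 0, 0, 0, 0, 0, 0, 0, 0, 0, 0, 0, 0, 0, 0, 0, 0, 0, 0, 0,
     0, 0, 0, 0, 0] @
     [0, 1, 0, 0, 0, 0, 0, 0, 0, 0, 0, 0, 0, 0, 0, 0, 0, 0, 0, 0, 0, 0, 0, 0, 0, 0, 0, 1, 0, 0, 0, 0,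
     0, 0, 0, 0, 0, 0, 0, 0, 0, 0, 0, 0, 0, 0, 0, 0, 0, 0, 0, 0, 0, 0, 0, 0, 0, 0, 0, 0, 0, 0, 0, 0,
     0, 0, 0, 0, 0, 0, 0, 0, 0, 0, 0, 0, 0, 0, 0, 0, -1, 0, 0, 0, 0, 0, 0, 0, 0, 0, 0, 0, 0, 0, 0, 0,
     0, 0, 0, 0] @
     [0, 0, 0, 0, 0, 0, 0, -1, 0, 0, 0, 0, 0, 0, 0, 0, 0, 0, 0, 0, 0, 0, 0, 0, 0, 0, 0, 0, 0, 0, 0,
     0, 0, 0, 0, 0, 0, 0, 0, 0, 0, 0, 0, 0, 0, 0, 0, 0, 0, 0, 0, 0, 0, 0, 0, 0, 0, 0, 0, 0, 0, 0, 1,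
     0, 0, 0, 0, 0, 0, 0, 0, 0, 0, 0, 0, 0, 0, 0, 0, 0, 0, 0, 0, 0, 0, 0, 0, 0, 0, 0, 1, 0, 0, 0, 0,
     0, 0, 0, 0, 0] @
     [0, 0, 0, 0, 0, 0, 0, 0, 0, 0, 0, 0, 0, 0, 0, 0, 0, 0, 0, 0, 0, 0, 0, 0, 0, 0, 0, 0, 0, 0, 0, 0,
     0, 0, 0, 0, 0, 0, 0, 0, 0, 0, 0, 0, 0, 0, 0, -1, 0, 0, 0, 0, 0, 0, 0, 0, 0, 0, 0, 0, 0, 0, 0, 0,
     0, 0, 0, 0, 0, 0, 0, 0, 0, 0, 0, 0, -1, 0, 0, 0, 0, 0, 0, 0, 0, 0, 0, 0, 0, 0, 0, 0, 0, 0, 0, 0,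
     0, 0, 0, 0] @
     [0, 0, 0, 0, 0, 0, 0, 0, 0, 0, 0, 0, 0, 0, 0, 0, 0, 0, 0, 0, 0, 0, 0, 0, 0, 0, 0, 0, 0, 0, 0, 0,
     0, 0, 0, 1, 0, 0, 0, 0, 0, 0, 0, 0, 0, 0, 0, 0, 0, 0, 0, 0, 0, 0, 0, 0, 0, 0, 0, 0, 0, 0, 0, 0,
     0, 1, 0, 0, 0, 0, 0, 0, 0, 0, 0, 0, 0, 0, 0, 0, 0, 0, 0, 0, 0, 0, 0, 0, 0, 0, 0, 0, 0, 0, 0, 0,
     0, 0, 0, 0] @
     [0, 0, 0, 0, 0, 0, 0, 0, 0, 0, 0, 0, 0, 0, 0, 0, 0, 0, 0, 0, 0, 0, 0, 0, 0, 0, -1, 0, 0, 0, 0,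
     0, 0, 0, 0, 0, 0, 0, 0, 0, 0, 0, 0, 0, 0, 0, 0, 0, 0, 0, 0, 0, 0, 0, 0, 0, 0, -1, 0, 0, 0, 0, 0,
     0, 0, 0, 0, 0, 0, 0, 0, 0, 0, 0, 0, 0, 0, 0, 0, 0, 0, 0, 0, 0, 0, 0, 0, 0, 0, 0, 0, 0, 0, 0, 0,
     0, 0, 0, 0, 0] @
     [0, 0, 0, 0, 0, 0]"

definition square_list :: "int list" where
  "square_list =
     [1, -2, -1, 2, 1, 2, -2, 0, -2, -2, 1, 0, 0, 2, 3, -2, 2, 0, 0, -2, -2, 0, 0, -2, -1, 0, 2, 2,
     -2, 2, 1, 2, 0, 2, -2, -2, 2, 0, -2, 0, -4, 0, 0, 0, 1, -2, 0, 0, 2, 0, 2, 2, 1, -2, 0, 2, 2, 0,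
     0, -2, 0, -2, 0, -2, 2, 0, -4, 0, 0, -2, -1, 2, 0, 2, 0, 0, 0, -2, 2, 4, 1, 0, 0, 2, -2, 2, -2,
     0, 0, 2, 0, -2, 0, -2, -2, 0, -2, 0, 0, 0] @
     [2, -2, -1, -2, -2, 4, 0, 0, 2, 0, 2, 0, 0, 0, 3, -2, 0, 0, 4, 2, 0, -2, 0, 0, -2, 0, 0, -2, 0,
     2, 0, -2, 0, -2, -2, -2, 0, 0, 2, -2, -1, 2, 0, 0, 0, 2, -2, 0, -2, 2, 2, 2, 2, 0, 1, 2, -2, 0,
     0, 0, 0, 2, 0, 0, 0, 0, 2, 0, -2, -2, -4, 2, 0, 0, -2, 0, -2, 0, 2, 0, -2, 0, 0, -4, 1, -2, 0,
     0, 4, 2, -2, 2, 0, 0, 0, -2, 4, 0, -2, 2] @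
     [1, 0, 2, 2, 0, 0, 2, 0, 0, -4, 2, 0, 0, -2, 0, 0, 2, 0, -2, 0, 0, 0, 0, -2, -2, -4, -2, 2, 0,
     2, 0, 0, 0, -2, -1, 0, 2, 0, -2, 0, 0, 0, 0, 2, 0, 0, 2, 0, 4, 2, -2, 0, -1, 2, -2, 2, 0, 0, 0,
     2, -2, 4, 0, 0, 2, -2, 0, 0, -2, -2, 0, -2, 0, 0, 0, 2, -2, 0, 0, 0, -2, -2, 0, 0, 0, 0, -2, 0,
     -2, -2, 1, 0, 0, 2, 2, 2, 0, 0, -2, -4] @
     [4, 2, 0, -2, 0, 0, 2, 0, 2, 2, 3, -2, 0, 2, 2, 0, -2, 0, 0, 0, 0, -2, 0, 2, 2, 0, 0, -2, 0, 0,
     0, 0, 0, 0, 0, -2, -4, 0, 2, -4, 0, -2, 0, 0, 2, 0, 2, 0, -2, 0, -2, 0, -3, 0, 0, 2, -2, 0, 2,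
     0, 0, 0, 0, 2, 0, 4, 0, 0, 0, 0, 2, -4, 0, 2, 1, 0, 2, 2, -4, 2, 2, 0, 0, 2, 0, 2, 0, 0, -2, 0,
     0, -2, 0, 0, -2, 0, -2, 0, 0, 2] @
     [2, 2, -2, 0, -4, -2, 0, 0, 0, -2, 0, -2, 0, -2, 2, 0, -2, 0, 0, 0, 1, 0, 0, 2, 0, -2, 2, 0, 0,
     0, -4, 0, 0, 2, 2, 0, 2, 0, 0, 0, 2, 0, 0, 4, 3, -2, 0, 0, 0, 0, 0, -2, 0, -2, 2, 0, 4, 0, 0, 0,
     2, 0, 0, -2, -2, 2, 0, 0, 0, -4, -2, 2, 0, 0, -2, -2, 0, 2, -2, -2, 0, 0, 0, 0, 4, -2, 0, 0, -2,
     -2, -2, 0, 0, -4, 1, 4, -2, 0, 0, 0] @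
     [0, 0, 2, 2, 0, 0, 2, 0, 0, 0, -2, 2, 0, 0, 0, 0, 0, 0, -2, 2, 1, 6, 0, 2, 0, -2, 0, 0, 2, 0,
     -2, 2, 0, 2, 0, -2, 0, 0, 0, -2, -2, 0, 0, 0, 2, 0, 2, 0, -2, 0, 0, 0, 0, 2, -4, -2, -2, 0, -4,
     2, 0, -2, 0, 0, 0, -2, 2, 0, 0, 2, -2, 0, 0, -2, 1, 0, 0, 2, 0, -2, -2, 0, 0, -2, 0, 0, 4, 0, 2,
     -2, 4, 0, 0, 0, -2, 4, 0, 0, 2, 0] @
     [0, 2, 1, -2, 0, 0, 0, 0, -2, 2, 2, -2, 0, 0, 2, 2, 2, 0, 2, 0, 0, 0, 0, -2, -2, -4, 0, 0, 2, 2,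
     -2, -2, 0, 0, 0, -2, 0, 0, 0, -2, 2, 2, 0, -2, 0, -2, -2, 0, 0, 2, 0, -4, -2, 0, 0, 0, -2, 0, 0,
     0, -1, 2, 0, 4, -4, 0, 2, 0, 2, 0, 0, -2, 0, 0, 2, 2, 0, -2, 0, 0, -2, 0, 0, 0, 2, 2, 2, 0, 0,
     2, 3, 2, 0, 2, -2, 0, -2, 0, -2, 2] @
     [0, 0, 2, 0, 0, 2, -4, 0, 0, 0, 2, 0, 0, 0, 0, 2, -4, 0, 0, 2, 2, 0, 0, -2, -2, 0, -2, -2, 2,
     -4, -2, 0, 0, 0, 0, 2, -2, 0, 0, -2, 0, 2, 0, -4, 2, 2, 0, 0, 0, 0, -2, -2, -1, 0, -2, 0, 0, 0,
     0, 2, 0, -2, 0, 2, 0, 2, 0, 0, 4, 0, 2, 0, 0, -2, 0, 0, 0, -2, 2, 2, 0, 0, 0, 2, 3, -2, -2, 0,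
     2, 0, 0, 0, 0, 0, 4, 0, 0, 0, 4, 0] @
     [2, -2, 0, 0, -2, -2, 0, 0, -2, 0, -2, 2, 0, 0, -2, 2, 0, 0, -2, -2, 4, 0, 0, 0, 0, -2, 0, -2,
     0, 2, 0, -2, 0, -4, -2, 0, 0, 0, 0, -2, 0, -2, 0, 0, 0, 2, 0, 0, 2, 0, -1, 0, 2, 0, -4, 0, -2,
     0, 0, 6, 2, -2, 0, -2, -2, 0, 0, 0, 0, 2, 0, 2, 0, -2, 0, 2, 2, 2, 0, 0, 0, 4, 0, 2, 1, 0, 0, 0,
     -2, 0, 0, -2, 0, 0, -2, 0, 2, 0, 4, 2] @
     [0, 0, -2, 2, 0, -2, 0, 0, 0, 2, 0, 2, 0, -2, 0, 0, -2, 0, 0, 0, -4, 0, 0, 0, -4, 0, 2, 0, 0,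
     -2, -2, 2, 0, 2, 0, -2, 0, 0, -2, 0, 0, 0, 0, -2, 2, 0, -2, 0, 0, 0, -4, 0, 2, -2, 1, -4, 0, 0,
     2, 0, 0, 0, 0, 0, 0, 4, 2, 0, 2, 0, 0, 0, 0, -2, 2, -2, 0, 0, -2, 0, 0, 4, 0, 0, -2, 2, 2, 0, 0,
     0, 3, 0, 0, 0, 0, 2, 2, 0, 0, 0] @
     [0, 0, 4, -2, -2, 0, 2, 0, 2, -2, 0, 0, 0, -2, 0, -4, 0, 0, 0, 0, 2, 2, 0, 2, 2, -2, 0, 0, -6,
     0, 0, 2, 0, 0, 2, -2, -2, 0, 2, -4, 0, -2, 0, -2, 0, -2, -2, 0, -2, 2, -2, 2, 0, 2, 0, 0, 0, 0,
     2, 0, -2, 0, 0, -2, -1, 2, 0, 0, 0, -2, -2, -2, 0, 0, 2, 0, 4, 0, 0, 0, -4, 2, 0, 0, 2, 0, 2, 0,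
     0, 0, 0, 2, 0, 4, 0, 0, 0, 0, 2, -2] @
     [0, 4, -1, 0, -2, 0, -4, 0, 2, 2, 0, 0, 0, 2, 0, 2, 0, 0, -2, 4, 2, 0, 0, -2, 0, 0, 2, 2, -2, 0,
     0, -2, 0, -2, 0, 0, -2, 0, 0, 2, -2, -2, 0, 0, -2, 0, 0, 0, 0, -2, 4, 0, 0, 0, 0, 0, 2, 0, -4,
     0, -2, -2, 0, 0, -4, 0, 0, 0, 0, 2, 0, 0, 0, 0, -4, 0, 0, 0, 0, -2, -1, -2, 0, 2, 4, 2, 0, 0, 0,
     0, 2, -2, 0, 0, 0, 2, 0, 0, 0, -2] @
     [2, 0, -2, -2, 2, -2, 0, 0, 0, 0, 4, 2, 0, 2, 0, 0, 2, 0, 0, 2, 1, -2, 0, 4, 4, -4, -2, 0, 2, 0,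
     0, 0, 0, 2, 0, -2, 0, 0, 0, -2, 0, 0, 0, 0, 2, 0, 0, 0, 0, 4, 0, -2, -2, 0, 0, 2, 2, 0, 0, 0,
     -2, -4, 0, 0, 0, 0, -2, 0, 2, -4, 2, 0, 0, -2, -2, 0, -2, -2, 2, -2, 2, -2, 0, 0, 0, 0, 0, 0, 0,
     0, 0, 2, 0, 0, 0, 2, 0, 0, -4, 0] @
     [-2, -4, -1, 0, -2, 2, 0, 0, 0, 0, 0, 2, 0, 0, 4, 0, 0, 0, -2, 0, 0, 0, 0, 2, 2, 2, -2, 2, 2, 0,
     0, -2, 0, 0, 0, 4, -2, 0, -2, -2, 4, 0, 0, 0, 1, 2, 0, 0, 0, -2, 0, 0, 0, 4, 2, 0, 2, 0, 0, 0,
     0, 2, 0, 0, 2, 2, -6, 0, -2, 0, 0, 2, 0, 2, 0, 0, -2, -2, 0, 0, -2, -2, 0, 0, 0, 0, 2, 0, -2, 0,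
     0, 2, 0, 4, -2, -2, 0, 0, 0, 0] @
     [0, 0, -2, 0, 0, -4, 0, 0, -4, -4, 2, 0, 0, 0, 0, -2, 2, 0, 0, 2, -2, -2, 0, 2, 0, 2, -4, 0, 2,
     0, 1, -4, 0, 0, 2, 0, 0, 0, 2, 0, 0, 2, 0, -2, 0, -2, 0, 0, -2, 2, -2, 0, 0, 0, 2, 0, 0, 0, 2,
     2, 0, 0, 0, 4, -2, 2, 4, 0, 0, -2, 0, 0, 0, 0, 1, 0, 2, 2, 2, -2, 2, 0, 0, -6, 0, 0, 0, 0, 0, 0,
     2, 0, 0, 0, 2, 0, 4, 0, -2, -2] @
     [0, 2, 0, 0, 2, 2]"

lemma pent_table: "tabulates pent_coef 0 pent_list"
  unfolding pent_list_def
  by (simp only: table_eval pent_coef_eq delta_def pent_sum.simps cong: if_weak_cong)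

lemmas pent_facts = pent_table[unfolded pent_list_def, simplified table_eval]

lemma square_table: "tabulates square_coef 0 square_list"
  unfolding square_list_def
  by (simp only: table_eval square_coef_eq pent_sum.simps pent_facts cong: if_weak_cong)

lemmas square_facts = square_table[unfolded square_list_def, simplified table_eval]

text \<open>The lists \<open>quot\<close> contain the coefficients of \<open>fps_euler 1 ^ 2 / fps_euler t\<close>, the lists \<open>core\<close> those of
  \<open>q ^ (3 * i + 2)\<close> in \<open>fps_euler 1 ^ 2 * fps_euler t ^ v / (fps_euler 3 * fps_euler t)\<close>, with \<open>v = 2\<close> for \<open>t = 7, 19\<close> and
  \<open>v = 0\<close> for \<open>t = 11, 17\<close>. Restricted to this class of exponents, division by \<open>fps_euler 3\<close> becomes division by
  \<open>fps_euler 1\<close>. The blocks of 100 entries keep the simplifier fast.\<close>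

definition quot11_list :: "int list" where
  "quot11_list =
     [1, -2, -1, 2, 1, 2, -2, 0, -2, -2, 1, 1, -2, 1, 5, -1, 4, -2, 0, -4, -4, 1, 2, -6, -1, 7, 2, 8,
     -6, 2, -5, -4, 2, 5, -10, -2, 14, 1, 10, -8, -2, -9, -8, 3, 8, -18, -3, 21, 5, 18, -12, 2, -13,
     -14, 5, 14, -24, -4, 33, 3, 26, -20, 0, -22, -18, 7, 17, -40, -8, 47, 8, 42, -30, 4, -31, -28,
     11, 26, -54, -6, 72, 8, 58, -40, 0, -44, -42, 15, 37, -80, -13, 98, 16, 84, -62, 6, -64, -58,
     22, 53] @
     [-108, -17, 141, 15, 114, -80, 2, -90, -80, 30, 73, -154, -24, 192, 30, 160, -114, 10, -119,
     -110, 42, 99, -204, -30, 263, 32, 214, -154, 6, -163, -148, 54, 133, -284, -47, 350, 52, 292,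
     -208, 14, -219, -198, 75, 179, -370, -53, 471, 59, 382, -270, 12, -289, -262, 97, 236, -496,
     -80, 615, 90, 510, -364, 28, -379, -342, 129, 311, -642, -99, 810, 103, 656, -466, 22, -496,
     -448, 166, 402, -846, -132, 1047, 148, 860, -610, 40, -638, -582, 217, 523, -1076, -163, 1353,
     176, 1098, -780, 40, -825, -740, 275, 667, -1396] @
     [-221, 1727, 244, 1416, -1004, 64, -1049, -948, 355, 851, -1762, -266, 2208, 289, 1788, -1264,
     66, -1333, -1206, 446, 1079, -2250, -352, 2783, 388, 2272, -1616, 104, -1683, -1518, 567, 1362,
     -2818, -433, 3516, 462, 2848, -2016, 106, -2120, -1908, 708, 1705, -3554, -552, 4398, 610, 3582,
     -2534, 160, -2645, -2388, 889, 2135, -4414, -674, 5496, 729, 4448, -3148]"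

lemmas quot11_list_facts = tabulates_entry[OF quot11_list_def, simplified table_eval]

lemma quot11_list_check: "tabulates (\<lambda>m. square_coef m + pent_sum 11 (entry quot11_list) (m - 11) 11) 0 quot11_list"
  by (subst (2) quot11_list_def)
     (simp only: table_eval pent_sum.simps square_facts quot11_list_facts cong: if_weak_cong)

definition core11_list :: "int list" where
  "core11_list =
     [-1, 1, -2, 0, 3, 2, 0, -1, 0, 0, 0, -5, 3, -10, 0, 10, 7, 0, -2, 0, 0, 0, -18, 13, -31, 0, 34,
     22, 0, -8, 0, 0, 0, -47, 32, -83, 0, 84, 54, 0, -17, 0, 0, 0, -116, 81, -196, 0, 202, 129, 0,
     -44, 0, 0, 0, -256, 172, -433, 0, 432, 275, 0, -88, 0, 0, 0, -540, 367, -896, 0, 896, 567, 0,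
     -185, 0, 0, 0, -1069, 718, -1771, 0, 1744, 1100, 0, -349, 0]"

lemmas core11_list_facts = tabulates_entry[OF core11_list_def, simplified table_eval]

lemma core11_list_check: "tabulates (\<lambda>m. entry quot11_list (3 * m + 2) + pent_sum 1 (entry core11_list) (m - 1) 1) 0 core11_list"
  by (subst (2) core11_list_def)
     (simp only: table_eval pent_sum.simps square_facts core11_list_facts quot11_list_facts cong: if_weak_cong)

definition quot17_list :: "int list" where
  "quot17_list =
     [1, -2, -1, 2, 1, 2, -2, 0, -2, -2, 1, 0, 0, 2, 3, -2, 2, 1, -2, -3, 0, 1, 2, -4, -1, -2, 0, 3,
     -2, 2, 3, 5, -2, 4, 0, -6, -2, 2, 0, 4, -10, -1, -4, -2, 5, -4, 2, 5, 10, -4, 8, 3, -7, -7, 2,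
     3, 8, -14, -2, -8, -2, 6, -6, 2, 10, 15, -10, 12, 3, -15, -10, 6, 3, 14, -24, -3, -12, -6, 13,
     -6, 5, 15, 25, -12, 18, 7, -22, -16, 6, 7, 20, -38, -5, -20, -8, 18, -14, 7, 23, 37] @
     [-18, 26, 8, -37, -25, 16, 9, 32, -56, -7, -28, -14, 28, -18, 13, 33, 57, -28, 44, 16, -51, -40,
     18, 15, 44, -82, -11, -44, -18, 42, -28, 16, 49, 79, -42, 58, 20, -79, -53, 30, 19, 68, -120,
     -15, -62, -28, 59, -38, 23, 71, 118, -56, 88, 33, -108, -79, 38, 31, 94, -168, -22, -88, -38,
     83, -56, 32, 102, 162, -84, 118, 39, -156, -109, 60, 38, 134, -238, -30, -120, -56, 116, -74,
     46, 136, 229, -114, 168, 61, -208, -151, 74, 59, 182, -326, -42, -170, -70, 158, -108, 62] @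
     [191, 309, -156, 226, 78, -293, -203, 112, 76, 250, -444, -56, -228, -104, 215, -140, 87, 257,
     423, -212, 312, 112, -387, -281, 138, 104, 332, -596, -77, -308, -132, 289, -194, 113, 346, 562,
     -284, 410, 139, -527, -367, 196, 134, 450, -800, -101, -406, -182, 388, -252, 152, 457, 753,
     -372, 552, 198, -688, -494, 248, 187, 588, -1050, -135, -542, -232, 507, -340, 198, 606, 984,
     -498, 718, 247, -916, -644, 340, 233, 778, -1384, -176, -706, -314, 670, -436, 263, 788, 1294,
     -644, 946, 333, -1182, -844, 424, 315, 1008, -1798, -231, -924, -398, 865] @
     [-576, 339, 1029, 1671, -838, 1218, 420, -1547, -1086, 572, 400, 1310, -2330, -295, -1186, -526,
     1120, -734, 442, 1323, 2166, -1082, 1584, 557, -1973, -1410, 712, 521, 1676, -2990, -383, -1532,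
     -662, 1437, -952, 561, 1698, 2765, -1388, 2010, 694, -2548, -1790, 934, 658, 2154, -3830, -486,
     -1952, -860, 1836, -1204, 719, 2163, 3540, -1760, 2578, 906, -3221, -2293, 1164, 852, 2728,
     -4858, -621, -2484, -1078, 2326, -1542, 910, 2753, 4473, -2244, 3254, 1124, -4104, -2891, 1504,
     1056, 3464, -6156, -782, -3132, -1378, 2947, -1930, 1154, 3464, 5661, -2822, 4120, 1441, -5147,
     -3655, 1858, 1352, 4350, -7742, -988, -3952] @
     [-1712, 3699, -2448, 1442, 4361, 7094, -3550, 5154, 1786, -6493, -4572, 2372, 1679, 5468, -9710,
     -1233, -4942, -2170, 4637, -3042, 1814, 5452, 8894, -4436, 6468, 2259, -8079, -5734, 2920, 2112,
     6808, -12112, -1545, -6174, -2680, 5779, -3812, 2252, 6799, 11058, -5530, 8026, 2778, -10092,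
     -7107, 3676, 2607, 8488, -15074, -1914, -7662, -3356, 7185, -4716, 2806, 8431, 13752, -6848,
     9988, 3487, -12474, -8838, 4512, 3258, 10492, -18650, -2376, -9500, -4126, 8878, -5860, 3463,
     10440, 16974, -8488, 12314, 4269, -15456, -10897, 5624, 3989, 12976, -23038, -2926, -11704,
     -5124, 10964, -7194, 4276, 12851, 20946, -10438, 15198, 5295, -18983, -13432, 6858, 4943, 15942,
     -28324] @
     [-3606, -14408, -6260, 13465, -8876, 5244, 15804, 25695, -12826, 18624, 6457, -23352, -16457,
     8488, 6033, 19576, -34744, -4411, -17642, -7714, 16507, -10834, 6438, 19340, 31496, -15698,
     22838, 7952, -28507, -20169, 10304, 7408, 23902, -42450, -5402, -21578, -9378, 20156, -13270,
     7845, 23620, 38405, -19170, 27818, 9645, -34843, -24552, 12642, 8995, 29174, -51766, -6572,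
     -26274, -11472, 24559, -16122, 9565, 28744, 46790, -23304, 33900, 11797, -42311, -29905, 15290,
     10983, 35426, -62884, -7997, -31940, -13888, 29812, -19622, 11600, 34919, 56748, -28316, 41088,
     14243, -51404, -36234, 18636, 13259, 42986, -76258, -9681, -38676, -16882, 36140, -23714, 14067,
     42253, 68754, -34248, 49778, 17309, -62109, -43871, 22434, 16096] @
     [51940, -92168, -11715, -46782, -20336, 43645, -28710, 16969, 51057, 82975, -41370, 60034,
     20820, -75056, -52894, 27190, 19366, 62696, -111184, -14112, -56374, -24590, 52626, -34540,
     20473, 61497, 100019, -49818, 72378, 25153, -90265, -63740, 32598, 23356, 75392, -133746,
     -16995, -67838, -29498, 63269, -41590, 24589, 73941, 120142, -59888, 86882, 30119, -108540,
     -76482, 39280, 27984, 90574, -160600, -20380, -81382, -35474, 75930, -49832, 29517, 88656,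
     144151, -71770, 104250, 36219, -129975, -91731, 46930, 33607, 108442, -192312, -24426, -97494,
     -42390, 90874, -59722, 35306, 106132, 172407, -85920, 124626, 43207, -155580, -109632, 56270,
     40089, 129698, -229918, -29174, -116462, -50744, 108604, -71254, 42195, 126709, 205958, -102538,
     148868, 51690, -185550, -130896] @
     [66964, 47923, 154660, -274206, -34817, -138930, -60402, 129449, -85042, 50267, 151060, 245352,
     -122210, 177270, 61454, -221173, -155824, 79948, 56975, 184212, -326480, -41418, -165304,
     -72000, 154063, -101082, 59839, 179652, 291920, -145322, 210914, 73210, -262773, -185333, 94814,
     67802, 218818, -387868, -49236, -196424, -85394, 182952, -120142, 71009, 213331, 346444,
     -172536, 250200, 86724, -312004, -219784, 112700, 80329, 259646, -460088, -58359, -232860,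
     -101378, 216925, -142306, 84203, 252786, 410660, -204370, 296562, 102912, -369378, -260425,
     133242, 95246, 307324, -544610, -69113, -275680, -119846, 256660, -168506, 99586, 299113,
     485648, -241806, 350600, 121511, -436970, -307796, 157770, 112441, 363348, -643728, -81642,
     -325674, -141746, 303271, -198912, 117674, 353189, 573640, -285452, 414090, 143645] @
     [-515589, -363406, 185916, 132841, 428632, -759432, -96351, -384258, -167022, 357620, -234730,
     138703, 416496, 676146, -336554, 487934, 169103, -607873, -428110, 219374, 156370, 505072,
     -894640, -113445, -452468, -196878, 421144, -276208, 163350, 490234, 796024, -396066, 574410,
     199206, -714970, -503835, 257740, 184077, 593926, -1052086, -133454, -532120, -231284, 495079,
     -324854, 191948, 576244, 935333, -465480, 674730, 233796, -840236, -591672, 303084, 216032,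
     697648, -1235558, -156651, -624664, -271720, 581210, -381136, 225343, 676184, 1097762, -546082,
     791844, 274559, -985323, -694178, 355108, 253550, 817926, -1448598, -183709, -732408, -318300,
     681178, -446890, 264022, 792456, 1286072, -639920, 927448, 321334, -1154466, -812871, 416274,
     296688, 957900, -1696198, -215028, -857280, -372826, 797364, -522798, 309042, 927193, 1504985,
     -748568] @
     [1085208, 376181, -1349985, -950877, 486374, 347170, 1119884]"

lemmas quot17_list_facts = tabulates_entry[OF quot17_list_def, simplified table_eval]

lemma quot17_list_check: "tabulates (\<lambda>m. square_coef m + pent_sum 17 (entry quot17_list) (m - 17) 17) 0 quot17_list"
  by (subst (2) quot17_list_def)
     (simp only: table_eval pent_sum.simps square_facts quot17_list_facts cong: if_weak_cong)

definition core17_list :: "int list" where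
  "core17_list =
     [-1, 1, -2, -1, 0, 1, 0, 0, 0, 4, 2, 0, 0, 0, -1, 0, 4, -6, 5, -8, -8, 0, 4, 0, 0, 0, 13, 3, 0,
     0, 0, -4, 0, 14, -18, 15, -27, -28, 0, 15, 0, 0, 0, 44, 10, 0, 0, 0, -15, 0, 46, -50, 42, -73,
     -80, 0, 40, 0, 0, 0, 111, 18, 0, 0, 0, -38, 0, 116, -118, 101, -180, -200, 0, 103, 0, 0, 0, 271,
     44, 0, 0, 0, -93, 0, 281, -270, 231, -403, -460, 0, 228, 0, 0, 0, 591, 82, 0, 0, 0, -203] @
     [0, 608, -569, 486, -858, -987, 0, 493, 0, 0, 0, 1245, 168, 0, 0, 0, -429, 0, 1268, -1156, 988,
     -1731, -2011, 0, 988, 0, 0, 0, 2469, 307, 0, 0, 0, -848, 0, 2494, -2239, 1914, -3369, -3927, 0,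
     1933, 0, 0, 0, 4759, 582, 0, 0, 0, -1633, 0, 4770, -4218, 3606, -6319, -7405, 0, 3611, 0, 0, 0,
     8821, 1029, 0, 0, 0, -3014, 0, 8778, -7693, 6572, -11537, -13547, 0, 6604, 0, 0, 0, 15979, 1838,
     0, 0, 0, -5450, 0, 15791, -13718, 11715, -20515, -24149, 0, 11708, 0, 0, 0, 28156, 3147, 0, 0] @
     [0, -9565, 0, 27650, -23877, 20380, -35711, -42081, 0, 20382, 0, 0, 0, 48683, 5388, 0, 0, 0,
     -16498, 0, 47527, -40807, 34817, -60906, -71863, 0, 34677, 0, 0, 0, 82434, 8959, 0, 0, 0,
     -27837, 0, 80034, -68440, 58359, -102097, -120530, 0, 58092, 0, 0, 0, 137390, 14820, 0, 0, 0,
     -46276, 0, 132705, -113045, 96351, -168364, -198885, 0, 95601, 0, 0, 0, 225228, 24008, 0, 0, 0,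
     -75624, 0, 216500, -183894, 156651, -273690, -323372, 0, 155255, 0, 0, 0, 364302, 38618, 0, 0,
     0, -122013, 0, 348610, -295299, 251441, -438904, -518716, 0, 248534, 0, 0, 0, 581311, 61126] @
     [0, 0]"

lemmas core17_list_facts = tabulates_entry[OF core17_list_def, simplified table_eval]

lemma core17_list_check: "tabulates (\<lambda>m. entry quot17_list (3 * m + 2) + pent_sum 1 (entry core17_list) (m - 1) 1) 0 core17_list"
  by (subst (2) core17_list_def)
     (simp only: table_eval pent_sum.simps square_facts core17_list_facts quot17_list_facts cong: if_weak_cong)

definition core7_list :: "int list" where
  "core7_list =
     [-1, 1, 0, 0, 2, 0, -1, -2, 0, 0, 0, 0, 0, 0, 0, 1, 0, 0, 1, 0, 0, 0, 0, 0, 0, -2, 0, 2, 0, 0,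
     0, 0, 0, 0, -2, 0, -1]"

lemmas core7_list_facts = tabulates_entry[OF core7_list_def, simplified table_eval]

lemma core7_list_check: "tabulates (\<lambda>m. (square_coef (3 * m + 2) - pent_sum 7 square_coef (3 * m + 2 - 7) 7) + pent_sum 1 (entry core7_list) (m - 1) 1) 0 core7_list"
  by (subst (2) core7_list_def)
     (simp only: table_eval pent_sum.simps square_facts core7_list_facts cong: if_weak_cong)

definition core19_list :: "int list" where
  "core19_list =
     [-1, 1, -2, -1, 0, 0, -1, -1, 0, 2, 1, 0, 0, 0, 0, 1, 0, 0, 0, 1, 1, 1, 1, 0, 0, -1, 1, 0, -1,
     1, 0, 0, 0, 0, -1, 0, 1, 0, -1, -1, 1, 1, 0, 0, 3, 0, 0, -1, -1, 0, 0, 0, 0, -1, 0, 0, 0, 2, -2,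
     1, 0, 0, 0, 0, 0, 0, -2, -2, 0, 0, 0, 0, 0, 0, 0, 0, 0, -2, 1, -2, 0, 0, 0, 0, 0, -1, -2, 0, 0,
     0, 0, 1, 0, -3, 0, -1, 1, 1, 1, 0] @
     [0, -1, 0, 0, 1, 0, 0, 0, 0, 0, 0, 0, 0, 0, 2, 0, 0, 0, 0, 0, 1, 2, 0, -1, 1, 0, 0, 0, 0, -1, 0,
     1, 0, -1, -1, -2, 0, 0, 0, 2, 0, 0, 4, 0, 0, 0, 0, 0, 1, 0, -1, 0, 0, 1, -1, 1, 0, 0, -1, -1, 0,
     0, 2, 0, 0, 0, 0, 0, 0, 1, 0, -1, 1, -1, 1, 0, 0, 0, 0, 0, 0, 0, 0, 0, 0, 0, 1, 0, 1, 0, 0, 3,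
     0, 0, 0, 0, -2, 0, 0, 1] @
     [1, 0, 0, 0, 0, 2, 0, 2, 0, 0, 1, -1, -4, 0, 0, -1, -1, 0, 0, 0, 0, 0, 0, 0, -1, 0, -2, 0, 0, 0,
     2, 1, 0, 0, -1, -1, 0, 0, 0, 0, 0, 0, 0, -1, 0, 0, 0, -2, 0, -1, -1, 0, 0, 0, -2, 0, -1, 2, 0,
     0, 0, 0, -2, 0, 1, 0, 1, 0, -2, 0, 0, 0, -1, 0, 0, 0, -1, 0, 0, 0, 0, 0, 0, 1, 0, -2, 0, 0, -1,
     0, 0, 0, 0, 0, 1, 0, 0, 0, 0, 0] @
     [0, 0, 0, 0, 1, -1, 0, 2, 0, 0, 0, 1, 0, -1, 1, 0, 0, 0, 0, -2, 0, 1, 0, 1, -2, -1, 1, 0, 0, 0,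
     1, 0, -2, 1, 0, 0, 0, 0, 3, 0, -1, 0, -2, 1, 1, 2, 0, 0, 0, 0, 0, 0, -2, 0, 0, 0, 0, -2, 0, -2,
     0, 0, 0, 2, 0, 0, 0, 2, -1, 0, -1, -1, 0, 0, 0, 0, 1, 0, 1, 0, 2, -1, 2, 0, 0, 0, -1, 3, 0, 1,
     -1, 0, 0, 0, 0, 1, 0, -1, 0, 1] @
     [0, 0, -2, 0, 0, 1, 0, 0, 2, 1, 0, 0, 0, 0, 0, 0, -1, 0, 2, -1, 1, 0, 0, 0, 1, 0, 0, 0, -1, 0,
     0, 0, 0, 0, 0, 1, 0, 2, 0, 1, 0, 0, 0, 2, 0, 0, 0, 0, 0, 0, 0, 0, 0, 0, 0, 0, -1, 0, 1, -1, 0,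
     0, 2, 0, 0, -1, 0, 0, 0, 0, 0, 2, 0, -1, 0, 1, 0, 0, 2, 0, 0, 1, 0, 0, -1, -4, 0, 0, 0, 0, 0, 0,
     -2, 0, -1, -2, 0, -1, 0, 0] @
     [-1, 0]"

lemmas core19_list_facts = tabulates_entry[OF core19_list_def, simplified table_eval]

lemma core19_list_check: "tabulates (\<lambda>m. (square_coef (3 * m + 2) - pent_sum 19 square_coef (3 * m + 2 - 19) 19) + pent_sum 1 (entry core19_list) (m - 1) 1) 0 core19_list"
  by (subst (2) core19_list_def)
     (simp only: table_eval pent_sum.simps square_facts core19_list_facts cong: if_weak_cong)

section \<open>The finite check\<close>

definition weight :: "int \<Rightarrow> int \<Rightarrow> int \<Rightarrow> int" where
  "weight t v j = (if j mod 3 = 0 then 1 else if j mod t = 0 then v + 1 else 2)"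

definition weighted_sum :: "int \<Rightarrow> int \<Rightarrow> (int \<Rightarrow> int) \<Rightarrow> int" where
  "weighted_sum t v F = sum_list (map (\<lambda>j. weight t v j * F j) [1..(3 * t - 1) div 2])"

lemma weighted_sum_eq:
  assumes t: "odd t"
  shows "weighted_sum (int t) (int v) F =
    (\<Sum>j=1..(3 * t - 1) div 2. int (expo t (Suc v) (gcd j (3 * t))) * F (int j))"
proof -
  have M: "(3 * int t - 1) div 2 = int ((3 * t - 1) div 2)"
    using t by (auto elim!: oddE)
  have S: "{1..int ((3 * t - 1) div 2)} = int ` {1..(3 * t - 1) div 2}"
    by (simp add: image_int_atLeastAtMost)
  have w: "weight (int t) (int v) (int j) = int (expo t (Suc v) (gcd j (3 * t)))" for j
  proof -
    have "int j mod 3 = 0 \<longleftrightarrow> 3 dvd j" "int j mod int t = 0 \<longleftrightarrow> t dvd j"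
      by presburger (simp add: dvd_eq_mod_eq_0 zmod_int[symmetric])
    then show ?thesis by (simp add: weight_def expo_def)
  qed
  show ?thesis
    unfolding weighted_sum_def interv_sum_list_conv_sum_set_int set_upto M S
    by (subst sum.reindex) (simp_all add: w)
qed

text \<open>\<open>S\<close> lists residues modulo \<open>3 t\<close>.  The four conditions say: the level condition; a bound for the
  pole orders at the cusps; stability of \<open>S\<close>, after the shift of the exponent, under multiplication
  by the squares of units; and the valence inequality, in which \<open>B\<close> coefficients suffice.\<close>

definition sturm_check :: "int \<Rightarrow> int \<Rightarrow> int \<Rightarrow> int \<Rightarrow> int list \<Rightarrow> bool" where
  "sturm_check t v \<kappa> B S \<longleftrightarrow>
    (let n = 3 * t; sh = 2 * weighted_sum t v (\<lambda>j. j * j) div n - weighted_sum t v (\<lambda>j. j) in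
      2 * weighted_sum t v (\<lambda>j. j * j) mod n = 0 \<and>
      list_all (\<lambda>c. weighted_sum t v (\<lambda>j. let r = j * c mod n in 6 * (r * r) - 6 * r * n + n * n)
        \<ge> - \<kappa> * (n * n)) [0..n - 1] \<and>
      list_all (\<lambda>d. d mod 3 = 0 \<or> d mod t = 0 \<or>
        list_all (\<lambda>\<beta>. List.member S (((sh + \<beta>) * (d * d) - sh) mod n)) S) [0..n - 1] \<and>
      \<kappa> * (8 * (t * t - 1) - 2 * (t - 1)) * n
        < 24 * (t - 1) * (sh + B) + 2 * (t - 1) * weighted_sum t v (\<lambda>j. 1) * n)"

text \<open>\<open>D\<close> is the series of \<open>Q\<close> times \<open>U\<close>, the v-th
  power of \<open>fps_euler (3 * t)\<close>, a series in q ^ (3 t) with constant term 1. Vanishing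
  of the first B coefficients passes from \<open>D\<close> to \<open>Q\<close> by cancellation,
  \<open>coeffs_vanish\<close> extends it to all coefficients in the classes of S, and
  multiplication by \<open>U\<close> leads back to \<open>D\<close>.\<close>

theorem core_coeffs_vanish:
  fixes D :: "int fps"
  assumes t: "prime t" "t > 3" and check: "sturm_check (int t) (int v) \<kappa> (int B) S" and \<kappa>: "\<kappa> \<ge> 0"
    and D: "D * (fps_euler 3 * fps_euler t) = fps_euler 1 ^ 2 * fps_euler t ^ v"
    and zero: "\<And>m. m < B \<Longrightarrow> int m mod int (3 * t) \<in> set S \<Longrightarrow> fps_nth D m = 0"
    and m: "int m mod int (3 * t) \<in> set S"
  shows "fps_nth D m = 0"
proof -
  have odd_t: "odd t" using t prime_odd_nat by auto
  note ws = weighted_sum_eq[OF odd_t, of v]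
  define n where "n = 3 * t"
  have n: "int n = 3 * int t" "n > 0" using t by (simp_all add: n_def)
  define sh where "sh = 2 * weighted_sum t v (\<lambda>j. j * j) div int n - weighted_sum t v (\<lambda>j. j)"
  note check' = check[unfolded sturm_check_def Let_def, folded n(1), folded sh_def]
  have c1: "2 * weighted_sum t v (\<lambda>j. j * j) mod int n = 0" using check' by blast
  have c2: "weighted_sum t v (\<lambda>j. 6 * ((j * c mod int n) * (j * c mod int n)) - 6 * (j * c mod int n) * int n + int n * int n)
        \<ge> - \<kappa> * (int n * int n)" if "0 \<le> c" "c < int n" for c
    using check'[THEN conjunct2, THEN conjunct1, unfolded list_all_iff set_upto, rule_format, of c] that
    by (simp only: atLeastAtMost_iff) simp
  have c3: "((sh + \<beta>) * (d * d) - sh) mod int n \<in> set S"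
    if "0 \<le> d" "d < int n" "\<not> 3 dvd d" "\<not> int t dvd d" "\<beta> \<in> set S" for d \<beta>
    using check'[THEN conjunct2, THEN conjunct2, THEN conjunct1, unfolded list_all_iff set_upto, rule_format, of d] that
    by (simp only: atLeastAtMost_iff dvd_eq_mod_eq_0 List.member_iff) auto
  have c4: "\<kappa> * (8 * (int t * int t - 1) - 2 * (int t - 1)) * int n
        < 24 * (int t - 1) * (sh + int B) + 2 * (int t - 1) * weighted_sum t v (\<lambda>j. 1) * int n"
    using check' by blast
  have sq: "weighted_sum t v (\<lambda>j. j * j) = int (\<Sum>j=1..(3 * t - 1) div 2. expo t (Suc v) (gcd j (3 * t)) * j\<^sup>2)"
    by (simp add: ws power2_eq_square)
  interpret core_product t v
  proof
    show "3 * t dvd 2 * (\<Sum>j=1..(3 * t - 1) div 2. expo t (Suc v) (gcd j (3 * t)) * j\<^sup>2)"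
    proof -
      have "int n dvd int (2 * (\<Sum>j=1..(3 * t - 1) div 2. expo t (Suc v) (gcd j (3 * t)) * j\<^sup>2))"
        using c1 unfolding sq by (simp add: mod_eq_0_iff_dvd)
      then show ?thesis unfolding int_dvd_int_iff n_def .
    qed
  qed (use t in auto)
  have shift: "shift = sh"
    unfolding shift_def sh_def sq ws(1)[of "\<lambda>j. j"] by (simp add: M_def n_def zdiv_int)
  have wt: "weighted_sum t v (\<lambda>j. 1) = int wt"
    by (simp add: ws wt_def M_def)
  define G where "G = card {d \<in> {1..<3 * t}. coprime d (3 * t)}"
  have G: "real G = 2 * (real t - 1)" using card_units t by (simp add: G_def of_nat_diff)
  have ord: "(\<Sum>j=1..M. int (expo t (Suc v) (gcd j (3 * t))) *
      (6 * ((2 * int j * x) mod int (3 * t))\<^sup>2 - 6 * ((2 * int j * x) mod int (3 * t)) * int (3 * t) + (int (3 * t))\<^sup>2))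
      \<ge> - \<kappa> * (int (3 * t))\<^sup>2" for x
  proof -
    \<comment> \<open>The factor 2 is absorbed into the residue, since the check ranges over all
      residues c.\<close>
    have "int j * (2 * x mod int n) mod int n = 2 * int j * x mod int n" for j
      by (simp add: mod_mult_right_eq mult_ac)
    then show ?thesis using c2[of "2 * x mod int n"] n(2)
      by (simp add: ws power2_eq_square M_def[folded n_def] n_def[symmetric] del: of_nat_mult)
  qed
  define U :: "int fps" where "U = fps_euler (3 * t) ^ v"
  have U: "\<not> 3 * t dvd i \<Longrightarrow> fps_nth U i = 0" for i
    unfolding U_def by (rule fps_power_support[of "3 * t"]) (use t in \<open>simp_all add: fps_euler_support\<close>)
  have U0: "fps_nth U 0 = 1" unfolding U_def using t by (simp add: fps_nth_power_0)
  define R where "R = fps_expansion Q 0"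
  have aR: "a i = fps_nth R i" for i by (simp add: a_def R_def fps_expansion_def)
  have DR: "fps_map of_int D = R * fps_map of_int U"
  proof -
    have "fps_map of_int D * (fps_euler 3 * fps_euler t) = (R * fps_map of_int U) * (fps_euler 3 * fps_euler t)"
      using Q_fps_identity arg_cong[OF D, of "fps_map (of_int :: int \<Rightarrow> complex)"] t
      by (simp add: cplx.fps_map_mult cplx.fps_map_power fps_map_euler_of_int R_def U_def mult_ac)
    moreover have "(fps_euler d :: complex fps) \<noteq> 0" if "d > 0" for d
      by (metis fps_euler_nth_0 fps_zero_nth that zero_neq_one)
    ultimately show ?thesis using t by simp
  qed
  let ?cU = "fps_map (of_int :: int \<Rightarrow> complex) U"
  have cU: "\<not> 3 * t dvd i \<Longrightarrow> fps_nth ?cU i = 0" for i by (simp add: U)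
  have a0: "a i = 0" if i: "int i mod int n \<in> set S" for i
  proof (rule coeffs_vanish[OF ord, where B = B and \<rho> = "shift + int i"])
    show "int (3 * t) dvd shift + int i - (shift + int i)" by simp
    fix l d assume l: "l < B" and d: "coprime d (3 * t)"
      and dv: "int (3 * t) dvd (shift + int l) * (int d)\<^sup>2 - (shift + int i)"
    \<comment> \<open>With the inverse c of d, the relation \<open>dv\<close> becomes: l is
      congruent to (shift + i) * c ^ 2 - shift. The stability condition of the check places this
      residue in S.\<close>
    obtain d' where d': "[d * d' = 1] (mod n)" using d cong_solve_coprime_nat[of d n] by (auto simp: n_def)
    define c where "c = int d' mod int n"
    have cr: "[int d * c = 1] (mod int n)"
      using d' unfolding c_def cong_int_iff[symmetric] by (simp add: cong_def mod_mult_right_eq)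
    have un: "\<not> p dvd c" if p: "p dvd int n" "\<not> is_unit p" for p
    proof
      assume "p dvd c"
      then have "p dvd int d * c" by simp
      moreover have "[int d * c = 1] (mod p)" using cr p(1) by (rule cong_dvd_modulus)
      ultimately show False using p(2) by (metis cong_dvd_iff)
    qed
    have "[shift + int i = (shift + int l) * (int d * int d)] (mod int n)"
      using dv by (simp add: n_def power2_eq_square cong_iff_dvd_diff dvd_diff_commute)
    then have "[(shift + int i) * (c * c) = (shift + int l) * (int d * int d) * (c * c)] (mod int n)"
      by (rule cong_scalar_right)
    also have "(shift + int l) * (int d * int d) * (c * c) = (shift + int l) * ((int d * c) * (int d * c))"
      by (simp add: mult_ac)
    also have "[\<dots> = (shift + int l) * (1 * 1)] (mod int n)"
      by (intro cong_mult cr cong_refl)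
    finally have "[(shift + int i) * (c * c) = shift + int l] (mod int n)" by simp
    moreover have "[(shift + int i mod int n) * (c * c) = (shift + int i) * (c * c)] (mod int n)"
      by (intro cong_mult cong_add cong_refl) (simp add: cong_def)
    ultimately have "[(shift + int i mod int n) * (c * c) - shift = shift + int l - shift] (mod int n)"
      by (intro cong_diff cong_refl) (rule cong_trans)
    then have "((shift + int i mod int n) * (c * c) - shift) mod int n = int l mod int n"
      by (simp add: cong_def)
    moreover have "((shift + int i mod int n) * (c * c) - shift) mod int n \<in> set S"
      unfolding shift by (rule c3) (use n(2) i t un[of 3] un[of "int t"] in \<open>simp_all add: c_def n(1)\<close>)
    ultimately have lS: "int l mod int n \<in> set S" by simp
    have "fps_nth R l = 0"
    proof (rule class_cancel_vanish[OF cU])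
      show "fps_nth ?cU 0 = 1" by (simp add: U0)
      fix k assume k: "k < B" "k mod (3 * t) = l mod n"
      then have "int k mod int n = int l mod int n" by (metis n_def zmod_int)
      then show "fps_nth (R * ?cU) k = 0"
        using zero[of k] k lS unfolding DR[symmetric] by (simp add: n_def)
    qed (use l in \<open>simp_all add: n_def\<close>)
    then show "a l = 0" by (simp add: aR)
  next
    show "of_int \<kappa> * (real (card vecs) - real (card {d \<in> {1..<3 * t}. coprime d (3 * t)}))
       < 12 * real (card {d \<in> {1..<3 * t}. coprime d (3 * t)}) * (lead + real B / real (3 * t))"
    proof -
      have "real (card vecs) \<le> real (8 * (t\<^sup>2 - 1))" using card_vecs_le by (rule of_nat_mono)
      also have "\<dots> = 8 * (real t * real t - 1)" using t by (simp add: of_nat_diff power2_eq_square)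
      \<comment> \<open>The number of vectors enters through an upper bound, which requires \<kappa>
        \<ge> 0 in the product.\<close>
      finally have cv: "of_int \<kappa> * (real (card vecs) - real G) \<le> of_int \<kappa> * (8 * (real t * real t - 1) - 2 * (real t - 1))"
        using \<kappa> by (intro mult_left_mono) (simp_all add: G)
      have "real_of_int (\<kappa> * (8 * (int t * int t - 1) - 2 * (int t - 1)) * int n)
        < real_of_int (24 * (int t - 1) * (sh + int B) + 2 * (int t - 1) * int wt * int n)"
        using c4 unfolding wt of_int_less_iff .
      then have "of_int \<kappa> * (8 * (real t * real t - 1) - 2 * (real t - 1)) * real n
        < 24 * (real t - 1) * (of_int sh + real B) + 2 * (real t - 1) * real wt * real n" by simp
      also have "\<dots> = 12 * real G * (lead + real B / real n) * real n"
        unfolding lead_eq G shift unfolding n_def[symmetric] using n(2) by (simp add: field_simps)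
      finally have "of_int \<kappa> * (8 * (real t * real t - 1) - 2 * (real t - 1))
          < 12 * real G * (lead + real B / real n)" using n(2) by simp
      with cv show ?thesis unfolding G_def n_def by linarith
    qed
  qed
  have "fps_nth (R * ?cU) m = 0"
  proof (rule class_mult_vanish[OF cU])
    fix k assume "k < Suc m" "k mod (3 * t) = m mod (3 * t)"
    then have "int k mod int n = int m mod int n" by (metis n_def zmod_int)
    then show "fps_nth R k = 0" using a0[of k] m by (simp add: aR n_def)
  qed simp_all
  then show ?thesis unfolding DR[symmetric] by simp
qed

text \<open>In all four checks \<kappa> is sharp: the poles are worst at the residues c with gcd (c,
  3 t) = t, where the weighted sum is - n ^ 2 * (t + 5) / 6 for v = 2 and - n ^ 2 * (t + 1) / 6 for
  v = 0. With this \<kappa>, \<open>B\<close> is the least integer that satisfies the valence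
  inequality. Each list S is a single orbit under squares of units: sh + \<beta> runs through one
  class modulo 3, restricted to the quadratic residues modulo t for t = 11, 17 and to the
  nonresidues for t = 7, 19.\<close>

lemma sturm_check_7: "sturm_check 7 2 2 111 [8, 11, 17]"
  by code_simp

lemma sturm_check_11: "sturm_check 11 0 2 260 [11, 20, 26, 29, 32]"
  by code_simp

lemma sturm_check_17: "sturm_check 17 0 3 907 [14, 20, 23, 26, 35, 38, 41, 47]"
  by code_simp

lemma sturm_check_19: "sturm_check 19 2 4 1506 [14, 17, 26, 35, 38, 41, 44, 50, 56]"
  by code_simp

section \<open>The congruences\<close>

definition core_series :: "nat \<Rightarrow> nat \<Rightarrow> int fps" where
  "core_series t v = fps_euler 1 ^ 2 * fps_euler t ^ v * fps_recip (fps_euler 3 * fps_euler t)"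

lemma core_series_mult:
  assumes "t > 0"
  shows "core_series t v * (fps_euler 3 * fps_euler t) = fps_euler 1 ^ 2 * fps_euler t ^ v"
proof -
  have "(fps_euler 3 * fps_euler t) * fps_recip (fps_euler 3 * fps_euler t :: int fps) = 1"
    by (rule fps_right_inverse) (use assms in simp)
  then show ?thesis by (simp add: core_series_def mult_ac)
qed

lemma coef_trisect:
  assumes "D * fps_euler 3 = N"
  shows "coef D (3 * m + 2) = coef N (3 * m + 2) + pent_sum 1 (\<lambda>i. coef D (3 * i + 2)) (m - 1) 1"
proof -
  have "3 * m + 2 - 3 = 3 * (m - 1) + 2" by simp
  then show ?thesis
    using coef_euler_mult[of 3 D "3 * m + 2"] pent_sum_trisect[of "coef D" "m - 1" 1] assms
    by (simp add: mult.commute)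
qed

primrec vanishes_on :: "int \<Rightarrow> int list \<Rightarrow> int \<Rightarrow> int list \<Rightarrow> bool" where
  "vanishes_on n S i [] \<longleftrightarrow> True"
| "vanishes_on n S i (x # xs) \<longleftrightarrow> (x = 0 \<or> \<not> List.member S (i mod n)) \<and> vanishes_on n S (i + 3) xs"

lemma vanishes_on_nth:
  "vanishes_on n S i xs \<Longrightarrow> k < length xs \<Longrightarrow> (i + 3 * int k) mod n \<in> set S \<Longrightarrow> xs ! k = 0"
proof (induction xs arbitrary: i k)
  case (Cons x xs)
  then show ?case
    by (cases k) (auto simp: List.member_iff algebra_simps dest!: Cons.IH[of "i + 3"])
qed simp

lemma tabulates_cong:
  "(\<And>k. i \<le> k \<Longrightarrow> k < i + int (length xs) \<Longrightarrow> f k = g k) \<Longrightarrow> tabulates f i xs \<longleftrightarrow> tabulates g i xs"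
proof (induction xs arbitrary: i)
  case (Cons x xs)
  have "tabulates f (i + 1) xs \<longleftrightarrow> tabulates g (i + 1) xs" by (rule Cons.IH) (use Cons.prems in auto)
  then show ?case using Cons.prems[of i] by simp
qed simp

text \<open>All residues in S are 2 modulo 3, so a table of this one class suffices; its k-th entry
  belongs to q ^ (3 k + 2).\<close>

lemma trisection_vanish:
  assumes N: "D * fps_euler 3 = N"
    and tab: "tabulates (\<lambda>m. num m + pent_sum 1 (entry xs) (m - 1) 1) 0 xs"
    and num: "\<And>i. 0 \<le> i \<Longrightarrow> i < int (length xs) \<Longrightarrow> coef N (3 * i + 2) = num i"
    and van: "vanishes_on (3 * t) S 2 xs"
    and S: "list_all (\<lambda>s. s mod 3 = 2) S"
    and m: "m < 3 * length xs + 2" "int m mod (3 * t) \<in> set S"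
  shows "fps_nth D m = 0"
proof -
  have "int m mod (3 * t) mod 3 = 2" using S m(2) by (simp add: list_all_iff)
  then have "int m mod 3 = 2" by (simp add: mod_mod_cancel)
  then have i: "m = 3 * (m div 3) + 2" by presburger
  define i where "i = m div 3"
  note i = i[folded i_def]
  have len: "i < length xs" using m(1) i by simp
  have "tabulates (\<lambda>i. coef D (3 * i + 2)) 0 xs"
  proof (rule division_table[OF zero_less_one coef_trisect[OF N]])
    show "tabulates (\<lambda>m. coef N (3 * m + 2) + pent_sum 1 (entry xs) (m - 1) 1) 0 xs"
      using tab by (subst tabulates_cong[where g = "\<lambda>m. num m + pent_sum 1 (entry xs) (m - 1) 1"]) (simp_all add: num)
  qed
  from tabulates_nth[OF this len] have "coef D (3 * int i + 2) = xs ! i" by simp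
  moreover have "xs ! i = 0"
    by (rule vanishes_on_nth[OF van len]) (use m(2) i in \<open>simp add: add.commute\<close>)
  moreover have "nat (3 * int i + 2) = m" using i by simp
  ultimately show ?thesis by (simp add: coef_def)
qed

text \<open>For v = 0 there are two divisions: ys tabulates the quotient by
  \<open>fps_euler t\<close>, and xs the class 2 modulo 3 after the division by
  \<open>fps_euler 3\<close>.\<close>

lemma core_series_vanish_0:
  assumes t: "t > 0"
    and quot: "tabulates (\<lambda>m. square_coef m + pent_sum (int t) (entry ys) (m - int t) (int t)) 0 ys"
    and tab: "tabulates (\<lambda>m. entry ys (3 * m + 2) + pent_sum 1 (entry xs) (m - 1) 1) 0 xs"
    and len: "3 * length xs \<le> length ys"
    and van: "vanishes_on (3 * int t) S 2 xs"
    and S: "list_all (\<lambda>s. s mod 3 = 2) S"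
    and m: "m < 3 * length xs + 2" "int m mod (3 * int t) \<in> set S"
  shows "fps_nth (core_series t 0) m = 0"
proof (rule trisection_vanish[OF refl tab _ van S m])
  define N where "N = core_series t 0 * fps_euler 3"
  have "fps_euler t * N = fps_euler 1 * fps_euler 1"
    using core_series_mult[OF t, of 0] by (simp add: N_def mult_ac power2_eq_square)
  then have "coef N m = square_coef m + pent_sum (int t) (coef N) (m - int t) (int t)" for m
    using coef_euler_mult[of "int t" N m] t by (simp add: square_coef_def)
  then have T: "tabulates (coef N) 0 ys" by (rule division_table[rotated]) (use t quot in auto)
  fix i assume i: "0 \<le> i" "i < int (length xs)"
  then have "nat (3 * i + 2) < length ys" using len by linarith
  from tabulates_nth[OF T this] show "coef (core_series t 0 * fps_euler 3) (3 * i + 2) = entry ys (3 * i + 2)"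
    using i by (simp add: N_def entry_def)
qed

text \<open>For v = 2 one factor \<open>fps_euler t\<close> cancels and the other is multiplied out
  by the pentagonal recursion, which leaves the division by \<open>fps_euler 3\<close>.\<close>

lemma core_series_vanish_2:
  assumes t: "t > 0"
    and tab: "tabulates (\<lambda>m. (square_coef (3 * m + 2) - pent_sum (int t) square_coef (3 * m + 2 - int t) (int t)) +
      pent_sum 1 (entry xs) (m - 1) 1) 0 xs"
    and van: "vanishes_on (3 * int t) S 2 xs"
    and S: "list_all (\<lambda>s. s mod 3 = 2) S"
    and m: "m < 3 * length xs + 2" "int m mod (3 * int t) \<in> set S"
  shows "fps_nth (core_series t 2) m = 0"
proof (rule trisection_vanish[OF _ tab _ van S m])
  show "core_series t 2 * fps_euler 3 = fps_euler t * (fps_euler 1 * fps_euler 1)"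
  proof -
    have "(fps_euler t :: int fps) \<noteq> 0" by (metis fps_euler_nth_0 fps_zero_nth t zero_neq_one)
    moreover have "core_series t 2 * fps_euler 3 * fps_euler t = fps_euler t * (fps_euler 1 * fps_euler 1) * fps_euler t"
      using core_series_mult[OF t, of 2] by (simp add: mult_ac power2_eq_square)
    ultimately show ?thesis by simp
  qed
  show "coef (fps_euler t * (fps_euler 1 * fps_euler 1)) (3 * i + 2) =
      square_coef (3 * i + 2) - pent_sum (int t) square_coef (3 * i + 2 - int t) (int t)" for i
    using coef_euler_mult[of "int t" "fps_euler 1 * fps_euler 1" "3 * i + 2"] t by (simp add: square_coef_def)
qed

section \<open>Specialisation at \<zeta> = 1 and at a cube root of unity\<close>

lemma eval1_factor:
  fixes P :: "laurent fps"
  assumes n: "n \<ge> 1" and P: "fps_map at_zeta_one P = (1 - fps_X ^ (t * n)) ^ c" and ac: "a + c = t"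
  shows "fps_map at_zeta_one ((1 - fps_X ^ n) * (1 - fps_X ^ (t * n)) ^ a * P * fps_recip (pm 1 n)) = core_factor t n"
proof -
  have p0: "fps_nth (pm 1 n) 0 = 1" using one_mod_q_nth[OF one_mod_q_pm[OF order_refl, of n 1], of 0] n by simp
  define x :: "int fps" where "x = 1 - fps_X ^ n"
  have x0: "fps_nth x 0 = 1" using n by (simp add: x_def)
  have i1: "x * fps_recip x = 1" by (rule fps_right_inverse) (simp add: x0)
  have "x\<^sup>2 * fps_recip (x\<^sup>2) = 1" by (rule fps_right_inverse) (simp add: fps_nth_power_0 x0)
  then have "x * fps_recip (x\<^sup>2) = fps_recip x * x * (x * fps_recip (x\<^sup>2))"
    using i1 by (simp add: mult.commute)
  also have "\<dots> = fps_recip x * (x\<^sup>2 * fps_recip (x\<^sup>2))" by (simp add: mult_ac power2_eq_square)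
  \<comment> \<open>At \<zeta> = 1 the numerator 1 - q ^ n cancels one of the two equal factors of
    \<open>pm 1 n\<close>.\<close>
  finally have i2: "x * fps_recip (x\<^sup>2) = fps_recip x" using \<open>x\<^sup>2 * fps_recip (x\<^sup>2) = 1\<close> by simp
  have "fps_map at_zeta_one ((1 - fps_X ^ n) * (1 - fps_X ^ (t * n)) ^ a * P * fps_recip (pm 1 n)) =
      (1 - fps_X ^ (t * n)) ^ (a + c) * (x * fps_recip (x\<^sup>2))"
    by (simp add: eval1.fps_map_mult eval1.fps_map_diff eval1.fps_map_power eval1.fps_map_recip[OF p0]
        eval1_pm P x_def power_add mult_ac)
  then show ?thesis unfolding i2 ac unfolding core_factor_def x_def .
qed

lemma evalw_pm_list:
  assumes "list_all (\<lambda>k. \<not> 3 dvd k) ks"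
  shows "fps_map eval_omega (prod_list (map (\<lambda>k. pm k m) ks)) * (1 - fps_X ^ m) ^ length ks =
    (1 - fps_X ^ (3 * m)) ^ length ks"
  using assms
proof (induction ks)
  case (Cons k ks)
  let ?P = "prod_list (map (\<lambda>k. pm k m) ks)"
  have "fps_map eval_omega (pm k m * ?P) * (1 - fps_X ^ m) ^ Suc (length ks) =
    (fps_map eval_omega (pm k m) * (1 - fps_X ^ m)) * (fps_map eval_omega ?P * (1 - fps_X ^ m) ^ length ks)"
    by (simp add: evalw.fps_map_mult mult_ac)
  also have "\<dots> = (1 - fps_X ^ (3 * m)) * (1 - fps_X ^ (3 * m)) ^ length ks"
    using Cons by (simp add: evalw_pm)
  finally show ?case by (simp only: list.map prod_list.Cons length_Cons power_Suc)
qed simp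

lemma eval1_pm_list:
  "fps_map at_zeta_one (prod_list (map (\<lambda>k. pm k m) ks)) = (1 - fps_X ^ m) ^ (2 * length ks)"
  by (induction ks) (simp_all add: eval1.fps_map_mult eval1_pm power_add[symmetric] power2_eq_square mult_ac)

text \<open>The equations \<open>exps\<close> count factors 1 - q ^ (t n). At \<zeta> = 1 each
  member of ks contributes two of them, to a total of t; at a cube root of unity each member removes
  one in exchange for 1 - q ^ (3 t n), which leaves the exponent v - 1.\<close>

theorem explains_core:
  fixes F :: "nat \<Rightarrow> laurent fps"
  assumes t: "prime t" "t > 3" and check: "sturm_check (int t) (int v) \<kappa> (int B) S" and \<kappa>: "\<kappa> \<ge> 0"
    and zero: "\<And>m. m < B \<Longrightarrow> int m mod int (3 * t) \<in> set S \<Longrightarrow> fps_nth (core_series t v) m = 0"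
    and one: "\<And>n. n \<ge> 1 \<Longrightarrow> one_mod_q n (F n)"
    and F: "\<And>n. F n = (1 - fps_X ^ n) * (1 - fps_X ^ (t * n)) ^ a *
      prod_list (map (\<lambda>k. pm k (t * n)) ks) * fps_recip (pm 1 n)"
    and ks: "list_all (\<lambda>k. \<not> 3 dvd k) ks"
    and exps: "a + 2 * length ks = t" "Suc a = length ks + v"
    and \<beta>: "\<beta> > 0" "\<beta> < 3 * t" "int \<beta> \<in> set S"
  shows "explains (q_product F) (core_partitions t) (3 * t) \<beta> 3"
proof -
  have t0: "t > 0" using t by simp
  define b where "b = length ks"
  have Pw: "fps_map eval_omega (prod_list (map (\<lambda>k. pm k (t * n)) ks)) * (1 - fps_X ^ (t * n)) ^ b =
      (1 - fps_X ^ (3 * t * n)) ^ b" for n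
    using evalw_pm_list[OF ks, of "t * n"] by (simp add: b_def mult_ac)
  define C where "C = q_product F"
  define D where "D = core_series t v"
  let ?D = "fps_map (of_int :: int \<Rightarrow> complex) D"
  have D: "D * (fps_euler 3 * fps_euler t) = fps_euler 1 ^ 2 * fps_euler t ^ v"
    unfolding D_def by (rule core_series_mult[OF t0])
  have "fps_map eval_omega C * fps_euler 3 * fps_euler t = fps_euler 1 ^ 2 * fps_euler t ^ v * fps_euler (3 * t) ^ b"
    unfolding C_def by (rule eval_omega_product[OF t0 one]) (simp_all add: F eval_omega_factor[OF _ Pw exps(2)[folded b_def] t0])
  moreover have "?D * fps_euler 3 * fps_euler t = fps_euler 1 ^ 2 * fps_euler t ^ v"
    using arg_cong[OF D, of "fps_map (of_int :: int \<Rightarrow> complex)"] t0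
    by (simp add: cplx.fps_map_mult cplx.fps_map_power fps_map_euler_of_int mult_ac)
  ultimately have "fps_map eval_omega C * fps_euler 3 * fps_euler t = ?D * fps_euler (3 * t) ^ b * fps_euler 3 * fps_euler t"
    by (simp add: mult_ac)
  moreover have "(fps_euler d :: complex fps) \<noteq> 0" if "d > 0" for d
    by (metis fps_euler_nth_0 fps_zero_nth that zero_neq_one)
  ultimately have CD: "fps_map eval_omega C = ?D * fps_euler (3 * t) ^ b" using t0 by simp
  have supp: "fps_nth (fps_euler (3 * t) ^ b :: complex fps) i = 0" if "\<not> 3 * t dvd i" for i
    by (rule fps_power_support[OF _ that]) (use t0 in \<open>simp add: fps_euler_support\<close>)
  have dvd: "poly_at_zeta [:1, 1, 1:] dvd fps_nth C (3 * t * n + \<beta>)" for n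
  proof (rule phi3_dvd_iff)
    have "fps_nth (?D * fps_euler (3 * t) ^ b) (3 * t * n + \<beta>) = 0"
    proof (rule class_mult_vanish[OF supp, where B = "Suc (3 * t * n + \<beta>)"])
      fix m assume "m mod (3 * t) = \<beta>"
      then have "int m mod int (3 * t) \<in> set S" using \<beta>(3) by (simp only: zmod_int[symmetric])
      then have "fps_nth D m = 0"
        unfolding D_def by (rule core_coeffs_vanish[OF t check \<kappa> core_series_mult[OF t0] zero, rotated 2])
      then show "fps_nth ?D m = 0" by simp
    qed (use \<beta>(2) in simp_all)
    then show "eval_omega (fps_nth C (3 * t * n + \<beta>)) = 0" by (metis CD fps_map_nth)
  qed
  have one': "fps_at_zeta_one C = Abs_fps (core_partitions t)"
  proof -
    have "fps_map at_zeta_one C = q_product (\<lambda>n. fps_map at_zeta_one (F n))"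
      unfolding C_def by (rule eval1.fps_map_q_product[OF one])
    also have "\<dots> = q_product (core_factor t)"
      by (rule q_product_cong) (simp add: F eval1_factor[OF _ eval1_pm_list exps(1)])
    finally show ?thesis unfolding fps_at_zeta_one_eq by (simp add: core_partitions_def fps_eq_iff)
  qed
  \<comment> \<open>Reading off coefficients at \<zeta> = 1 turns the divisibility into the
    congruence for the core numbers.\<close>
  have "core_partitions t m = at_zeta_one (fps_nth C m)" for m
    using arg_cong[OF one', of "\<lambda>f. fps_nth f m"] by (simp add: fps_at_zeta_one_def)
  then show ?thesis unfolding explains_def C_def[symmetric]
    using dvd at_zeta_one_phi3_dvd[OF dvd] one' \<beta>(1) t0 by (simp add: cyclotomic_poly_3 cong_0_iff)
qed

section \<open>The cases t = 7, 11, 17, 19\<close>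

lemma length_core7_list: "length core7_list = 37"
proof -
  have "int (length core7_list) = 37"
    by (simp only: core7_list_def table_eval length_append of_nat_add)
  then show ?thesis by simp
qed

lemma length_core11_list: "length core11_list = 86"
proof -
  have "int (length core11_list) = 86"
    by (simp only: core11_list_def table_eval length_append of_nat_add)
  then show ?thesis by simp
qed

lemma length_quot11_list: "length quot11_list = 260"
proof -
  have "int (length quot11_list) = 260"
    by (simp only: quot11_list_def table_eval length_append of_nat_add)
  then show ?thesis by simp
qed

lemma length_core17_list: "length core17_list = 302"
proof -
  have "int (length core17_list) = 302"
    by (simp only: core17_list_def table_eval length_append of_nat_add)
  then show ?thesis by simp
qed

lemma length_quot17_list: "length quot17_list = 907"
proof -
  have "int (length quot17_list) = 907"
    by (simp only: quot17_list_def table_eval length_append of_nat_add)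
  then show ?thesis by simp
qed

lemma length_core19_list: "length core19_list = 502"
proof -
  have "int (length core19_list) = 502"
    by (simp only: core19_list_def table_eval length_append of_nat_add)
  then show ?thesis by simp
qed

lemma vanishes_on_core7: "vanishes_on 21 [8, 11, 17] 2 core7_list"
  by code_simp

lemma core7_vanish:
  assumes "m < 111" "int m mod int (3 * 7) \<in> set [8, 11, 17]"
  shows "fps_nth (core_series 7 2) m = 0"
  by (rule core_series_vanish_2[where xs = core7_list and S = "[8, 11, 17]"])
     (use assms core7_list_check vanishes_on_core7 in
       \<open>simp_all add: length_core7_list\<close>)

lemma vanishes_on_core11: "vanishes_on 33 [11, 20, 26, 29, 32] 2 core11_list"
  by code_simp

lemma core11_vanish:
  assumes "m < 260" "int m mod int (3 * 11) \<in> set [11, 20, 26, 29, 32]"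
  shows "fps_nth (core_series 11 0) m = 0"
  by (rule core_series_vanish_0[where ys = quot11_list and xs = core11_list and S = "[11, 20, 26, 29, 32]"])
     (use assms quot11_list_check core11_list_check vanishes_on_core11 in
       \<open>simp_all add: length_core11_list length_quot11_list\<close>)

lemma vanishes_on_core17: "vanishes_on 51 [14, 20, 23, 26, 35, 38, 41, 47] 2 core17_list"
  by code_simp

lemma core17_vanish:
  assumes "m < 907" "int m mod int (3 * 17) \<in> set [14, 20, 23, 26, 35, 38, 41, 47]"
  shows "fps_nth (core_series 17 0) m = 0"
  by (rule core_series_vanish_0[where ys = quot17_list and xs = core17_list and S = "[14, 20, 23, 26, 35, 38, 41, 47]"])
     (use assms quot17_list_check core17_list_check vanishes_on_core17 in
       \<open>simp_all add: length_core17_list length_quot17_list\<close>)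

lemma vanishes_on_core19: "vanishes_on 57 [14, 17, 26, 35, 38, 41, 44, 50, 56] 2 core19_list"
  by code_simp

lemma core19_vanish:
  assumes "m < 1506" "int m mod int (3 * 19) \<in> set [14, 17, 26, 35, 38, 41, 44, 50, 56]"
  shows "fps_nth (core_series 19 2) m = 0"
  by (rule core_series_vanish_2[where xs = core19_list and S = "[14, 17, 26, 35, 38, 41, 44, 50, 56]"])
     (use assms core19_list_check vanishes_on_core19 in
       \<open>simp_all add: length_core19_list\<close>)

text \<open>The parameters are read off from \<open>factor7\<close>: a is the exponent of 1 - q ^ (7
  n), ks lists the exponents of \<zeta> in the numerator, and v = a + 1 - \<open>length ks\<close>.
  The other three cases follow the same pattern.\<close>

lemma explains_core7:
  assumes "\<beta> \<in> {8, 11, 17}"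
  shows "explains C7 (core_partitions 7) 21 \<beta> 3"
proof -
  have "explains (q_product factor7) (core_partitions 7) (3 * 7) \<beta> 3"
    by (rule explains_core[where v = 2 and \<kappa> = 2 and B = 111 and a = 3 and ks = "[2, 4]",
          OF _ _ _ _ core7_vanish one_mod_q_factors(2)])
       (use assms sturm_check_7 in \<open>auto simp: factor7_def mult.assoc\<close>)
  then show ?thesis by (simp add: C7_def)
qed

lemma explains_core11:
  assumes "\<beta> \<in> {11, 20, 26, 29, 32}"
  shows "explains C11 (core_partitions 11) 33 \<beta> 3"
proof -
  have "explains (q_product factor11) (core_partitions 11) (3 * 11) \<beta> 3"
    by (rule explains_core[where v = 0 and \<kappa> = 2 and B = 260 and a = 3 and ks = "[2, 4, 8, 10]",
          OF _ _ _ _ core11_vanish one_mod_q_factors(3)])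
       (use assms sturm_check_11 in \<open>auto simp: factor11_def mult.assoc\<close>)
  then show ?thesis by (simp add: C11_def)
qed

lemma explains_core17:
  assumes "\<beta> \<in> {14, 20, 23, 26, 35, 38, 41, 47}"
  shows "explains C17 (core_partitions 17) 51 \<beta> 3"
proof -
  have "explains (q_product factor17) (core_partitions 17) (3 * 17) \<beta> 3"
    by (rule explains_core[where v = 0 and \<kappa> = 3 and B = 907 and a = 5 and ks = "[2, 4, 8, 10, 14, 16]",
          OF _ _ _ _ core17_vanish one_mod_q_factors(4)])
       (use assms sturm_check_17 in \<open>auto simp: factor17_def mult.assoc\<close>)
  then show ?thesis by (simp add: C17_def)
qed

lemma explains_core19:
  assumes "\<beta> \<in> {14, 17, 26, 35, 38, 41, 44, 50, 56}"
  shows "explains C19 (core_partitions 19) 57 \<beta> 3"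
proof -
  have "explains (q_product factor19) (core_partitions 19) (3 * 19) \<beta> 3"
    by (rule explains_core[where v = 2 and \<kappa> = 4 and B = 1506 and a = 7 and ks = "[2, 4, 8, 10, 14, 16]",
          OF _ _ _ _ core19_vanish one_mod_q_factors(5)])
       (use assms sturm_check_19 in \<open>auto simp: factor19_def mult.assoc\<close>)
  then show ?thesis by (simp add: C19_def)
qed

theorem theorem1p3:
  shows "(\<forall>\<beta>\<in>{8, 11, 17}. explains C7 (core_partitions 7) 21 \<beta> 3) \<and>
    (\<forall>\<beta>\<in>{11, 20, 26, 29, 32}. explains C11 (core_partitions 11) 33 \<beta> 3) \<and>
    (\<forall>\<beta>\<in>{14, 20, 23, 26, 35, 38, 41, 47}. explains C17 (core_partitions 17) 51 \<beta> 3) \<and>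
    (\<forall>\<beta>\<in>{14, 17, 26, 35, 38, 41, 44, 50, 56}. explains C19 (core_partitions 19) 57 \<beta> 3)"
  using explains_core7 explains_core11 explains_core17 explains_core19 by blast

end
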